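(* Let $t>1$, let $a,b\in H^{1/2}(\mathcal S^1,\mathbb R^m)$ and define $f\in H^{1/2}(\partial A_t,\mathbb R^m)$ by setting $f(e^{i\theta})=a(e^{i\theta})$, $f(te^{i\theta})=b(e^{i\theta})$. Then the Dirichlet energy of the harmonic extension $\tilde f\in H^1(A_t,\mathbb R^m)$ is given by $$\frac1{2\pi}\int_{A_t}|\nabla\tilde f|^2=\sum_{n\in\mathbb Z}|n|(|a_n|^2+|b_n|^2)+\frac{|b_0-a_0|^2}{\log t}+\sum_{n>0}n\Big(\frac{4}{t^{2n}-1}(|a_n|^2+|b_n|^2)-\frac{8t^n}{t^{2n}-1}\Re(a_n\cdot\overline{b_n})\Big)$$ $$=\frac1{2\pi}\Big[\|(-\Delta)^{1/4}a\|_{L^2(\mathcal S^1)}^2+\|(-\Delta)^{1/4}b\|_{L^2(\mathcal S^1)}^2+\mathcal B_t((a,b),(a,b))\Big],$$ where $\mathcal B_t:\mathcal D'(\mathcal S^1,\mathbb R^m)^2\times\mathcal D'(\mathcal S^1,\mathbb R^m)^2\to\mathbb R$ is a compact symmetric bilinear functional.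
   Context: $A_t:=\overline{B}_t\setminus B_1\subset\mathbb C$ is the annulus $\{1\le|z|\le t\}$ with the Euclidean metric, and $\mathcal S^1=\partial B_1$. $\mathcal D'(\mathcal S^1,\mathbb R^m)$ is the space of $\mathbb R^m$-valued distributions on $\mathcal S^1$. For $a\in\mathcal D'(\mathcal S^1,\mathbb R^m)$, $a_n:=\frac1{2\pi}\int_0^{2\pi}a(e^{i\theta})e^{-in\theta}\,d\theta\in\mathbb C^m$ ($n\in\mathbb Z$) are the Fourier coefficients (the integral being the distributional pairing), and similarly for $b,c,d$; $\cdot$ is the bilinear dot product. $(-\Delta)^{1/4}$ on $\mathcal S^1$ multiplies the $n$-th Fourier coefficient by $|n|^{1/2}$, so $\|(-\Delta)^{1/4}a\|_{L^2(\mathcal S^1)}^2=2\pi\sum_n|n||a_n|^2$. The harmonic extension $\tilde f$ is the unique harmonic map in $H^1(A_t,\mathbb R^m)$ with trace $f$ on $\partial A_t$. The functional $\mathcal B_t$ is $$\mathcal B_t((a,b),(c,d)):=2\pi\frac{(b_0-a_0)\cdot(d_0-c_0)}{\log t}+\sum_{n>0}\frac{8\pi n}{t^{2n}-1}\Re\big(a_n\cdot\overline{c_n}+b_n\cdot\overline{d_n}-t^na_n\cdot\overline{d_n}-t^nb_n\cdot\overline{c_n}\big).$$ *)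

theory Defs
  imports "HOL-Analysis.Analysis"
begin

section \<open>Distributions on the circle\<close>

text \<open>
  Functions on the unit circle are tested against smooth functions of the angle, that is, against
  real-valued smooth \<open>2\<pi>\<close>-periodic functions on the line.
\<close>

definition smooth_periodic :: "(real \<Rightarrow> real) set" where
  "smooth_periodic = {\<phi>. (\<forall>x. \<phi> (x + 2 * pi) = \<phi> x) \<and>
     (\<forall>k x. (deriv ^^ k) \<phi> field_differentiable (at x))}"

lemma higher_deriv_lincomb:
  fixes f g :: "real \<Rightarrow> real"
  assumes "f \<in> smooth_periodic" "g \<in> smooth_periodic"
  shows "(deriv ^^ k) (\<lambda>x. c * f x + d * g x) =
    (\<lambda>x. c * (deriv ^^ k) f x + d * (deriv ^^ k) g x)"
proof (induction k)
  case (Suc k)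
  have f: "(deriv ^^ k) f field_differentiable (at x)" and g: "(deriv ^^ k) g field_differentiable (at x)" for x
    using assms by (auto simp: smooth_periodic_def)
  have "deriv (\<lambda>x. c * (deriv ^^ k) f x + d * (deriv ^^ k) g x) x =
      c * deriv ((deriv ^^ k) f) x + d * deriv ((deriv ^^ k) g) x" for x
    by (rule DERIV_imp_deriv)
      (intro derivative_intros DERIV_cmult field_differentiable_derivI[OF f] field_differentiable_derivI[OF g])
  then show ?case using Suc by auto
qed auto

lemma smooth_periodic_lincomb:
  assumes "f \<in> smooth_periodic" "g \<in> smooth_periodic"
  shows "(\<lambda>x. c * f x + d * g x) \<in> smooth_periodic"
  using assms higher_deriv_lincomb[OF assms]
  by (auto simp: smooth_periodic_def intro!: derivative_intros)

lemma higher_deriv_trig: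
  "\<exists>A' B'. (deriv ^^ k) (\<lambda>x. A * cos (w * x) + B * sin (w * x)) =
    (\<lambda>x::real. A' * cos (w * x) + B' * sin (w * x))"
proof (induction k)
  case (Suc k)
  then obtain A' B' where e: "(deriv ^^ k) (\<lambda>x. A * cos (w * x) + B * sin (w * x)) =
    (\<lambda>x::real. A' * cos (w * x) + B' * sin (w * x))" by blast
  have 1: "deriv (\<lambda>x::real. A' * cos (w * x) + B' * sin (w * x)) =
      (\<lambda>x. (B' * w) * cos (w * x) + (- A' * w) * sin (w * x))"
    by (rule ext, rule DERIV_imp_deriv) (auto intro!: derivative_eq_intros)
  then have "(deriv ^^ Suc k) (\<lambda>x. A * cos (w * x) + B * sin (w * x)) =
      (\<lambda>x. (B' * w) * cos (w * x) + (- A' * w) * sin (w * x))"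
    using e 1 by simp
  then show ?case by blast
qed auto

lemma smooth_periodic_trig:
  "(\<lambda>x. A * cos (of_int n * x) + B * sin (of_int n * x)) \<in> smooth_periodic"
proof -
  have "(deriv ^^ k) (\<lambda>x. A * cos (of_int n * x) + B * sin (of_int n * x)) field_differentiable (at x)" for k x
  proof -
    obtain A' B' where e: "(deriv ^^ k) (\<lambda>x. A * cos (of_int n * x) + B * sin (of_int n * x)) =
      (\<lambda>x::real. A' * cos (of_int n * x) + B' * sin (of_int n * x))"
      using higher_deriv_trig by blast
    show ?thesis unfolding e field_differentiable_def
      by (rule exI) (auto intro!: derivative_eq_intros)
  qed
  moreover have "cos (of_int n * (x + 2 * pi)) = cos (of_int n * x)"
    "sin (of_int n * (x + 2 * pi)) = sin (of_int n * x)" for x :: real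
    using cos_int_2pin[of n] sin_int_2pin[of n]
    by (simp_all add: distrib_left cos_add sin_add mult_ac)
  ultimately show ?thesis by (simp add: smooth_periodic_def)
qed

typedef circle_test = smooth_periodic
  using smooth_periodic_trig by blast

setup_lifting type_definition_circle_test

instantiation circle_test :: real_vector
begin

lift_definition zero_circle_test :: circle_test is "\<lambda>_. 0"
  using smooth_periodic_trig[of 0 0 0] by simp

lift_definition plus_circle_test :: "circle_test \<Rightarrow> circle_test \<Rightarrow> circle_test"
  is "\<lambda>f g x. f x + g x"
  using smooth_periodic_lincomb[of _ _ 1 1] by simp

lift_definition minus_circle_test :: "circle_test \<Rightarrow> circle_test \<Rightarrow> circle_test"
  is "\<lambda>f g x. f x - g x"
  using smooth_periodic_lincomb[of _ _ 1 "-1"] by simp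

lift_definition uminus_circle_test :: "circle_test \<Rightarrow> circle_test"
  is "\<lambda>f x. - f x"
  using smooth_periodic_lincomb[of _ _ "-1" 0] by fastforce

lift_definition scaleR_circle_test :: "real \<Rightarrow> circle_test \<Rightarrow> circle_test"
  is "\<lambda>c f x. c * f x"
  using smooth_periodic_lincomb[of _ _ _ 0] by fastforce

instance
  by standard (transfer; auto simp: algebra_simps)+

end

definition Ck_norm :: "nat \<Rightarrow> circle_test \<Rightarrow> real" where
  "Ck_norm N \<phi> = (SUP x. \<Sum>k\<le>N. \<bar>(deriv ^^ k) (Rep_circle_test \<phi>) x\<bar>)"

lemma higher_deriv_periodic:
  assumes "f \<in> smooth_periodic"
  shows "(deriv ^^ k) f (x + 2 * pi) = (deriv ^^ k) f x"
proof (induction k arbitrary: x)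
  case 0
  then show ?case using assms by (simp add: smooth_periodic_def)
next
  case (Suc k)
  have "(deriv ^^ k) f field_differentiable (at (x + 2 * pi))"
    using assms by (simp add: smooth_periodic_def)
  then have "((deriv ^^ k) f has_field_derivative deriv ((deriv ^^ k) f) (x + 2 * pi)) (at (x + 2 * pi))"
    by (rule field_differentiable_derivI)
  then have "((\<lambda>y. (deriv ^^ k) f (y + 2 * pi)) has_field_derivative
      deriv ((deriv ^^ k) f) (x + 2 * pi)) (at x)"
    by (simp add: DERIV_shift)
  then show ?case using DERIV_imp_deriv Suc.IH by fastforce
qed

lemma Ck_norm_bdd: "bdd_above (range (\<lambda>x. \<Sum>k\<le>N. \<bar>(deriv ^^ k) (Rep_circle_test \<phi>) x\<bar>))"
proof -
  define h where "h = (\<lambda>x. \<Sum>k\<le>N. \<bar>(deriv ^^ k) (Rep_circle_test \<phi>) x\<bar>)"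
  have mem: "Rep_circle_test \<phi> \<in> smooth_periodic" by (rule Rep_circle_test)
  have "continuous_on S ((deriv ^^ k) (Rep_circle_test \<phi>))" for k S
    using mem unfolding smooth_periodic_def
    by (auto intro!: continuous_at_imp_continuous_on field_differentiable_imp_continuous_at)
  then have "continuous_on {0..2*pi} h"
    unfolding h_def by (intro continuous_intros)
  then have bdd: "bdd_above (h ` {0..2*pi})"
    by (meson bounded_imp_bdd_above compact_Icc compact_continuous_image compact_imp_bounded)
  have per: "h (x + 2 * pi) = h x" for x
    unfolding h_def using higher_deriv_periodic[OF mem] by simp
  have pern: "h (x + of_nat n * (2 * pi)) = h x" for x n
  proof (induction n)
    case (Suc n)
    then show ?case using per[of "x + of_nat n * (2 * pi)"] by (simp add: algebra_simps)
  qed simp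
  have peri: "h (x + of_int n * (2 * pi)) = h x" for x n
  proof (cases n rule: int_cases2)
    case (nonneg m) then show ?thesis using pern by simp
  next
    case (nonpos m) then show ?thesis using pern[of "x - of_nat m * (2 * pi)" m] by simp
  qed
  have "h x \<in> h ` {0..2*pi}" for x
  proof -
    let ?m = "\<lfloor>x / (2 * pi)\<rfloor>"
    have x: "x = x / (2 * pi) * (2 * pi)" by simp
    have "of_int ?m * (2 * pi) \<le> x / (2 * pi) * (2 * pi)"
      by (rule mult_right_mono) (simp_all add: of_int_floor_le)
    moreover have "x / (2 * pi) * (2 * pi) \<le> (of_int ?m + 1) * (2 * pi)"
      by (rule mult_right_mono) (linarith, simp)
    ultimately have "of_int ?m * (2 * pi) \<le> x" "x \<le> of_int ?m * (2 * pi) + 2 * pi"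
      unfolding x[symmetric] by (auto simp: distrib_right)
    then have "x + of_int (- ?m) * (2 * pi) \<in> {0..2*pi}" by simp
    then show ?thesis using peri[of x "- ?m"] by (metis image_eqI)
  qed
  then have "range h \<subseteq> h ` {0..2*pi}" by blast
  with bdd have "bdd_above (range h)" by (rule bdd_above_mono)
  then show ?thesis by (simp add: h_def)
qed

lemma Ck_norm_upper: "(\<Sum>k\<le>N. \<bar>(deriv ^^ k) (Rep_circle_test \<phi>) x\<bar>) \<le> Ck_norm N \<phi>"
  unfolding Ck_norm_def by (rule cSUP_upper[OF _ Ck_norm_bdd]) simp

lemma Ck_norm_nonneg: "0 \<le> Ck_norm N \<phi>"
  by (rule order_trans[OF _ Ck_norm_upper[of \<phi> 0 N]]) (simp add: sum_nonneg)

lemma Ck_norm_mono: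
  assumes "N \<le> M"
  shows "Ck_norm N \<phi> \<le> Ck_norm M \<phi>"
  unfolding Ck_norm_def[of N]
proof (rule cSUP_least)
  fix x
  have "(\<Sum>k\<le>N. \<bar>(deriv ^^ k) (Rep_circle_test \<phi>) x\<bar>) \<le> (\<Sum>k\<le>M. \<bar>(deriv ^^ k) (Rep_circle_test \<phi>) x\<bar>)"
    using assms by (intro sum_mono2) auto
  then show "(\<Sum>k\<le>N. \<bar>(deriv ^^ k) (Rep_circle_test \<phi>) x\<bar>) \<le> Ck_norm M \<phi>"
    using Ck_norm_upper[of \<phi> x M] by simp
qed simp

text \<open>
  The elements of \<open>\<D>'(\<S>\<^sup>1, \<real>\<^sup>m)\<close>: linear maps on test functions that are continuous for the
  Frechet topology defined by the norms \<^const>\<open>Ck_norm\<close>.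
\<close>

typedef (overloaded) 'm circle_distr =
  "{T :: circle_test \<Rightarrow> real ^ 'm::finite. linear T \<and> (\<exists>N C. \<forall>\<phi>. norm (T \<phi>) \<le> C * Ck_norm N \<phi>)}"
  morphisms distr_pairing Abs_circle_distr
  by (rule exI[of _ "\<lambda>_. 0"]) (auto simp: linear_0 intro!: exI[of _ 0] module_hom_zero)

setup_lifting type_definition_circle_distr

lemma continuous_lincomb:
  fixes S T :: "circle_test \<Rightarrow> real ^ 'm::finite"
  assumes "\<exists>N C. \<forall>\<phi>. norm (S \<phi>) \<le> C * Ck_norm N \<phi>" "\<exists>N C. \<forall>\<phi>. norm (T \<phi>) \<le> C * Ck_norm N \<phi>"
  shows "\<exists>N C. \<forall>\<phi>. norm (c *\<^sub>R S \<phi> + d *\<^sub>R T \<phi>) \<le> C * Ck_norm N \<phi>"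
proof -
  obtain N C where S: "\<And>\<phi>. norm (S \<phi>) \<le> C * Ck_norm N \<phi>" using assms(1) by blast
  obtain M D where T: "\<And>\<phi>. norm (T \<phi>) \<le> D * Ck_norm M \<phi>" using assms(2) by blast
  let ?L = "max N M"
  have "norm (c *\<^sub>R S \<phi> + d *\<^sub>R T \<phi>) \<le> (\<bar>c\<bar> * \<bar>C\<bar> + \<bar>d\<bar> * \<bar>D\<bar>) * Ck_norm ?L \<phi>" for \<phi>
  proof -
    have "norm (S \<phi>) \<le> \<bar>C\<bar> * Ck_norm ?L \<phi>"
      using S[of \<phi>] Ck_norm_mono[of N ?L \<phi>] Ck_norm_nonneg[of N \<phi>]
      by (smt (verit) max.cobounded1 mult_mono mult_right_mono)
    moreover have "norm (T \<phi>) \<le> \<bar>D\<bar> * Ck_norm ?L \<phi>"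
      using T[of \<phi>] Ck_norm_mono[of M ?L \<phi>] Ck_norm_nonneg[of M \<phi>]
      by (smt (verit) max.cobounded2 mult_mono mult_right_mono)
    ultimately have "\<bar>c\<bar> * norm (S \<phi>) + \<bar>d\<bar> * norm (T \<phi>) \<le>
        \<bar>c\<bar> * (\<bar>C\<bar> * Ck_norm ?L \<phi>) + \<bar>d\<bar> * (\<bar>D\<bar> * Ck_norm ?L \<phi>)"
      by (intro add_mono mult_left_mono) auto
    moreover have "norm (c *\<^sub>R S \<phi> + d *\<^sub>R T \<phi>) \<le> \<bar>c\<bar> * norm (S \<phi>) + \<bar>d\<bar> * norm (T \<phi>)"
      by (metis norm_scaleR norm_triangle_ineq)
    ultimately show ?thesis by (simp add: algebra_simps)
  qed
  then show ?thesis by blast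
qed

lemma continuous_functional_lincomb:
  fixes S T :: "circle_test \<Rightarrow> real ^ 'm::finite"
  assumes "linear S \<and> (\<exists>N C. \<forall>\<phi>. norm (S \<phi>) \<le> C * Ck_norm N \<phi>)"
    "linear T \<and> (\<exists>N C. \<forall>\<phi>. norm (T \<phi>) \<le> C * Ck_norm N \<phi>)"
  shows "linear (\<lambda>\<phi>. c *\<^sub>R S \<phi> + d *\<^sub>R T \<phi>) \<and>
    (\<exists>N C. \<forall>\<phi>. norm (c *\<^sub>R S \<phi> + d *\<^sub>R T \<phi>) \<le> C * Ck_norm N \<phi>)"
  using assms by (intro conjI continuous_lincomb linear_compose_add linear_compose_scale_right) auto

instantiation circle_distr :: (finite) real_vector
begin

lift_definition zero_circle_distr :: "'a circle_distr" is "\<lambda>_. 0"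
  by (auto simp: linear_iff intro!: exI[of _ 0])

lift_definition plus_circle_distr :: "'a circle_distr \<Rightarrow> 'a circle_distr \<Rightarrow> 'a circle_distr"
  is "\<lambda>S T \<phi>. S \<phi> + T \<phi>"
  subgoal for S T using continuous_functional_lincomb[of S T 1 1] by simp
  done

lift_definition minus_circle_distr :: "'a circle_distr \<Rightarrow> 'a circle_distr \<Rightarrow> 'a circle_distr"
  is "\<lambda>S T \<phi>. S \<phi> - T \<phi>"
  subgoal for S T using continuous_functional_lincomb[of S T 1 "-1"] by simp
  done

lift_definition uminus_circle_distr :: "'a circle_distr \<Rightarrow> 'a circle_distr"
  is "\<lambda>S \<phi>. - S \<phi>"
  subgoal for S using continuous_functional_lincomb[of S S "-1" 0] by simp
  done

lift_definition scaleR_circle_distr :: "real \<Rightarrow> 'a circle_distr \<Rightarrow> 'a circle_distr"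
  is "\<lambda>c S \<phi>. c *\<^sub>R S \<phi>"
  subgoal for c S using continuous_functional_lincomb[of S S c 0] by simp
  done

instance
  by standard (transfer; auto simp: algebra_simps)+

end

text \<open>
  \<open>\<D>'\<close> carries the strong dual topology, that is, the topology of uniform convergence on bounded
  sets of test functions.
\<close>

definition bounded_tests :: "circle_test set \<Rightarrow> bool" where
  "bounded_tests K \<longleftrightarrow> (\<forall>N. bdd_above (Ck_norm N ` K))"

lemma bounded_tests_Un: "bounded_tests K \<Longrightarrow> bounded_tests L \<Longrightarrow> bounded_tests (K \<union> L)"
  by (auto simp: bounded_tests_def image_Un)

instantiation circle_distr :: (finite) topological_space
begin

definition open_circle_distr :: "'a circle_distr set \<Rightarrow> bool" where
  "open U \<longleftrightarrow> (\<forall>T\<in>U. \<exists>K \<epsilon>. bounded_tests K \<and> \<epsilon> > 0 \<and>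
     {S. \<forall>\<phi>\<in>K. norm (distr_pairing S \<phi> - distr_pairing T \<phi>) < \<epsilon>} \<subseteq> U)"

instance
proof
  show "open (UNIV :: 'a circle_distr set)"
    unfolding open_circle_distr_def
    by (auto simp: bounded_tests_def intro!: exI[of _ "{}"] exI[of _ 1])
next
  fix U V :: "'a circle_distr set"
  assume U: "open U" and V: "open V"
  show "open (U \<inter> V)"
    unfolding open_circle_distr_def
  proof
    fix T assume T: "T \<in> U \<inter> V"
    obtain K e where 1: "bounded_tests K" "e > 0"
      "{S. \<forall>\<phi>\<in>K. norm (distr_pairing S \<phi> - distr_pairing T \<phi>) < e} \<subseteq> U"
      using U T unfolding open_circle_distr_def by blast
    obtain L d where 2: "bounded_tests L" "d > 0"
      "{S. \<forall>\<phi>\<in>L. norm (distr_pairing S \<phi> - distr_pairing T \<phi>) < d} \<subseteq> V"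
      using V T unfolding open_circle_distr_def by blast
    show "\<exists>K \<epsilon>. bounded_tests K \<and> \<epsilon> > 0 \<and>
        {S. \<forall>\<phi>\<in>K. norm (distr_pairing S \<phi> - distr_pairing T \<phi>) < \<epsilon>} \<subseteq> U \<inter> V"
      using 1 2 by (intro exI[of _ "K \<union> L"] exI[of _ "min e d"]) (auto simp: bounded_tests_Un)
  qed
next
  fix \<U> :: "'a circle_distr set set"
  assume "\<forall>U\<in>\<U>. open U"
  then show "open (\<Union>\<U>)"
    unfolding open_circle_distr_def
    by (meson Union_iff Union_upper order_trans)
qed

end

subsection \<open>Fourier coefficients\<close>

lift_definition cos_test :: "int \<Rightarrow> circle_test" is "\<lambda>n x. cos (of_int n * x)"
  using smooth_periodic_trig[of 1 _ 0] by simp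

lift_definition sin_test :: "int \<Rightarrow> circle_test" is "\<lambda>n x. sin (of_int n * x)"
  using smooth_periodic_trig[of 0 _ 1] by simp

text \<open>\<open>a\<^sub>n = 1/(2\<pi>) \<langle>a, e\<^sup>-\<^sup>i\<^sup>n\<^sup>\<theta>\<rangle>\<close>, where \<open>e\<^sup>-\<^sup>i\<^sup>n\<^sup>\<theta> = cos n\<theta> - i sin n\<theta>\<close>.\<close>

definition fourier :: "'m::finite circle_distr \<Rightarrow> int \<Rightarrow> complex ^ 'm" where
  "fourier a n = (\<chi> j. (complex_of_real (distr_pairing a (cos_test n) $ j)
     - \<i> * complex_of_real (distr_pairing a (sin_test n) $ j)) / (2 * pi))"

definition cdot :: "complex ^ 'm::finite \<Rightarrow> complex ^ 'm \<Rightarrow> complex" (infixl \<open>\<cdot>\<close> 70) where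
  "x \<cdot> y = (\<Sum>j\<in>UNIV. x $ j * y $ j)"

definition vcnj :: "complex ^ 'm::finite \<Rightarrow> complex ^ 'm" where
  "vcnj x = (\<chi> j. cnj (x $ j))"

subsection \<open>Functions as distributions\<close>

definition L2_on :: "'a::euclidean_space set \<Rightarrow> ('a \<Rightarrow> 'b::euclidean_space) \<Rightarrow> bool" where
  "L2_on S f \<longleftrightarrow> f \<in> borel_measurable (lebesgue_on S) \<and>
     integrable (lebesgue_on S) (\<lambda>x. (norm (f x))\<^sup>2)"

text \<open>
  Functions on the circle are functions on \<open>\<complex>\<close> of which only the values on the circle matter.
  A non-integrable function is sent to \<open>0\<close>.
\<close>

lift_definition distr_of :: "(complex \<Rightarrow> real ^ 'm::finite) \<Rightarrow> 'm circle_distr" is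
  "\<lambda>g \<phi>. if integrable (lebesgue_on {0..2*pi}) (\<lambda>\<theta>. g (cis \<theta>))
     then (LINT \<theta>|lebesgue_on {0..2*pi}. Rep_circle_test \<phi> \<theta> *\<^sub>R g (cis \<theta>)) else 0"
proof -
  fix g :: "complex \<Rightarrow> real ^ 'm"
  let ?M = "lebesgue_on {0..2*pi}"
  let ?T = "\<lambda>\<phi>. if integrable ?M (\<lambda>\<theta>. g (cis \<theta>))
     then (LINT \<theta>|?M. Rep_circle_test \<phi> \<theta> *\<^sub>R g (cis \<theta>)) else 0"
  show "linear ?T \<and> (\<exists>N C. \<forall>\<phi>. norm (?T \<phi>) \<le> C * Ck_norm N \<phi>)"
  proof (cases "integrable ?M (\<lambda>\<theta>. g (cis \<theta>))")
    case True
    have bd: "\<bar>Rep_circle_test \<phi> x\<bar> \<le> Ck_norm 0 \<phi>" for \<phi> x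
      using Ck_norm_upper[of \<phi> x 0] by simp
    have meas: "Rep_circle_test \<phi> \<in> borel_measurable ?M" for \<phi>
    proof -
      have "(deriv ^^ 0) (Rep_circle_test \<phi>) field_differentiable (at x)" for x
        using Rep_circle_test[of \<phi>] unfolding smooth_periodic_def by blast
      then have "continuous_on UNIV (Rep_circle_test \<phi>)"
        by (auto intro!: continuous_at_imp_continuous_on field_differentiable_imp_continuous_at)
      then show ?thesis
        by (intro measurable_restrict_space1 measurable_completion)
          (simp add: borel_measurable_continuous_onI)
    qed
    have int: "integrable ?M (\<lambda>\<theta>. Rep_circle_test \<phi> \<theta> *\<^sub>R g (cis \<theta>))" for \<phi>
    proof (rule Bochner_Integration.integrable_bound)
      show "integrable ?M (\<lambda>\<theta>. Ck_norm 0 \<phi> *\<^sub>R g (cis \<theta>))" using True by simp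
      show "(\<lambda>\<theta>. Rep_circle_test \<phi> \<theta> *\<^sub>R g (cis \<theta>)) \<in> borel_measurable ?M"
        using meas True by (intro borel_measurable_scaleR) auto
      show "AE \<theta> in ?M. norm (Rep_circle_test \<phi> \<theta> *\<^sub>R g (cis \<theta>)) \<le> norm (Ck_norm 0 \<phi> *\<^sub>R g (cis \<theta>))"
        using bd Ck_norm_nonneg[of 0 \<phi>] by (intro AE_I2) (auto intro!: mult_right_mono)
    qed
    have "linear ?T"
      using True int
      by (auto simp: linear_iff plus_circle_test.rep_eq scaleR_circle_test.rep_eq scaleR_left_distrib
          simp flip: scaleR_scaleR)
    moreover have "norm (?T \<phi>) \<le> (LINT \<theta>|?M. norm (g (cis \<theta>))) * Ck_norm 0 \<phi>" for \<phi>
    proof -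
      have "norm (LINT \<theta>|?M. Rep_circle_test \<phi> \<theta> *\<^sub>R g (cis \<theta>))
          \<le> (LINT \<theta>|?M. norm (Rep_circle_test \<phi> \<theta> *\<^sub>R g (cis \<theta>)))"
        by (rule integral_norm_bound)
      also have "\<dots> \<le> (LINT \<theta>|?M. Ck_norm 0 \<phi> * norm (g (cis \<theta>)))"
        using integrable_norm[OF int[of \<phi>]] True bd
        by (intro integral_mono) (auto intro!: mult_right_mono)
      finally show ?thesis using True by (simp add: mult.commute)
    qed
    ultimately show ?thesis by blast
  next
    case False
    then show ?thesis by (auto simp: linear_iff intro!: exI[of _ 0])
  qed
qed

definition H_half :: "(complex \<Rightarrow> real ^ 'm::finite) set" where
  "H_half = {a. L2_on {0..2*pi} (\<lambda>\<theta>. a (cis \<theta>)) \<and>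
     (\<lambda>n::int. \<bar>of_int n\<bar> * (norm (fourier (distr_of a) n))\<^sup>2) summable_on UNIV}"

definition circle_L2_norm :: "(complex \<Rightarrow> real ^ 'm::finite) \<Rightarrow> real" where
  "circle_L2_norm g = sqrt (LINT \<theta>|lebesgue_on {0..2*pi}. (norm (g (cis \<theta>)))\<^sup>2)"

text \<open>
  \<open>(-\<Delta>)\<^sup>1\<^sup>/\<^sup>4 a\<close> for \<open>a\<close> in \<^const>\<open>H_half\<close>, as an element of \<open>L\<^sup>2\<close>; the chosen function is
  determined up to null sets by its Fourier coefficients.
\<close>

definition quarter_laplacian :: "(complex \<Rightarrow> real ^ 'm::finite) \<Rightarrow> complex \<Rightarrow> real ^ 'm" where
  "quarter_laplacian a = (SOME g. L2_on {0..2*pi} (\<lambda>\<theta>. g (cis \<theta>)) \<and>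
     (\<forall>n. fourier (distr_of g) n = sqrt \<bar>of_int n\<bar> *\<^sub>R fourier (distr_of a) n))"

section \<open>Sobolev functions and harmonic extensions on the annulus\<close>

primrec Ck_on :: "nat \<Rightarrow> 'a::real_normed_vector set \<Rightarrow> ('a \<Rightarrow> 'b::real_normed_vector) \<Rightarrow> bool" where
  "Ck_on 0 U f \<longleftrightarrow> continuous_on U f"
| "Ck_on (Suc k) U f \<longleftrightarrow> (\<forall>x\<in>U. f differentiable (at x)) \<and>
     (\<forall>v. Ck_on k U (\<lambda>x. frechet_derivative f (at x) v))"

definition smooth_on :: "'a::real_normed_vector set \<Rightarrow> ('a \<Rightarrow> 'b::real_normed_vector) \<Rightarrow> bool" where
  "smooth_on U f \<longleftrightarrow> (\<forall>k. Ck_on k U f)"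

text \<open>
  The gradient is the pair of partial derivatives in the directions \<open>1\<close> and \<open>\<i>\<close>; the norm of such a
  pair is the Euclidean (Hilbert-Schmidt) norm.
\<close>

definition grad :: "(complex \<Rightarrow> 'b::real_normed_vector) \<Rightarrow> complex \<Rightarrow> 'b \<times> 'b" where
  "grad u z = (frechet_derivative u (at z) 1, frechet_derivative u (at z) \<i>)"

definition laplacian :: "(complex \<Rightarrow> 'b::real_normed_vector) \<Rightarrow> complex \<Rightarrow> 'b" where
  "laplacian u z = (\<Sum>v\<in>{1, \<i>}. frechet_derivative (\<lambda>w. frechet_derivative u (at w) v) (at z) v)"

definition harmonic_on :: "complex set \<Rightarrow> (complex \<Rightarrow> 'b::real_normed_vector) \<Rightarrow> bool" where
  "harmonic_on U u \<longleftrightarrow> Ck_on 2 U u \<and> (\<forall>z\<in>U. laplacian u z = 0)"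

definition weak_gradient ::
  "complex set \<Rightarrow> (complex \<Rightarrow> 'b::euclidean_space) \<Rightarrow> (complex \<Rightarrow> 'b \<times> 'b) \<Rightarrow> bool" where
  "weak_gradient U F G \<longleftrightarrow>
     (\<forall>\<phi> :: complex \<Rightarrow> real. smooth_on UNIV \<phi> \<and> compact (closure {z. \<phi> z \<noteq> 0}) \<and> closure {z. \<phi> z \<noteq> 0} \<subseteq> U \<longrightarrow>
       (LINT z|lebesgue_on U. fst (grad \<phi> z) *\<^sub>R F z) = - (LINT z|lebesgue_on U. \<phi> z *\<^sub>R fst (G z)) \<and>
       (LINT z|lebesgue_on U. snd (grad \<phi> z) *\<^sub>R F z) = - (LINT z|lebesgue_on U. \<phi> z *\<^sub>R snd (G z)))"

definition H1 :: "complex set \<Rightarrow> (complex \<Rightarrow> 'b::euclidean_space) set" where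
  "H1 U = {F. L2_on U F \<and> (\<exists>G. L2_on U G \<and> weak_gradient U F G)}"

definition wgrad :: "complex set \<Rightarrow> (complex \<Rightarrow> 'b::euclidean_space) \<Rightarrow> complex \<Rightarrow> 'b \<times> 'b" where
  "wgrad U F = (SOME G. L2_on U G \<and> weak_gradient U F G)"

definition annulus :: "real \<Rightarrow> complex set" where
  "annulus t = cball 0 t - ball 0 1"

text \<open>
  The trace on \<open>\<partial>A\<^sub>t\<close> is the continuous extension to \<open>H\<^sup>1\<close> of the restriction map, with values in
  \<open>L\<^sup>2(\<partial>A\<^sub>t)\<close>: \<open>f\<close> is the trace of \<open>F\<close> if some sequence of functions smooth up to the boundary
  converges to \<open>F\<close> in \<open>H\<^sup>1\<close> while its restrictions converge to \<open>f\<close> in \<open>L\<^sup>2\<close> of both circles.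
\<close>

definition has_trace :: "real \<Rightarrow> (complex \<Rightarrow> 'b::euclidean_space) \<Rightarrow> (complex \<Rightarrow> 'b) \<Rightarrow> bool" where
  "has_trace t F f \<longleftrightarrow>
     (\<forall>r\<in>{1, t}. L2_on {0..2*pi} (\<lambda>\<theta>. f (of_real r * cis \<theta>))) \<and>
     (\<exists>u. (\<forall>k. smooth_on UNIV (u k)) \<and>
       (\<lambda>k. LINT z|lebesgue_on (annulus t). (norm (u k z - F z))\<^sup>2) \<longlonglongrightarrow> 0 \<and>
       (\<lambda>k. LINT z|lebesgue_on (annulus t).
          (norm (grad (u k) z - wgrad (interior (annulus t)) F z))\<^sup>2) \<longlonglongrightarrow> 0 \<and>
       (\<forall>r\<in>{1, t}. (\<lambda>k. LINT \<theta>|lebesgue_on {0..2*pi}.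
          (norm (u k (of_real r * cis \<theta>) - f (of_real r * cis \<theta>)))\<^sup>2) \<longlonglongrightarrow> 0))"

definition harmonic_extension ::
  "real \<Rightarrow> (complex \<Rightarrow> 'b::euclidean_space) \<Rightarrow> (complex \<Rightarrow> 'b) \<Rightarrow> bool" where
  "harmonic_extension t f F \<longleftrightarrow> F \<in> H1 (interior (annulus t)) \<and>
     harmonic_on (interior (annulus t)) F \<and> has_trace t F f"

definition dirichlet_energy :: "real \<Rightarrow> (complex \<Rightarrow> 'b::euclidean_space) \<Rightarrow> real" where
  "dirichlet_energy t F =
     (LINT z|lebesgue_on (annulus t). (norm (wgrad (interior (annulus t)) F z))\<^sup>2)"

section \<open>The bilinear form\<close>

definition form_term :: "real \<Rightarrow> 'm::finite circle_distr \<times> 'm circle_distr \<Rightarrow>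
    'm circle_distr \<times> 'm circle_distr \<Rightarrow> nat \<Rightarrow> real" where
  "form_term t = (\<lambda>(a, b) (c, d) n. 8 * pi * real n / (t ^ (2 * n) - 1) *
     Re (fourier a (int n) \<cdot> vcnj (fourier c (int n)) + fourier b (int n) \<cdot> vcnj (fourier d (int n))
       - t ^ n *\<^sub>R (fourier a (int n) \<cdot> vcnj (fourier d (int n)))
       - t ^ n *\<^sub>R (fourier b (int n) \<cdot> vcnj (fourier c (int n)))))"

text \<open>The zeroth coefficients are real vectors, so taking the real part of their product is harmless.\<close>

definition annulus_form :: "real \<Rightarrow> 'm::finite circle_distr \<times> 'm circle_distr \<Rightarrow>
    'm circle_distr \<times> 'm circle_distr \<Rightarrow> real" where
  "annulus_form t = (\<lambda>(a, b) (c, d).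
     2 * pi * (Re ((fourier b 0 - fourier a 0) \<cdot> (fourier d 0 - fourier c 0)) / ln t)
     + (\<Sum>\<^sub>\<infinity>n\<in>{0<..}. form_term t (a, b) (c, d) n))"

definition vN_bounded :: "'a::{real_vector, topological_space} set \<Rightarrow> bool" where
  "vN_bounded S \<longleftrightarrow> (\<forall>U. open U \<and> 0 \<in> U \<longrightarrow> (\<exists>c>0. S \<subseteq> (*\<^sub>R) c ` U))"

text \<open>
  A bilinear functional \<open>B\<close> on \<open>X\<close> is compact if the operator \<open>u \<mapsto> B(u, \<cdot>)\<close> from \<open>X\<close> to its strong
  dual \<open>X'\<close> is compact, i.e. maps some neighbourhood of \<open>0\<close> to a relatively compact set. Strong
  convergence in \<open>X'\<close> is uniform convergence on bounded sets. Relative compactness is expressed by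
  sequences; for \<open>X = \<D>'(\<S>\<^sup>1, \<real>\<^sup>m)\<^sup>2\<close> this is no restriction since \<open>X' = C\<^sup>\<infinity>(\<S>\<^sup>1, \<real>\<^sup>m)\<^sup>2\<close> is
  metrizable.
\<close>

definition compact_bilinear :: "('a::{real_vector, topological_space} \<Rightarrow> 'a \<Rightarrow> real) \<Rightarrow> bool" where
  "compact_bilinear B \<longleftrightarrow> (\<forall>u. continuous_on UNIV (B u)) \<and>
     (\<exists>U. open U \<and> 0 \<in> U \<and>
       (\<forall>u. range u \<subseteq> U \<longrightarrow>
         (\<exists>L r. linear L \<and> continuous_on UNIV L \<and> strict_mono (r :: nat \<Rightarrow> nat) \<and>
           (\<forall>S. vN_bounded S \<longrightarrow> uniform_limit S (\<lambda>k. B (u (r k))) L sequentially))))"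

end

theory Submission
  imports Defs "HOL-Complex_Analysis.Great_Picard"
begin

text \<open>
  In the coordinates \<open>z = exp (s + \<i> \<theta>)\<close> the annulus is the cylinder of height \<open>ln t\<close> over the circle.
  The coordinate change is conformal, so the area factor \<open>exp (2 s)\<close> turns the squared gradient
  in \<open>z\<close> into the squared gradient in \<open>(s, \<theta>)\<close> (\<open>nn_integral_annulus_logpolar\<close>,
  \<open>nn_integral_annulus_energy\<close>). Parseval's identity on each circle (\<open>parseval\<close>, obtained from
  \<open>riesz_fischer\<close> and the completeness of the trigonometric system) splits the energy into the
  contributions \<open>\<integral> |v\<^sub>n'|\<^sup>2 + n\<^sup>2 |v\<^sub>n|\<^sup>2 ds\<close> of the Fourier modes. Harmonicity means \<open>v\<^sub>n'' = n\<^sup>2 v\<^sub>n\<close>,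
  so a mode is determined by its values at the two ends, and its contribution is the explicit
  quadratic form \<open>mode_energy\<close> in these values.

  It remains to see that the end values are the Fourier coefficients of \<open>a\<close> and \<open>b\<close>. The trace is
  given by smooth functions \<open>u\<^sub>k\<close> that approximate \<open>F\<close> in \<open>H\<^sup>1\<close> and \<open>f\<close> on both circles. The argument
  (\<open>mode_limit\<close>) uses only the limit of the gradients of the \<open>u\<^sub>k\<close>, so the weak gradient never has to
  be compared with the classical gradient of \<open>F\<close>: the modes of the \<open>u\<^sub>k\<close> converge at \<open>s = 0\<close> and
  their derivatives converge in \<open>L\<^sup>2\<close>, hence the modes converge on the closed interval to a
  primitive of the corresponding mode of the weak gradient. This limit agrees almost everywhere
  with the mode of \<open>F\<close>, which solves the differential equation; so it is the solution with the
  right end values, and its derivative is the mode of the weak gradient. Summation over the modes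
  gives \<open>annulus_energy_fourier\<close> for scalar functions and \<open>dirichlet_energy_modes\<close> for vectors.
  Splitting \<open>|n| (|a\<^sub>n|\<^sup>2 + |b\<^sub>n|\<^sup>2)\<close> off each contribution leaves \<open>interaction\<close>; the parts split off sum
  to the two quarter Laplacian norms and the rest to the diagonal of the bilinear form.

  The form acts on all distributions because its coefficients are of order \<open>n t\<^sup>-\<^sup>n\<close>. The test
  functions \<open>t\<^sup>-\<^sup>n\<^sup>/\<^sup>4 cos (n \<theta>)\<close> and \<open>t\<^sup>-\<^sup>n\<^sup>/\<^sup>4 sin (n \<theta>)\<close> form a bounded set, so the Fourier coefficients
  are bounded by a multiple of \<open>t\<^sup>n\<^sup>/\<^sup>4\<close>, uniformly on some neighbourhood of \<open>0\<close> and on every bounded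
  set of distributions. Products of two such sequences are still summable against the
  coefficients of the form, which gives continuity. A sequence in the neighbourhood has a
  subsequence along which every Fourier coefficient converges, and dominated convergence for
  series gives uniform convergence of the functionals on bounded sets (\<open>compact_annulus_form\<close>).
\<close>

section \<open>Fourier series of square-integrable functions\<close>

text \<open>
  The circle is parametrised by the closed interval of angles; the double endpoint is a null set.
\<close>

definition circle_measure :: "real measure" where
  "circle_measure = restrict_space lborel {0..2*pi}"

definition fourier_coeff :: "(real \<Rightarrow> complex) \<Rightarrow> int \<Rightarrow> complex" where
  "fourier_coeff g n = (LINT \<theta>|circle_measure. g \<theta> * cis (- (of_int n * \<theta>))) / (2 * pi)"

lemma space_circ [simp]: "space circle_measure = {0..2*pi}"
  by (simp add: circle_measure_def space_restrict_space)

lemma measurable_circI: "f \<in> borel_measurable borel \<Longrightarrow> f \<in> borel_measurable circle_measure"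
  unfolding circle_measure_def by (intro measurable_restrict_space1) simp

lemma emeasure_circ_UNIV: "emeasure circle_measure (space circle_measure) = ennreal (2*pi)"
  unfolding space_circ circle_measure_def by (simp add: emeasure_restrict_space)

lemma measure_circ_UNIV: "measure circle_measure {0..2*pi} = 2*pi"
  using emeasure_circ_UNIV by (simp add: measure_def)

interpretation circle_measure: finite_measure circle_measure
  by standard (simp add: emeasure_circ_UNIV flip: space_circ)

lemma measurable_cis [measurable]: "cis \<in> borel_measurable borel"
  by (intro borel_measurable_continuous_onI continuous_intros)

lemma measurable_cis_circ [measurable]: "(\<lambda>\<theta>. cis (c * \<theta>)) \<in> borel_measurable circle_measure"
  by (rule measurable_circI) measurable

lemma integrable_circ_bounded:
  fixes f :: "real \<Rightarrow> 'b::{banach, second_countable_topology}"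
  assumes "f \<in> borel_measurable circle_measure" "\<And>x. x \<in> {0..2*pi} \<Longrightarrow> norm (f x) \<le> B"
  shows "integrable circle_measure f"
  using assms by (intro circle_measure.integrable_const_bound[where B = B]) (auto intro!: AE_I2)

lemma circ_integral_continuous:
  fixes f :: "real \<Rightarrow> 'b::euclidean_space"
  assumes "continuous_on {0..2*pi} f"
  shows "integrable circle_measure f" "(LINT x|circle_measure. f x) = integral {0..2*pi} f"
proof -
  have s: "set_integrable lborel {0..2*pi} f"
    using assms by (rule borel_integrable_atLeastAtMost')
  then show "integrable circle_measure f"
    unfolding circle_measure_def set_integrable_def by (subst integrable_restrict_space) auto
  show "(LINT x|circle_measure. f x) = integral {0..2*pi} f"
    unfolding circle_measure_def
    by (subst integral_restrict_space)
       (use set_borel_integral_eq_integral(2)[OF s] in \<open>auto simp: set_lebesgue_integral_def\<close>)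
qed

lemma integral_cis: "(LINT \<theta>|circle_measure. cis (of_int k * \<theta>)) = (if k = 0 then 2 * pi else 0)"
proof (cases "k = 0")
  case True
  then show ?thesis by (simp add: measure_circ_UNIV scaleR_conv_of_real)
next
  case False
  have "((\<lambda>x. cis (of_int k * x) / (\<i> * of_int k)) has_vector_derivative cis (of_int k * x)) (at x within {0..2*pi})" for x
  proof (rule has_vector_derivative_at_within)
    have "((\<lambda>z. exp (\<i> * of_int k * z) / (\<i> * of_int k)) has_field_derivative exp (\<i> * of_int k * of_real x)) (at (of_real x))"
      using False by (auto intro!: derivative_eq_intros)
    from has_vector_derivative_real_field[OF this]
    show "((\<lambda>x. cis (of_int k * x) / (\<i> * of_int k)) has_vector_derivative cis (of_int k * x)) (at x)"
      by (simp add: cis_conv_exp mult.assoc)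
  qed
  then have "((\<lambda>x. cis (of_int k * x)) has_integral
      (cis (of_int k * (2*pi)) / (\<i> * of_int k) - cis (of_int k * 0) / (\<i> * of_int k))) {0..2*pi}"
    by (intro fundamental_theorem_of_calculus) auto
  moreover have "cis (of_int k * (2*pi)) = 1"
    using cis_multiple_2pi[of "of_int k"] by (simp add: mult_ac)
  ultimately have "integral {0..2*pi} (\<lambda>x. cis (of_int k * x)) = 0"
    by (simp add: integral_unique)
  then show ?thesis using False by (subst circ_integral_continuous) (auto intro!: continuous_intros)
qed

lemma integrable_fourier_coeff:
  assumes "integrable circle_measure g"
  shows "integrable circle_measure (\<lambda>\<theta>. g \<theta> * cis (c * \<theta>))"
proof (rule Bochner_Integration.integrable_bound[OF assms])
  show "(\<lambda>\<theta>. g \<theta> * cis (c * \<theta>)) \<in> borel_measurable circle_measure"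
    using assms by (intro borel_measurable_times) auto
qed (simp add: norm_mult)

lemma fourier_coeff_add: "integrable circle_measure f \<Longrightarrow> integrable circle_measure g \<Longrightarrow> fourier_coeff (\<lambda>x. f x + g x) n = fourier_coeff f n + fourier_coeff g n"
  using integrable_fourier_coeff[of f "- of_int n"] integrable_fourier_coeff[of g "- of_int n"]
  by (simp add: fourier_coeff_def distrib_right add_divide_distrib)

lemma fourier_coeff_diff: "integrable circle_measure f \<Longrightarrow> integrable circle_measure g \<Longrightarrow> fourier_coeff (\<lambda>x. f x - g x) n = fourier_coeff f n - fourier_coeff g n"
  using integrable_fourier_coeff[of f "- of_int n"] integrable_fourier_coeff[of g "- of_int n"]
  by (simp add: fourier_coeff_def left_diff_distrib diff_divide_distrib)

lemma fourier_coeff_cmult: "fourier_coeff (\<lambda>x. c * f x) n = c * fourier_coeff f n"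
  by (simp add: fourier_coeff_def mult.assoc)

lemma fourier_coeff_cnj: "fourier_coeff (\<lambda>x. cnj (f x)) n = cnj (fourier_coeff f (- n))"
proof -
  have "(LINT x|circle_measure. cnj (f x) * cis (- (of_int n * x))) = (LINT x|circle_measure. cnj (f x * cis (of_int n * x)))"
    by (simp add: cis_cnj)
  also have "\<dots> = cnj (LINT x|circle_measure. f x * cis (of_int n * x))"
    by (rule Bochner_Integration.integral_cnj)
  finally show ?thesis by (simp add: fourier_coeff_def)
qed

lemma fourier_coeff_cis: "fourier_coeff (\<lambda>x. cis (of_int m * x)) n = (if m = n then 1 else 0)"
  using integral_cis[of "m - n"]
  by (simp add: fourier_coeff_def cis_mult algebra_simps)

definition trig_poly :: "(int \<Rightarrow> complex) \<Rightarrow> int set \<Rightarrow> real \<Rightarrow> complex" where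
  "trig_poly c X \<theta> = (\<Sum>n\<in>X. c n * cis (of_int n * \<theta>))"

lemma measurable_trig [measurable]: "trig_poly c X \<in> borel_measurable borel"
  unfolding trig_poly_def by measurable

lemma measurable_trig_circ [measurable]: "trig_poly c X \<in> borel_measurable circle_measure"
  by (intro measurable_circI measurable_trig)

lemma norm_trig_le: "norm (trig_poly c X \<theta>) \<le> (\<Sum>n\<in>X. norm (c n))"
  unfolding trig_poly_def by (rule order_trans[OF norm_sum]) (simp add: norm_mult)

lemma integrable_trig: "integrable circle_measure (trig_poly c X)"
  by (rule integrable_circ_bounded[OF _ norm_trig_le]) simp

lemma fourier_coeff_trig:
  assumes "finite X"
  shows "fourier_coeff (trig_poly c X) n = (if n \<in> X then c n else 0)"
proof -
  have i: "integrable circle_measure (\<lambda>x. c m * (cis (of_int m * x) * cis (- of_int n * x)))" for m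
    by (intro integrable_mult_right integrable_fourier_coeff circ_integral_continuous(1) continuous_intros)
  have "fourier_coeff (trig_poly c X) n = (\<Sum>m\<in>X. c m * fourier_coeff (\<lambda>x. cis (of_int m * x)) n)"
    using Bochner_Integration.integral_sum[of X, OF i]
    by (simp add: fourier_coeff_def trig_poly_def sum_distrib_right sum_divide_distrib mult.assoc)
  also have "\<dots> = (if n \<in> X then c n else 0)"
    using assms by (simp add: fourier_coeff_cis sum.delta' if_distrib cong: if_cong)
  finally show ?thesis .
qed

definition circle_L2 :: "(real \<Rightarrow> complex) \<Rightarrow> bool" where
  "circle_L2 g \<longleftrightarrow> g \<in> borel_measurable circle_measure \<and> integrable circle_measure (\<lambda>x. (norm (g x))\<^sup>2)"

lemma circle_L2_integrable:
  assumes "circle_L2 g"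
  shows "integrable circle_measure g"
proof -
  have m: "g \<in> borel_measurable circle_measure" and i: "integrable circle_measure (\<lambda>x. (norm (g x))\<^sup>2)"
    using assms by (simp_all add: circle_L2_def)
  have "integrable circle_measure (\<lambda>x. norm (g x))"
    by (rule circle_measure.square_integrable_imp_integrable[OF measurable_compose[OF m borel_measurable_norm] i])
  then show ?thesis using m by (simp only: integrable_norm_iff)
qed

lemma circle_L2_bounded:
  assumes "g \<in> borel_measurable circle_measure" "\<And>x. x \<in> {0..2*pi} \<Longrightarrow> norm (g x) \<le> B"
  shows "circle_L2 g"
  unfolding circle_L2_def using assms
  by (auto intro!: integrable_circ_bounded[where B = "B\<^sup>2"] power_mono)

lemma circle_L2_trig: "circle_L2 (trig_poly c X)"
  by (rule circle_L2_bounded[OF _ norm_trig_le]) simp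

lemma norm_add_sq_le: "(norm (x + y :: 'a::real_normed_vector))\<^sup>2 \<le> 2 * (norm x)\<^sup>2 + 2 * (norm y)\<^sup>2"
proof -
  have "(norm (x + y))\<^sup>2 \<le> (norm x + norm y)\<^sup>2"
    by (intro power_mono norm_triangle_ineq) auto
  also have "\<dots> \<le> 2 * (norm x)\<^sup>2 + 2 * (norm y)\<^sup>2"
    using zero_le_power2[of "norm x - norm y"] by (simp add: power2_eq_square algebra_simps)
  finally show ?thesis .
qed

lemma circle_L2_add:
  assumes "circle_L2 f" "circle_L2 g"
  shows "circle_L2 (\<lambda>x. f x + g x)"
proof -
  have [measurable]: "f \<in> borel_measurable circle_measure" "g \<in> borel_measurable circle_measure"
    using assms by (auto simp: circle_L2_def)
  have "integrable circle_measure (\<lambda>x. (norm (f x + g x))\<^sup>2)"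
    by (rule Bochner_Integration.integrable_bound[where f = "\<lambda>x. 2 * (norm (f x))\<^sup>2 + 2 * (norm (g x))\<^sup>2"])
       (use assms norm_add_sq_le in \<open>auto simp: circle_L2_def intro!: AE_I2\<close>)
  then show ?thesis by (simp add: circle_L2_def)
qed

lemma circle_L2_cmult: "circle_L2 f \<Longrightarrow> circle_L2 (\<lambda>x. c * f x)"
  by (auto simp: circle_L2_def norm_mult power_mult_distrib)

lemma circle_L2_diff: "circle_L2 f \<Longrightarrow> circle_L2 g \<Longrightarrow> circle_L2 (\<lambda>x. f x - g x)"
  using circle_L2_add[of f "\<lambda>x. -1 * g x"] circle_L2_cmult[of g "-1"] by simp

text \<open>
  The functions \<open>cis (n \<theta>)\<close> are orthogonal, so expanding the square and completing it coefficient by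
  coefficient separates the distance into the part that the choice of \<open>c\<close> influences and the rest.
  Both Bessel's inequality and the norm of a trigonometric polynomial are special cases.
\<close>

lemma integral_norm_diff_trig:
  assumes g: "circle_L2 g" and X: "finite X"
  shows "(LINT x|circle_measure. (norm (g x - trig_poly c X x))\<^sup>2) =
    (LINT x|circle_measure. (norm (g x))\<^sup>2) + 2 * pi * (\<Sum>n\<in>X. (norm (c n - fourier_coeff g n))\<^sup>2 - (norm (fourier_coeff g n))\<^sup>2)"
proof -
  have *: "integrable circle_measure (\<lambda>x. h x * cnj (trig_poly c X x))"
    "(LINT x|circle_measure. h x * cnj (trig_poly c X x)) = 2 * pi * (\<Sum>n\<in>X. cnj (c n) * fourier_coeff h n)"
    if "integrable circle_measure h" for h
  proof -
    have e: "(\<lambda>x. h x * cnj (trig_poly c X x)) = (\<lambda>x. \<Sum>n\<in>X. cnj (c n) * (h x * cis (- of_int n * x)))"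
      by (simp add: trig_poly_def sum_distrib_left cis_cnj mult_ac)
    have i: "integrable circle_measure (\<lambda>x. cnj (c n) * (h x * cis (- of_int n * x)))" for n
      by (intro integrable_mult_right integrable_fourier_coeff that)
    show "integrable circle_measure (\<lambda>x. h x * cnj (trig_poly c X x))"
      unfolding e by (intro Bochner_Integration.integrable_sum i)
    show "(LINT x|circle_measure. h x * cnj (trig_poly c X x)) = 2 * pi * (\<Sum>n\<in>X. cnj (c n) * fourier_coeff h n)"
      unfolding e using Bochner_Integration.integral_sum[of X, OF i]
      by (simp add: fourier_coeff_def sum_distrib_left)
  qed
  note g' = circle_L2_integrable[OF g]
  have ng: "integrable circle_measure (\<lambda>x. (norm (g x))\<^sup>2)" using g by (simp add: circle_L2_def)
  have tt: "complex_of_real ((norm (trig_poly c X x))\<^sup>2) = trig_poly c X x * cnj (trig_poly c X x)" for x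
    by (rule complex_norm_square)
  have "complex_of_real (LINT x|circle_measure. (norm (trig_poly c X x))\<^sup>2) = (LINT x|circle_measure. trig_poly c X x * cnj (trig_poly c X x))"
    by (simp only: tt flip: integral_complex_of_real)
  also have "\<dots> = 2 * pi * (\<Sum>n\<in>X. cnj (c n) * c n)"
    using *(2)[OF integrable_trig[of c X]] X by (simp add: fourier_coeff_trig)
  also have "\<dots> = complex_of_real (2 * pi * (\<Sum>n\<in>X. (norm (c n))\<^sup>2))"
    by (simp only: of_real_mult of_real_sum complex_norm_square) (simp add: mult.commute)
  finally have t: "(LINT x|circle_measure. (norm (trig_poly c X x))\<^sup>2) = 2 * pi * (\<Sum>n\<in>X. (norm (c n))\<^sup>2)"
    using of_real_eq_iff by blast
  have nt: "integrable circle_measure (\<lambda>x. (norm (trig_poly c X x))\<^sup>2)" using circle_L2_trig by (simp add: circle_L2_def)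
  have sq: "(norm (x - y))\<^sup>2 = (norm x)\<^sup>2 - 2 * Re (x * cnj y) + (norm y)\<^sup>2" for x y :: complex
    unfolding cmod_power2 by (simp add: power2_eq_square algebra_simps)
  have iR: "integrable circle_measure (\<lambda>x. Re (g x * cnj (trig_poly c X x)))"
    using *(1)[OF g'] by (rule integrable_Re)
  have "(LINT x|circle_measure. (norm (g x - trig_poly c X x))\<^sup>2) =
      (LINT x|circle_measure. (norm (g x))\<^sup>2) - 2 * (LINT x|circle_measure. Re (g x * cnj (trig_poly c X x)))
      + (LINT x|circle_measure. (norm (trig_poly c X x))\<^sup>2)"
    unfolding sq
    using Bochner_Integration.integral_add[OF Bochner_Integration.integrable_diff[OF ng integrable_mult_right[OF iR, of 2]] nt]
      Bochner_Integration.integral_diff[OF ng integrable_mult_right[OF iR, of 2]]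
      integral_mult_right_zero[of circle_measure 2 "\<lambda>x. Re (g x * cnj (trig_poly c X x))"]
    by argo
  also have "(LINT x|circle_measure. Re (g x * cnj (trig_poly c X x))) = 2 * pi * (\<Sum>n\<in>X. Re (cnj (c n) * fourier_coeff g n))"
  proof -
    have "(LINT x|circle_measure. Re (g x * cnj (trig_poly c X x))) = Re (LINT x|circle_measure. g x * cnj (trig_poly c X x))"
      using *(1)[OF g'] by (rule integral_Re)
    then show ?thesis unfolding *(2)[OF g'] by simp
  qed
  finally have "(LINT x|circle_measure. (norm (g x - trig_poly c X x))\<^sup>2) =
      (LINT x|circle_measure. (norm (g x))\<^sup>2) - 2 * (2 * pi * (\<Sum>n\<in>X. Re (cnj (c n) * fourier_coeff g n)))
        + 2 * pi * (\<Sum>n\<in>X. (norm (c n))\<^sup>2)"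
    unfolding t .
  also have "\<dots> = (LINT x|circle_measure. (norm (g x))\<^sup>2)
      + 2 * pi * ((\<Sum>n\<in>X. (norm (c n))\<^sup>2) - 2 * (\<Sum>n\<in>X. Re (cnj (c n) * fourier_coeff g n)))"
    by (simp only: right_diff_distrib mult.left_commute[of 2])
  also have "(\<Sum>n\<in>X. (norm (c n))\<^sup>2) - 2 * (\<Sum>n\<in>X. Re (cnj (c n) * fourier_coeff g n)) =
      (\<Sum>n\<in>X. (norm (c n - fourier_coeff g n))\<^sup>2 - (norm (fourier_coeff g n))\<^sup>2)"
    unfolding sum_distrib_left sum_subtractf[symmetric] 
    by (intro sum.cong refl) (simp add: sq)
  finally show ?thesis .
qed

lemma bessel_ineq:
  assumes "circle_L2 g" "finite X"
  shows "2 * pi * (\<Sum>n\<in>X. (norm (fourier_coeff g n))\<^sup>2) \<le> (LINT x|circle_measure. (norm (g x))\<^sup>2)"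
proof -
  have "0 \<le> (LINT x|circle_measure. (norm (g x - trig_poly (fourier_coeff g) X x))\<^sup>2)" by (rule integral_nonneg_AE) simp
  also have "\<dots> = (LINT x|circle_measure. (norm (g x))\<^sup>2) - 2 * pi * (\<Sum>n\<in>X. (norm (fourier_coeff g n))\<^sup>2)"
    using integral_norm_diff_trig[OF assms, of "fourier_coeff g"] by (simp only: sum_negf) (simp add: sum_negf)
  finally show ?thesis by linarith
qed

lemma norm_fourier_coeff_le:
  assumes "circle_L2 g"
  shows "2 * pi * (norm (fourier_coeff g n))\<^sup>2 \<le> (LINT x|circle_measure. (norm (g x))\<^sup>2)"
proof -
  have "(\<Sum>m\<in>{n}. (norm (fourier_coeff g m))\<^sup>2) = (norm (fourier_coeff g n))\<^sup>2" by simp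
  then show ?thesis using bessel_ineq[OF assms, of "{n}"] by (simp only: finite.intros)
qed

lemma nn_integral_norm_sq:
  assumes "circle_L2 g"
  shows "(\<integral>\<^sup>+x. ennreal ((norm (g x))\<^sup>2) \<partial>circle_measure) = ennreal (LINT x|circle_measure. (norm (g x))\<^sup>2)"
  using assms by (intro nn_integral_eq_integral) (auto simp: circle_L2_def)

lemma circle_L2_iff_nn:
  "circle_L2 g \<longleftrightarrow> g \<in> borel_measurable circle_measure \<and> (\<integral>\<^sup>+x. ennreal ((norm (g x))\<^sup>2) \<partial>circle_measure) < \<infinity>"
  unfolding circle_L2_def integrable_iff_bounded by auto

lemma circle_L2_dist_fourier_coeff:
  assumes "circle_L2 f" "circle_L2 g"
  shows "2 * pi * (norm (fourier_coeff f n - fourier_coeff g n))\<^sup>2 \<le> (LINT x|circle_measure. (norm (f x - g x))\<^sup>2)"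
  using norm_fourier_coeff_le[OF circle_L2_diff[OF assms], of n] assms by (simp only: fourier_coeff_diff circle_L2_integrable)

text \<open>
  This gives an increasing sequence of finite index sets whose tails are small at a prescribed rate.
\<close>

lemma nonneg_has_sum_approx:
  fixes h :: "'a \<Rightarrow> real"
  assumes h: "h summable_on UNIV" and e: "\<And>k. (0::real) < e k"
  obtains X :: "nat \<Rightarrow> 'a set" where "\<And>k. finite (X k)" "\<And>k. X k \<subseteq> X (Suc k)"
    "\<And>k Z. finite Z \<Longrightarrow> Z \<inter> X k = {} \<Longrightarrow> sum h Z \<le> e k"
proof -
  have "\<exists>Y. finite Y \<and> (\<forall>Z. finite Z \<and> Y \<subseteq> Z \<longrightarrow> \<bar>sum h Z - infsum h UNIV\<bar> < e k / 2)" for k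
    using tendstoD[OF has_sum_infsum[OF h, unfolded has_sum_def], of "e k / 2"] e[of k]
    by (auto simp: eventually_finite_subsets_at_top dist_real_def)
  then obtain Y where Y: "\<And>k. finite (Y k)"
    "\<And>k Z. finite Z \<Longrightarrow> Y k \<subseteq> Z \<Longrightarrow> \<bar>sum h Z - infsum h UNIV\<bar> < e k / 2"
    by metis
  define X where "X = (\<lambda>k. \<Union>i\<le>k. Y i)"
  show thesis
  proof (rule that)
    show fX: "finite (X k)" for k unfolding X_def using Y by auto
    show "X k \<subseteq> X (Suc k)" for k unfolding X_def by (intro UN_mono) auto
    show "sum h Z \<le> e k" if Z: "finite Z" "Z \<inter> X k = {}" for k Z
    proof -
      have "Y k \<subseteq> X k" by (auto simp: X_def)
      then have "\<bar>sum h (X k) - infsum h UNIV\<bar> < e k / 2" "\<bar>sum h (X k \<union> Z) - infsum h UNIV\<bar> < e k / 2"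
        using Y(2)[of "X k" k] Y(2)[of "X k \<union> Z" k] fX Z by auto
      moreover have "sum h (X k \<union> Z) = sum h (X k) + sum h Z"
        using fX Z by (intro sum.union_disjoint) auto
      ultimately show ?thesis by linarith
    qed
  qed
qed

lemma trig_diff:
  assumes "finite Y" "X \<subseteq> Y"
  shows "trig_poly c Y \<theta> - trig_poly c X \<theta> = trig_poly c (Y - X) \<theta>"
  unfolding trig_poly_def using assms by (simp add: sum_diff)

lemma integral_norm_trig: "finite X \<Longrightarrow> (LINT x|circle_measure. (norm (trig_poly c X x))\<^sup>2) = 2 * pi * (\<Sum>n\<in>X. (norm (c n))\<^sup>2)"
  using integral_norm_diff_trig[OF circle_L2_trig[of c X], of X c] by (simp add: fourier_coeff_trig sum_negf)

text \<open>
  Cauchy-Schwarz against the constant function; the total mass of the circle is \<open>2 \<pi>\<close>.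
\<close>

lemma nn_integral_norm_le:
  assumes [measurable]: "f \<in> borel_measurable circle_measure"
    and f: "(\<integral>\<^sup>+x. ennreal ((norm (f x))\<^sup>2) \<partial>circle_measure) \<le> ennreal (2 * pi * B\<^sup>2)" and B: "0 \<le> B"
  shows "(\<integral>\<^sup>+x. ennreal (norm (f x)) \<partial>circle_measure) \<le> ennreal (2 * pi * B)"
proof -
  have "(\<integral>\<^sup>+x. ennreal (norm (f x)) * 1 \<partial>circle_measure)\<^sup>2
      \<le> (\<integral>\<^sup>+x. (ennreal (norm (f x)))\<^sup>2 \<partial>circle_measure) * (\<integral>\<^sup>+x. 1\<^sup>2 \<partial>circle_measure)"
    by (rule Cauchy_Schwarz_nn_integral) auto
  also have "\<dots> \<le> ennreal (2 * pi * B\<^sup>2) * ennreal (2 * pi)"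
    using f emeasure_circ_UNIV by (intro mult_mono) (auto simp: ennreal_power)
  also have "\<dots> = (ennreal (2 * pi * B))\<^sup>2"
    using B by (simp add: ennreal_power flip: ennreal_mult) (simp add: power2_eq_square mult_ac)
  finally have sq: "(\<integral>\<^sup>+x. ennreal (norm (f x)) \<partial>circle_measure)\<^sup>2 \<le> (ennreal (2 * pi * B))\<^sup>2" by simp
  show ?thesis
  proof (cases "\<integral>\<^sup>+x. ennreal (norm (f x)) \<partial>circle_measure")
    case (real r)
    then have "r\<^sup>2 \<le> (2 * pi * B)\<^sup>2"
      using sq B by (simp add: ennreal_power)
    then have "r \<le> 2 * pi * B" by (rule power2_le_imp_le) (use B in simp)
    then have "ennreal r \<le> ennreal (2 * pi * B)" by (rule ennreal_leI)
    then show ?thesis by (simp only: real)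
  next
    case top
    then show ?thesis using sq B by (simp add: ennreal_power top_unique)
  qed
qed

text \<open>
  Partial sums over finite index sets whose tails decay like \<open>4\<^sup>-\<^sup>k\<close> have increments that are summable
  in \<open>L\<^sup>1\<close>, hence summable at almost every point. Fatou's lemma shows that the pointwise limit is also
  the \<open>L\<^sup>2\<close> limit.
\<close>

lemma riesz_fischer:
  fixes c :: "int \<Rightarrow> complex"
  assumes c: "(\<lambda>n. (norm (c n))\<^sup>2) summable_on UNIV"
  obtains g where "circle_L2 g" "\<And>n. fourier_coeff g n = c n"
    "((\<lambda>n. 2 * pi * (norm (c n))\<^sup>2) has_sum (LINT x|circle_measure. (norm (g x))\<^sup>2)) UNIV"
proof -
  obtain X where X: "\<And>k. finite (X k)" "\<And>k. X k \<subseteq> X (Suc k)"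
    and tail: "\<And>k Z. finite Z \<Longrightarrow> Z \<inter> X k = {} \<Longrightarrow> (\<Sum>n\<in>Z. (norm (c n))\<^sup>2) \<le> ((1/2)^k)\<^sup>2"
    using nonneg_has_sum_approx[OF c, of "\<lambda>k. ((1/2)^k)\<^sup>2"] by auto
  have Xmono: "X j \<subseteq> X k" if "j \<le> k" for j k
    using lift_Suc_mono_le[of X, OF X(2) that] .
  define S where "S = (\<lambda>k. trig_poly c (X k))"
  have [measurable]: "S k \<in> borel_measurable circle_measure" for k unfolding S_def by simp
  have sS: "circle_L2 (S k)" for k unfolding S_def by (rule circle_L2_trig)
  have diff: "(\<integral>\<^sup>+x. ennreal ((norm (S j x - S k x))\<^sup>2) \<partial>circle_measure) \<le> ennreal (2 * pi * ((1/2)^k)\<^sup>2)" if "k \<le> j" for j k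
  proof -
    have "(LINT x|circle_measure. (norm (S j x - S k x))\<^sup>2) = 2 * pi * (\<Sum>n\<in>X j - X k. (norm (c n))\<^sup>2)"
      unfolding S_def trig_diff[OF X(1) Xmono[OF that]] by (rule integral_norm_trig) (use X in auto)
    also have "\<dots> \<le> 2 * pi * ((1/2)^k)\<^sup>2"
      by (intro mult_left_mono tail) (use X in auto)
    finally show ?thesis
      unfolding nn_integral_norm_sq[OF circle_L2_diff[OF sS sS]] by (rule ennreal_leI)
  qed
  define D where "D = (\<lambda>k x. S (Suc k) x - S k x)"
  have [measurable]: "D k \<in> borel_measurable circle_measure" for k unfolding D_def by simp
  have D1: "(\<integral>\<^sup>+x. ennreal (norm (D k x)) \<partial>circle_measure) \<le> ennreal (2 * pi * (1/2)^k)" for k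
    unfolding D_def by (rule nn_integral_norm_le) (use diff[of k "Suc k"] in simp_all)
  have "(\<integral>\<^sup>+x. (\<Sum>k. ennreal (norm (D k x))) \<partial>circle_measure) = (\<Sum>k. \<integral>\<^sup>+x. ennreal (norm (D k x)) \<partial>circle_measure)"
    by (rule nn_integral_suminf) simp
  also have "\<dots> \<le> (\<Sum>k. ennreal (2 * pi * (1/2)^k))"
    by (intro suminf_le D1) auto
  also have "\<dots> = ennreal (\<Sum>k. 2 * pi * (1/2)^k)"
    by (intro suminf_ennreal2 summable_mult summable_geometric) auto
  also have "\<dots> < \<infinity>" by simp
  finally have "(\<integral>\<^sup>+x. (\<Sum>k. ennreal (norm (D k x))) \<partial>circle_measure) \<noteq> \<infinity>" by simp
  then have "AE x in circle_measure. (\<Sum>k. ennreal (norm (D k x))) \<noteq> \<infinity>"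
    by (intro nn_integral_PInf_AE) auto
  then have ae: "AE x in circle_measure. summable (\<lambda>k. D k x)"
  proof (rule AE_mp, intro AE_I2 impI)
    fix x assume "(\<Sum>k. ennreal (norm (D k x))) \<noteq> \<infinity>"
    then have "summable (\<lambda>k. norm (D k x))" by (intro summable_suminf_not_top) auto
    then show "summable (\<lambda>k. D k x)" by (rule summable_norm_cancel)
  qed
  define g where "g = (\<lambda>x. S 0 x + (\<Sum>k. D k x))"
  have [measurable]: "g \<in> borel_measurable circle_measure" unfolding g_def by simp
  have lim: "AE x in circle_measure. (\<lambda>k. S k x) \<longlonglongrightarrow> g x"
    using ae
  proof (rule AE_mp, intro AE_I2 impI)
    fix x assume "summable (\<lambda>k. D k x)"
    then have "(\<lambda>k. \<Sum>i<k. D i x) \<longlonglongrightarrow> (\<Sum>k. D k x)" by (rule summable_LIMSEQ)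
    then have "(\<lambda>k. S 0 x + (\<Sum>i<k. D i x)) \<longlonglongrightarrow> g x" unfolding g_def by (intro tendsto_intros)
    moreover have "S 0 x + (\<Sum>i<k. D i x) = S k x" for k 
      unfolding D_def using sum_lessThan_telescope[of "\<lambda>i. S i x" k] by simp
    ultimately show "(\<lambda>k. S k x) \<longlonglongrightarrow> g x" by simp
  qed
  have gS: "(\<integral>\<^sup>+x. ennreal ((norm (g x - S k x))\<^sup>2) \<partial>circle_measure) \<le> ennreal (2 * pi * ((1/2)^k)\<^sup>2)" for k
  proof -
    have "(\<integral>\<^sup>+x. ennreal ((norm (g x - S k x))\<^sup>2) \<partial>circle_measure)
        \<le> (\<integral>\<^sup>+x. liminf (\<lambda>j. ennreal ((norm (S j x - S k x))\<^sup>2)) \<partial>circle_measure)"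
    proof (intro nn_integral_mono_AE, use lim in \<open>rule AE_mp\<close>, intro AE_I2 impI)
      fix x assume "(\<lambda>k. S k x) \<longlonglongrightarrow> g x"
      then have "(\<lambda>j. ennreal ((norm (S j x - S k x))\<^sup>2)) \<longlonglongrightarrow> ennreal ((norm (g x - S k x))\<^sup>2)"
        by (intro tendsto_intros)
      then show "ennreal ((norm (g x - S k x))\<^sup>2) \<le> liminf (\<lambda>j. ennreal ((norm (S j x - S k x))\<^sup>2))"
        by (simp only: lim_imp_Liminf[OF trivial_limit_sequentially] order_refl)
    qed
    also have "\<dots> \<le> liminf (\<lambda>j. \<integral>\<^sup>+x. ennreal ((norm (S j x - S k x))\<^sup>2) \<partial>circle_measure)"
      by (rule nn_integral_liminf) simp
    also have "\<dots> \<le> ennreal (2 * pi * ((1/2)^k)\<^sup>2)"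
      by (rule Liminf_le) (auto intro!: eventually_sequentiallyI[of k] diff)
    finally show ?thesis .
  qed
  have sd: "circle_L2 (\<lambda>x. g x - S k x)" for k
    unfolding circle_L2_iff_nn using gS[of k] by (auto intro: le_less_trans)
  have sg: "circle_L2 g" using circle_L2_add[OF sd[of 0] sS[of 0]] by simp
  have gSr: "(LINT x|circle_measure. (norm (g x - S k x))\<^sup>2) \<le> 2 * pi * ((1/2)^k)\<^sup>2" for k
    using gS[of k] unfolding nn_integral_norm_sq[OF sd] by (subst (asm) ennreal_le_iff) auto
  have half: "(\<lambda>k. (1/2)^k) \<longlonglongrightarrow> (0::real)" by (rule LIMSEQ_realpow_zero) auto
  have coeff: "fourier_coeff g n = c n" for n
  proof -
    have "norm (fourier_coeff g n - c n) \<le> 2 * (1/2)^k" for k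
    proof -
      have "2 * pi * (norm (fourier_coeff g n - fourier_coeff (S k) n))\<^sup>2 \<le> 2 * pi * ((1/2)^k)\<^sup>2"
        using circle_L2_dist_fourier_coeff[OF sg sS, of n k] gSr[of k] by linarith
      then have 1: "norm (fourier_coeff g n - fourier_coeff (S k) n) \<le> (1/2)^k"
        by (simp add: power2_le_iff_abs_le)
      have "norm (fourier_coeff (S k) n - c n) \<le> (1/2)^k"
      proof (cases "n \<in> X k")
        case False
        then show ?thesis using tail[of "{n}" k] X(1)[of k]
          by (simp add: S_def fourier_coeff_trig power2_le_iff_abs_le)
      qed (use X(1)[of k] in \<open>simp add: S_def fourier_coeff_trig\<close>)
      then show ?thesis using 1 norm_triangle_ineq[of "fourier_coeff g n - fourier_coeff (S k) n" "fourier_coeff (S k) n - c n"] by simp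
    qed
    moreover have "(\<lambda>k. 2 * (1/2)^k) \<longlonglongrightarrow> (0::real)" using tendsto_mult_left[OF half, of 2] by simp
    ultimately have "norm (fourier_coeff g n - c n) \<le> 0"
      by (intro LIMSEQ_le_const[where X = "\<lambda>k. 2 * (1/2)^k"]) auto
    then show ?thesis by simp
  qed
  have sm: "(\<lambda>n. 2 * pi * (norm (c n))\<^sup>2) summable_on UNIV"
    by (rule summable_on_cmult_right[OF c])
  \<comment> \<open>Bessel's inequality bounds the norm of \<open>g\<close> from below, the approximation by partial sums from above.\<close>
  have up: "(\<Sum>\<^sub>\<infinity>n. 2 * pi * (norm (c n))\<^sup>2) \<le> (LINT x|circle_measure. (norm (g x))\<^sup>2)"
    using bessel_ineq[OF sg] by (intro infsum_le_finite_sums[OF sm]) (simp add: coeff sum_distrib_left)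
  have lo: "(LINT x|circle_measure. (norm (g x))\<^sup>2) \<le> (\<Sum>\<^sub>\<infinity>n. 2 * pi * (norm (c n))\<^sup>2) + 2 * pi * ((1/2)^k)\<^sup>2" for k
  proof -
    have "(LINT x|circle_measure. (norm (g x))\<^sup>2) = (LINT x|circle_measure. (norm (g x - S k x))\<^sup>2) + 2 * pi * (\<Sum>n\<in>X k. (norm (c n))\<^sup>2)"
      unfolding S_def integral_norm_diff_trig[OF sg X(1), of c k] by (simp add: coeff sum_negf)
    also have "2 * pi * (\<Sum>n\<in>X k. (norm (c n))\<^sup>2) \<le> (\<Sum>\<^sub>\<infinity>n. 2 * pi * (norm (c n))\<^sup>2)"
      unfolding sum_distrib_left by (rule finite_sum_le_infsum[OF sm]) (use X in auto)
    finally show ?thesis using gSr[of k] by linarith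
  qed
  have "(\<lambda>k. (\<Sum>\<^sub>\<infinity>n. 2 * pi * (norm (c n))\<^sup>2) + 2 * pi * ((1/2)^k)\<^sup>2) \<longlonglongrightarrow> (\<Sum>\<^sub>\<infinity>n. 2 * pi * (norm (c n))\<^sup>2) + 2 * pi * 0\<^sup>2"
    by (intro tendsto_intros half)
  then have "(LINT x|circle_measure. (norm (g x))\<^sup>2) \<le> (\<Sum>\<^sub>\<infinity>n. 2 * pi * (norm (c n))\<^sup>2)"
    using lo by (intro LIMSEQ_le_const[where X = "\<lambda>k. (\<Sum>\<^sub>\<infinity>n. 2 * pi * (norm (c n))\<^sup>2) + 2 * pi * ((1/2)^k)\<^sup>2"]) auto
  with up have "(\<Sum>\<^sub>\<infinity>n. 2 * pi * (norm (c n))\<^sup>2) = (LINT x|circle_measure. (norm (g x))\<^sup>2)" by simp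
  then show thesis using sg coeff has_sum_infsum[OF sm] by (intro that) auto
qed

subsection \<open>Completeness of the trigonometric system\<close>

text \<open>
  Every Borel set arises from compact intervals by complements and countable disjoint unions.
  Complements require the integral over the whole line, which is the limit over growing intervals.
\<close>

lemma AE_zero_of_interval_integrals:
  fixes f :: "real \<Rightarrow> 'b::euclidean_space"
  assumes f: "integrable lborel f" and z: "\<And>a b. a \<le> b \<Longrightarrow> set_lebesgue_integral lborel {a..b} f = 0"
  shows "AE x in lborel. f x = 0"
proof (rule sigma_finite_measure.density_zero[OF sigma_finite_lborel f])
  have si: "set_integrable lborel A f" if "A \<in> sets borel" for A
    using integrable_mult_indicator[OF _ f, of A] that by (simp add: set_integrable_def)
  have total: "(LINT x|lborel. f x) = 0"
  proof -
    have "(\<lambda>n. LINT x|lborel. indicator {- real n..real n} x *\<^sub>R f x) \<longlonglongrightarrow> (LINT x|lborel. f x)"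
    proof (rule integral_dominated_convergence[where w = "\<lambda>x. norm (f x)"])
      show "AE x in lborel. (\<lambda>n. indicator {- real n..real n} x *\<^sub>R f x) \<longlonglongrightarrow> f x"
      proof (rule AE_I2)
        fix x :: real
        obtain N where N: "\<bar>x\<bar> \<le> real N" using real_arch_simple by blast
        have "eventually (\<lambda>n. indicator {- real n..real n} x *\<^sub>R f x = f x) sequentially"
          by (rule eventually_sequentiallyI[of N]) (use N in \<open>auto simp: indicator_def\<close>)
        then show "(\<lambda>n. indicator {- real n..real n} x *\<^sub>R f x) \<longlonglongrightarrow> f x"
          by (rule tendsto_eventually)
      qed
    qed (use f in \<open>auto simp: indicator_def intro!: AE_I2\<close>)
    moreover have "(LINT x|lborel. indicator {- real n..real n} x *\<^sub>R f x) = 0" for n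
      using z[of "- real n" "real n"] by (simp add: set_lebesgue_integral_def)
    ultimately show ?thesis by (simp add: LIMSEQ_const_iff)
  qed
  fix A :: "real set" assume "A \<in> sets lborel"
  then have "A \<in> sets borel" by simp
  then show "set_lebesgue_integral lborel A f = 0"
  proof (induction rule: borel_set_induct)
    case empty
    then show ?case by (simp add: set_lebesgue_integral_def)
  next
    case (interval a b)
    then show ?case by (rule z)
  next
    case (compl A)
    have "set_lebesgue_integral lborel (A \<union> - A) f = set_lebesgue_integral lborel A f + set_lebesgue_integral lborel (- A) f"
      by (rule set_integral_Un) (use compl in \<open>auto intro!: si\<close>)
    then show ?case using total compl by (simp add: set_lebesgue_integral_def)
  next
    case (union h)
    then have "set_lebesgue_integral lborel (\<Union>i. h i) f = (\<Sum>i. set_lebesgue_integral lborel (h i) f)"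
      by (intro lebesgue_integral_countable_add si) (auto simp: disjoint_family_on_def)
    then show ?case using union by simp
  qed
qed

lemma AE_circ: "(AE x in circle_measure. P x) \<longleftrightarrow> (AE x in lborel. x \<in> {0..2*pi} \<longrightarrow> P x)"
  unfolding circle_measure_def by (subst AE_restrict_space_iff) auto

lemma integrable_circ_iff:
  fixes f :: "real \<Rightarrow> 'b::{banach, second_countable_topology}"
  shows "integrable circle_measure f \<longleftrightarrow> integrable lborel (\<lambda>x. indicator {0..2*pi} x *\<^sub>R f x)"
  unfolding circle_measure_def by (subst integrable_restrict_space) auto

lemma integral_circ:
  fixes f :: "real \<Rightarrow> 'b::{banach, second_countable_topology}"
  shows "(LINT x|circle_measure. f x) = (LINT x|lborel. indicator {0..2*pi} x *\<^sub>R f x)"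
  unfolding circle_measure_def by (subst integral_restrict_space) auto

lemma fourier_coeff_mult_cis: "fourier_coeff (\<lambda>x. f x * cis (of_int k * x)) n = fourier_coeff f (n - k)"
proof -
  have "f x * cis (of_int k * x) * cis (- (of_int n * x)) = f x * cis (- (of_int (n - k) * x))" for x
    by (simp add: mult.assoc cis_mult algebra_simps)
  then show ?thesis unfolding fourier_coeff_def by (simp only:)
qed

text \<open>
  On the circle the coordinates are \<open>cos \<theta>\<close> and \<open>sin \<theta>\<close>, combinations of \<open>cis \<theta>\<close> and \<open>cis (-\<theta>)\<close>, and
  multiplication by these only shifts the Fourier coefficients. The statement about all
  coefficients is what makes the induction work.
\<close>

lemma fourier_coeff_zero_mult_polynomial:
  assumes "real_polynomial_function p" "integrable circle_measure g" "\<And>n. fourier_coeff g n = 0"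
  shows "integrable circle_measure (\<lambda>\<theta>. g \<theta> * complex_of_real (p (cis \<theta>))) \<and>
    (\<forall>n. fourier_coeff (\<lambda>\<theta>. g \<theta> * complex_of_real (p (cis \<theta>))) n = 0)"
  using assms
proof (induction p arbitrary: g rule: real_polynomial_function.induct)
  case (linear p)
  interpret bounded_linear p by fact
  have p: "p (cis x) = cos x * p 1 + sin x * p \<i>" for x
  proof -
    have "cis x = cos x *\<^sub>R 1 + sin x *\<^sub>R \<i>" by (simp add: complex_eq_iff)
    then show ?thesis by (metis add scaleR real_scaleR_def)
  qed
  define \<alpha> \<beta> where "\<alpha> = (p 1 - \<i> * p \<i>) / 2" and "\<beta> = (p 1 + \<i> * p \<i>) / 2"
  have e: "g x * complex_of_real (p (cis x)) = \<alpha> * (g x * cis (of_int 1 * x)) + \<beta> * (g x * cis (of_int (- 1) * x))" for x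
  proof -
    have "complex_of_real (p (cis x)) = \<alpha> * cis x + \<beta> * cis (- x)"
      unfolding p \<alpha>_def \<beta>_def by (simp add: complex_eq_iff field_simps)
    then show ?thesis by (simp add: algebra_simps)
  qed
  have i: "integrable circle_measure (\<lambda>x. g x * cis (of_int k * x))" for k
    by (rule integrable_fourier_coeff[OF linear.prems(1)])
  show ?case unfolding e
  proof (intro conjI allI)
    show "integrable circle_measure (\<lambda>x. \<alpha> * (g x * cis (of_int 1 * x)) + \<beta> * (g x * cis (of_int (- 1) * x)))"
      by (intro Bochner_Integration.integrable_add integrable_mult_right i)
    show "fourier_coeff (\<lambda>x. \<alpha> * (g x * cis (of_int 1 * x)) + \<beta> * (g x * cis (of_int (- 1) * x))) n = 0" for n
      by (subst fourier_coeff_add) (intro integrable_mult_right i, intro integrable_mult_right i,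
          simp only: fourier_coeff_cmult fourier_coeff_mult_cis linear.prems(2), simp)
  qed
next
  case (const c)
  then show ?case using fourier_coeff_cmult[of "complex_of_real c" g] by (simp add: mult.commute)
next
  case (add p q)
  have 1: "integrable circle_measure (\<lambda>x. g x * complex_of_real (p (cis x)))"
    "\<And>n. fourier_coeff (\<lambda>x. g x * complex_of_real (p (cis x))) n = 0"
    using add.IH(1)[OF add.prems] by auto
  have 2: "integrable circle_measure (\<lambda>x. g x * complex_of_real (q (cis x)))"
    "\<And>n. fourier_coeff (\<lambda>x. g x * complex_of_real (q (cis x))) n = 0"
    using add.IH(2)[OF add.prems] by auto
  show ?case using 1 2 fourier_coeff_add[OF 1(1) 2(1)] by (simp add: distrib_left)
next
  case (mult p q)
  have 1: "integrable circle_measure (\<lambda>x. g x * complex_of_real (p (cis x)))"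
    "\<And>n. fourier_coeff (\<lambda>x. g x * complex_of_real (p (cis x))) n = 0"
    using mult.IH(1)[OF mult.prems] by auto
  show ?case using mult.IH(2)[OF 1] by (simp add: mult.assoc)
qed

lemma integrable_mult_bounded:
  fixes g :: "real \<Rightarrow> complex"
  assumes g: "integrable circle_measure g" and f: "f \<in> borel_measurable circle_measure" "\<And>x. norm (f x) \<le> (B :: real)"
  shows "integrable circle_measure (\<lambda>x. g x * f x)"
proof (rule Bochner_Integration.integrable_bound[where f = "\<lambda>x. B *\<^sub>R norm (g x)"])
  show "integrable circle_measure (\<lambda>x. B *\<^sub>R norm (g x))"
    by (intro integrable_scaleR_right integrable_norm g)
  show "(\<lambda>x. g x * f x) \<in> borel_measurable circle_measure"
    using g f by (intro borel_measurable_times) auto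
  have "0 \<le> B" using order_trans[OF norm_ge_zero f(2)] .
  then show "AE x in circle_measure. norm (g x * f x) \<le> norm (B *\<^sub>R norm (g x))"
    using f(2) by (intro AE_I2) (auto simp: norm_mult mult.commute intro!: mult_right_mono)
qed

text \<open>
  Stone-Weierstrass: polynomials in the coordinates are dense in the continuous functions on the
  circle.
\<close>

lemma fourier_coeff_zero_integral_continuous:
  assumes g: "integrable circle_measure g" "\<And>n. fourier_coeff g n = 0"
    and \<phi>: "continuous_on UNIV (\<phi> :: complex \<Rightarrow> real)"
  shows "(LINT x|circle_measure. g x * complex_of_real (\<phi> (cis x))) = 0"
proof -
  have \<phi>s: "continuous_on (sphere 0 1) \<phi>" using \<phi> continuous_on_subset by blast
  define I where "I = (LINT x|circle_measure. norm (g x))"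
  have I0: "0 \<le> I" unfolding I_def by (rule integral_nonneg_AE) simp
  have m: "(\<lambda>x. complex_of_real (\<phi> (cis x))) \<in> borel_measurable circle_measure"
    by (intro measurable_circI borel_measurable_continuous_onI continuous_intros continuous_on_compose2[OF \<phi>]) auto
  have bd: "\<exists>B. \<forall>x. norm (complex_of_real (\<phi> (cis x))) \<le> B"
  proof -
    have "bounded (\<phi> ` sphere 0 1)" by (intro compact_imp_bounded compact_continuous_image \<phi>s) simp
    then obtain B where "\<And>y. y \<in> \<phi> ` sphere 0 1 \<Longrightarrow> norm y \<le> B" by (auto simp: bounded_iff)
    then show ?thesis by (intro exI[of _ B]) (auto simp: norm_mult)
  qed
  then have i\<phi>: "integrable circle_measure (\<lambda>x. g x * complex_of_real (\<phi> (cis x)))"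
    using integrable_mult_bounded[OF g(1) m] by blast
  have "norm (LINT x|circle_measure. g x * complex_of_real (\<phi> (cis x))) \<le> e * I" if "e > 0" for e
  proof -
    obtain p where p: "real_polynomial_function p" "\<And>x. x \<in> sphere 0 1 \<Longrightarrow> \<bar>\<phi> x - p x\<bar> < e"
      using Stone_Weierstrass_real_polynomial_function[OF compact_sphere \<phi>s \<open>e > 0\<close>] by blast
    have ip: "integrable circle_measure (\<lambda>x. g x * complex_of_real (p (cis x)))"
      "fourier_coeff (\<lambda>x. g x * complex_of_real (p (cis x))) 0 = 0"
      using fourier_coeff_zero_mult_polynomial[OF p(1) g] by auto
    then have "(LINT x|circle_measure. g x * complex_of_real (p (cis x))) = 0"
      by (simp add: fourier_coeff_def)
    then have "(LINT x|circle_measure. g x * complex_of_real (\<phi> (cis x))) =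
        (LINT x|circle_measure. g x * complex_of_real (\<phi> (cis x)) - g x * complex_of_real (p (cis x)))"
      using i\<phi> ip by simp
    also have "norm \<dots> \<le> (LINT x|circle_measure. norm (g x * complex_of_real (\<phi> (cis x)) - g x * complex_of_real (p (cis x))))"
      by (rule integral_norm_bound)
    also have "\<dots> \<le> (LINT x|circle_measure. e * norm (g x))"
    proof (rule integral_mono)
      show "integrable circle_measure (\<lambda>x. norm (g x * complex_of_real (\<phi> (cis x)) - g x * complex_of_real (p (cis x))))"
        by (intro integrable_norm Bochner_Integration.integrable_diff i\<phi> ip)
      show "integrable circle_measure (\<lambda>x. e * norm (g x))"
        by (intro integrable_mult_right integrable_norm g)
      fix x
      have "norm (g x * complex_of_real (\<phi> (cis x)) - g x * complex_of_real (p (cis x))) = norm (g x) * \<bar>\<phi> (cis x) - p (cis x)\<bar>"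
        by (simp add: norm_mult flip: right_diff_distrib of_real_diff)
      also have "\<dots> \<le> norm (g x) * e"
        using p(2)[of "cis x"] by (intro mult_left_mono) auto
      finally show "norm (g x * complex_of_real (\<phi> (cis x)) - g x * complex_of_real (p (cis x))) \<le> e * norm (g x)"
        by (simp only: mult.commute)
    qed
    also have "\<dots> = e * I" by (simp add: I_def)
    finally show ?thesis .
  qed
  note * = this
  have "norm (LINT x|circle_measure. g x * complex_of_real (\<phi> (cis x))) \<le> 0 + e" if "e > 0" for e
  proof -
    have "e / (I + 1) * I \<le> e" using I0 that by (simp add: field_simps)
    moreover have "e / (I + 1) > 0" using I0 that by simp
    ultimately show ?thesis using *[of "e / (I + 1)"] by linarith
  qed
  then have "norm (LINT x|circle_measure. g x * complex_of_real (\<phi> (cis x))) \<le> 0"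
    by (rule field_le_epsilon)
  then show ?thesis by (simp only: norm_le_zero_iff)
qed

text \<open>
  Continuous functions of \<open>cis \<theta>\<close> approximate the indicator functions of arcs, so the integrals over
  all intervals vanish.
\<close>

lemma fourier_coeff_zero_imp_AE_zero:
  assumes g: "integrable circle_measure g" "\<And>n. fourier_coeff g n = 0"
  shows "AE x in circle_measure. g x = 0"
proof -
  let ?f = "\<lambda>x. indicator {0..2*pi} x *\<^sub>R g x"
  have [measurable]: "g \<in> borel_measurable circle_measure" using g by auto
  have "AE x in lborel. ?f x = 0"
  proof (rule AE_zero_of_interval_integrals)
    show "integrable lborel ?f" using g by (simp only: integrable_circ_iff)
    fix a b :: real
    define J where "J = {a..b} \<inter> {0..2*pi}"
    show "set_lebesgue_integral lborel {a..b} ?f = 0"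
    proof (cases "J = {}")
      case True
      then have "(\<lambda>x. indicator {a..b} x *\<^sub>R ?f x) = (\<lambda>x. 0)" by (auto simp: J_def indicator_def)
      then show ?thesis unfolding set_lebesgue_integral_def by (simp only: integral_zero)
    next
      case False
      have "compact (cis ` J)"
        unfolding J_def by (intro compact_continuous_image continuous_intros compact_Int) auto
      then have K: "closed (cis ` J)" "cis ` J \<noteq> {}" using False by (auto intro: compact_imp_closed)
      \<comment> \<open>Tents over the closed arc that decrease to its indicator function.\<close>
      define \<phi> :: "nat \<Rightarrow> complex \<Rightarrow> real" where "\<phi> = (\<lambda>k z. max 0 (1 - real k * infdist z (cis ` J)))"
      have c: "continuous_on UNIV (\<phi> k)" for k
        unfolding \<phi>_def by (intro continuous_intros)
      have bd: "norm (complex_of_real (\<phi> k z)) \<le> 1" for k z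
        unfolding \<phi>_def by (auto simp: infdist_nonneg)
      have lim: "(\<lambda>k. \<phi> k z) \<longlonglongrightarrow> indicator (cis ` J) z" for z
      proof (cases "z \<in> cis ` J")
        case True
        then show ?thesis by (simp add: \<phi>_def)
      next
        case notin: False
        then have pos: "infdist z (cis ` J) > 0" using K
          by (metis in_closed_iff_infdist_zero infdist_nonneg order_le_less)
        obtain N where N: "1 / infdist z (cis ` J) \<le> real N" using real_arch_simple by blast
        have "\<phi> k z = 0" if "k \<ge> N" for k
        proof -
          have "1 \<le> real N * infdist z (cis ` J)" using N pos by (simp add: field_simps)
          also have "\<dots> \<le> real k * infdist z (cis ` J)" using that pos by (intro mult_right_mono) auto
          finally show ?thesis by (simp add: \<phi>_def)
        qed
        then have "eventually (\<lambda>k. \<phi> k z = indicator (cis ` J) z) sequentially"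
          using notin by (intro eventually_sequentiallyI[of N]) simp
        then show ?thesis by (rule tendsto_eventually)
      qed
      \<comment> \<open>At the endpoints this fails: as \<open>cis 0 = cis (2 \<pi>)\<close>, an interval may contain only one of them while its
        image contains their common value.\<close>
      have mem: "cis x \<in> cis ` J \<longleftrightarrow> x \<in> {a..b}" if "0 < x" "x < 2 * pi" for x
      proof
        assume "cis x \<in> cis ` J"
        then obtain y where y: "y \<in> J" "cis x = cis y" by blast
        then obtain n :: int where n: "x = y + 2 * pi * n"
          using sin_cos_eq_iff[of x y] by (auto simp: complex_eq_iff)
        have "\<bar>2 * pi * n\<bar> < 2 * pi * 1" using n y that by (auto simp: J_def)
        then have "\<bar>real_of_int n\<bar> < 1" by (simp add: abs_mult)
        then have "n = 0" by linarith
        then show "x \<in> {a..b}" using n y by (auto simp: J_def)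
      qed (use that in \<open>auto simp: J_def\<close>)
      have ae: "AE x in circle_measure. x \<noteq> 0 \<and> x \<noteq> 2 * pi"
        unfolding AE_circ using AE_lborel_singleton[of 0] AE_lborel_singleton[of "2*pi"] by eventually_elim auto
      have "(\<lambda>k. LINT x|circle_measure. g x * complex_of_real (\<phi> k (cis x))) \<longlonglongrightarrow> (LINT x|circle_measure. indicator {a..b} x *\<^sub>R g x)"
      proof (rule integral_dominated_convergence[where w = "\<lambda>x. norm (g x)"])
        show "(\<lambda>x. g x * complex_of_real (\<phi> k (cis x))) \<in> borel_measurable circle_measure" for k
          by (intro borel_measurable_times measurable_circI[of "\<lambda>x. complex_of_real (\<phi> k (cis x))"]
              borel_measurable_continuous_onI continuous_intros continuous_on_compose2[OF c]) auto
        show "AE x in circle_measure. norm (g x * complex_of_real (\<phi> k (cis x))) \<le> norm (g x)" for k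
          using bd by (intro AE_I2) (auto simp: norm_mult intro!: mult_left_le)
        have "AE x in circle_measure. x \<in> {0..2*pi}" by (rule AE_I2) simp
        with ae show "AE x in circle_measure. (\<lambda>k. g x * complex_of_real (\<phi> k (cis x))) \<longlonglongrightarrow> indicator {a..b} x *\<^sub>R g x"
        proof eventually_elim
          case (elim x)
          have "(\<lambda>k. g x * complex_of_real (\<phi> k (cis x))) \<longlonglongrightarrow> g x * complex_of_real (indicator (cis ` J) (cis x))"
            by (intro tendsto_intros lim)
          also have "indicator (cis ` J) (cis x) = (indicator {a..b} x :: real)"
            using mem[of x] elim by (auto simp: indicator_def)
          finally show ?case by (simp add: scaleR_conv_of_real mult.commute)
        qed
        show "(\<lambda>x. indicator {a..b} x *\<^sub>R g x) \<in> borel_measurable circle_measure"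
          by (intro borel_measurable_scaleR measurable_circI[of "indicator {a..b}"]) auto
      qed (use g in auto)
      then have "(LINT x|circle_measure. indicator {a..b} x *\<^sub>R g x) = 0"
        unfolding fourier_coeff_zero_integral_continuous[OF g c] by (simp add: LIMSEQ_const_iff)
      then show ?thesis
        unfolding integral_circ by (simp add: set_lebesgue_integral_def mult.commute)
    qed
  qed
  then show ?thesis unfolding AE_circ by eventually_elim auto
qed

text \<open>
  Riesz-Fischer yields a function with the same coefficients for which the identity holds; by
  completeness it is the given one.
\<close>

theorem parseval:
  assumes g: "circle_L2 g"
  shows "((\<lambda>n. 2 * pi * (norm (fourier_coeff g n))\<^sup>2) has_sum (LINT x|circle_measure. (norm (g x))\<^sup>2)) UNIV"
proof -
  have "(\<lambda>n. (norm (fourier_coeff g n))\<^sup>2) summable_on UNIV"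
  proof (rule nonneg_bdd_above_summable_on)
    show "bdd_above (sum (\<lambda>n. (norm (fourier_coeff g n))\<^sup>2) ` {F. F \<subseteq> UNIV \<and> finite F})"
    proof (rule bdd_aboveI2)
      fix X :: "int set" assume "X \<in> {F. F \<subseteq> UNIV \<and> finite F}"
      then show "(\<Sum>n\<in>X. (norm (fourier_coeff g n))\<^sup>2) \<le> (LINT x|circle_measure. (norm (g x))\<^sup>2) / (2 * pi)"
        using bessel_ineq[OF g, of X] by (simp add: field_simps)
    qed
  qed simp
  then obtain h where h: "circle_L2 h" "\<And>n. fourier_coeff h n = fourier_coeff g n"
    "((\<lambda>n. 2 * pi * (norm (fourier_coeff g n))\<^sup>2) has_sum (LINT x|circle_measure. (norm (h x))\<^sup>2)) UNIV"
    using riesz_fischer[of "fourier_coeff g"] by metis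
  have "AE x in circle_measure. h x - g x = 0"
    using fourier_coeff_zero_imp_AE_zero[of "\<lambda>x. h x - g x"] h(1,2) g
    by (simp add: fourier_coeff_diff circle_L2_integrable)
  then have "(LINT x|circle_measure. (norm (h x))\<^sup>2) = (LINT x|circle_measure. (norm (g x))\<^sup>2)"
    using h(1) g by (intro integral_cong_AE) (auto simp: circle_L2_def)
  with h(3) show ?thesis by simp
qed

text \<open>
  The integers are enumerated by the natural numbers, as interchanging a series with a nonnegative
  integral asks for a sequence.
\<close>

lemma parseval_nn_integral:
  assumes g: "circle_L2 g"
  shows "(\<integral>\<^sup>+x. ennreal ((norm (g x))\<^sup>2) \<partial>circle_measure) = (\<Sum>k. ennreal (2 * pi * (norm (fourier_coeff g (int_decode k)))\<^sup>2))"
proof -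
  have "((\<lambda>k. 2 * pi * (norm (fourier_coeff g (int_decode k)))\<^sup>2) has_sum (LINT x|circle_measure. (norm (g x))\<^sup>2)) UNIV"
    using parseval[OF g] by (subst has_sum_reindex_bij_betw[OF bij_int_decode])
  then have s: "(\<lambda>k. 2 * pi * (norm (fourier_coeff g (int_decode k)))\<^sup>2) sums (LINT x|circle_measure. (norm (g x))\<^sup>2)"
    by (rule has_sum_imp_sums)
  show ?thesis unfolding nn_integral_norm_sq[OF g] sums_unique[OF s]
    by (rule suminf_ennreal2[symmetric]) (use s in \<open>auto simp: sums_iff\<close>)
qed

section \<open>Geometrically weighted test functions\<close>

text \<open>
  Polynomial growth loses against geometric growth; the induction spends half of the exponent,
  \<open>sqrt q\<close>, on each further power.
\<close>

lemma power_times_geometric_bounded: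
  fixes q :: real
  assumes "q > 1"
  obtains B where "\<And>n. real n ^ k / q ^ n \<le> B"
proof -
  have "\<exists>B. \<forall>n. real n ^ k / q ^ n \<le> B" using assms
  proof (induction k arbitrary: q)
    case 0
    then show ?case by (intro exI[of _ 1]) (simp add: field_simps one_le_power)
  next
    case (Suc k)
    define r where "r = sqrt q"
    have r: "r > 1" "r * r = q" using Suc.prems by (auto simp: r_def)
    obtain B where B: "\<And>n. real n ^ k / r ^ n \<le> B" using Suc.IH[OF r(1)] by blast
    have "(\<lambda>n. real n * (1/r) ^ n) \<longlonglongrightarrow> 0"
      using powser_times_n_limit_0[of "1/r"] r by simp
    then have "Bseq (\<lambda>n. real n * (1/r) ^ n)" by (intro convergent_imp_Bseq convergentI)
    then obtain D where D: "D > 0" "\<And>n. \<bar>real n * (1/r) ^ n\<bar> \<le> D" by (auto simp: Bseq_def)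
    have "real n ^ Suc k / q ^ n \<le> D * B" for n
    proof -
      have "real n ^ Suc k / q ^ n = (real n * (1/r) ^ n) * (real n ^ k / r ^ n)"
        using r by (simp add: power_divide field_simps flip: r(2))
      also have "\<dots> \<le> D * B"
        using D(2)[of n] B[of n] D(1) r by (intro mult_mono) auto
      finally show ?thesis .
    qed
    then show ?case by blast
  qed
  then show thesis using that by blast
qed

text \<open>
  A derivative costs one factor \<open>\<bar>w\<bar>\<close>. The sum of the moduli of the two coefficients is the quantity that
  is stable under differentiation.
\<close>

lemma abs_higher_deriv_trig_le:
  fixes A B w :: real
  shows "\<exists>A' B'. (deriv ^^ k) (\<lambda>x. A * cos (w * x) + B * sin (w * x)) =
      (\<lambda>x. A' * cos (w * x) + B' * sin (w * x)) \<and> \<bar>A'\<bar> + \<bar>B'\<bar> \<le> \<bar>w\<bar> ^ k * (\<bar>A\<bar> + \<bar>B\<bar>)"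
proof (induction k)
  case (Suc k)
  then obtain A' B' where e: "(deriv ^^ k) (\<lambda>x. A * cos (w * x) + B * sin (w * x)) =
      (\<lambda>x. A' * cos (w * x) + B' * sin (w * x))" and le: "\<bar>A'\<bar> + \<bar>B'\<bar> \<le> \<bar>w\<bar> ^ k * (\<bar>A\<bar> + \<bar>B\<bar>)" by blast
  have "deriv (\<lambda>x. A' * cos (w * x) + B' * sin (w * x)) =
      (\<lambda>x. (B' * w) * cos (w * x) + (- A' * w) * sin (w * x))"
    by (rule ext, rule DERIV_imp_deriv) (auto intro!: derivative_eq_intros)
  moreover have "\<bar>B' * w\<bar> + \<bar>- A' * w\<bar> \<le> \<bar>w\<bar> ^ Suc k * (\<bar>A\<bar> + \<bar>B\<bar>)"
    using mult_left_mono[OF le, of "\<bar>w\<bar>"] by (simp add: abs_mult algebra_simps)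
  ultimately show ?case using e by (intro exI[of _ "B' * w"] exI[of _ "- A' * w"]) simp
qed (intro exI[of _ A] exI[of _ B], simp)

lemma Ck_norm_trig_le:
  assumes "Rep_circle_test \<phi> = (\<lambda>x. A * cos (w * x) + B * sin (w * x))"
  shows "Ck_norm N \<phi> \<le> (\<Sum>k\<le>N. \<bar>w\<bar> ^ k * (\<bar>A\<bar> + \<bar>B\<bar>))"
  unfolding Ck_norm_def
proof (rule cSUP_least)
  fix x
  have "\<bar>(deriv ^^ k) (Rep_circle_test \<phi>) x\<bar> \<le> \<bar>w\<bar> ^ k * (\<bar>A\<bar> + \<bar>B\<bar>)" for k
  proof -
    obtain A' B' where e: "(deriv ^^ k) (Rep_circle_test \<phi>) = (\<lambda>x. A' * cos (w * x) + B' * sin (w * x))"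
      and le: "\<bar>A'\<bar> + \<bar>B'\<bar> \<le> \<bar>w\<bar> ^ k * (\<bar>A\<bar> + \<bar>B\<bar>)"
      using abs_higher_deriv_trig_le[of k A w B] assms by auto
    have "\<bar>A' * cos (w * x)\<bar> \<le> \<bar>A'\<bar>" "\<bar>B' * sin (w * x)\<bar> \<le> \<bar>B'\<bar>"
      by (auto simp: abs_mult intro!: mult_left_le)
    then show ?thesis using le unfolding e by linarith
  qed
  then show "(\<Sum>k\<le>N. \<bar>(deriv ^^ k) (Rep_circle_test \<phi>) x\<bar>) \<le> (\<Sum>k\<le>N. \<bar>w\<bar> ^ k * (\<bar>A\<bar> + \<bar>B\<bar>))"
    by (rule sum_mono)
qed simp

text \<open>
  The Fourier coefficients of a distribution are its values on cosines and sines. Dividing these by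
  \<open>q\<^sup>n\<close> makes the family bounded in every \<open>C\<^sup>k\<close> norm, and for \<open>q > 1\<close> it still controls all coefficients up
  to geometric growth.
\<close>

definition geometric_tests :: "real \<Rightarrow> circle_test set" where
  "geometric_tests q = range (\<lambda>n::nat. (1 / q ^ n) *\<^sub>R cos_test (int n)) \<union> range (\<lambda>n::nat. (1 / q ^ n) *\<^sub>R sin_test (int n))"

lemma bounded_geometric_tests:
  assumes "q > 1"
  shows "bounded_tests (geometric_tests q)"
  unfolding bounded_tests_def
proof
  fix N
  have "\<exists>B. \<forall>n. real n ^ k / q ^ n \<le> B" for k
    using power_times_geometric_bounded[OF assms] by metis
  then obtain B where B: "\<And>k n. real n ^ k / q ^ n \<le> B k" by metis
  show "bdd_above (Ck_norm N ` geometric_tests q)"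
  proof (rule bdd_aboveI2)
    fix \<phi> assume "\<phi> \<in> geometric_tests q"
    then obtain n :: nat where "\<phi> = (1 / q ^ n) *\<^sub>R cos_test (int n) \<or> \<phi> = (1 / q ^ n) *\<^sub>R sin_test (int n)"
      by (auto simp: geometric_tests_def)
    then have "\<exists>A B'. Rep_circle_test \<phi> = (\<lambda>x. A * cos (real n * x) + B' * sin (real n * x)) \<and> \<bar>A\<bar> + \<bar>B'\<bar> = 1 / q ^ n"
    proof
      assume "\<phi> = (1 / q ^ n) *\<^sub>R cos_test (int n)"
      then show ?thesis using assms
        by (intro exI[of _ "1 / q ^ n"] exI[of _ 0]) (simp add: scaleR_circle_test.rep_eq cos_test.rep_eq)
    next
      assume "\<phi> = (1 / q ^ n) *\<^sub>R sin_test (int n)"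
      then show ?thesis using assms
        by (intro exI[of _ 0] exI[of _ "1 / q ^ n"]) (simp add: scaleR_circle_test.rep_eq sin_test.rep_eq)
    qed
    then obtain A B' where r: "Rep_circle_test \<phi> = (\<lambda>x. A * cos (real n * x) + B' * sin (real n * x))"
      and AB: "\<bar>A\<bar> + \<bar>B'\<bar> = 1 / q ^ n" by blast
    have "Ck_norm N \<phi> \<le> (\<Sum>k\<le>N. real n ^ k / q ^ n)"
      using Ck_norm_trig_le[OF r, of N] by (simp add: AB)
    also have "\<dots> \<le> (\<Sum>k\<le>N. B k)" by (intro sum_mono B)
    finally show "Ck_norm N \<phi> \<le> (\<Sum>k\<le>N. B k)" .
  qed
qed

definition tests_bound :: "real \<Rightarrow> real \<Rightarrow> 'm::finite circle_distr \<Rightarrow> bool" where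
  "tests_bound q M T \<longleftrightarrow> (\<forall>\<phi>\<in>geometric_tests q. norm (distr_pairing T \<phi>) \<le> M)"

lemma linear_distr_pairing: "linear (distr_pairing T)"
  using distr_pairing[of T] by simp

lemma distr_pairing_scaleR: "distr_pairing T (c *\<^sub>R \<phi>) = c *\<^sub>R distr_pairing T \<phi>"
  by (rule linear_scale[OF linear_distr_pairing])

text \<open>
  A distribution is bounded on bounded sets of test functions.
\<close>

lemma ex_tests_bound:
  assumes "q > 1"
  obtains M where "tests_bound q M T"
proof -
  obtain N C where C: "\<And>\<phi>. norm (distr_pairing T \<phi>) \<le> C * Ck_norm N \<phi>"
    using distr_pairing[of T] by auto
  obtain D where D: "\<And>\<phi>. \<phi> \<in> geometric_tests q \<Longrightarrow> Ck_norm N \<phi> \<le> D"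
    using bounded_geometric_tests[OF assms] unfolding bounded_tests_def bdd_above_def by blast
  have "norm (distr_pairing T \<phi>) \<le> \<bar>C\<bar> * D" if "\<phi> \<in> geometric_tests q" for \<phi>
  proof -
    have "norm (distr_pairing T \<phi>) \<le> \<bar>C\<bar> * Ck_norm N \<phi>"
      using C[of \<phi>] Ck_norm_nonneg[of N \<phi>] by (meson abs_ge_self mult_right_mono order_trans)
    also have "\<dots> \<le> \<bar>C\<bar> * D" by (intro mult_left_mono D that) auto
    finally show ?thesis .
  qed
  then show thesis using that by (auto simp: tests_bound_def)
qed

lemma norm_of_real_vec: "norm (\<chi> j. complex_of_real (x $ j)) = norm x"
  by (simp add: norm_vec_def)

lemma norm_fourier_le:
  "norm (fourier T n) \<le> norm (distr_pairing T (cos_test n)) + norm (distr_pairing T (sin_test n))"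
proof -
  let ?v = "\<lambda>x :: real ^ 'a. \<chi> j. complex_of_real (x $ j)"
  have "fourier T n = (1 / (2 * pi)) *\<^sub>R (?v (distr_pairing T (cos_test n)) - (\<chi> j. \<i> * ?v (distr_pairing T (sin_test n)) $ j))"
    unfolding fourier_def vec_eq_iff by (simp, simp add: scaleR_conv_of_real)
  moreover have "norm (\<chi> j. \<i> * ?v (distr_pairing T (sin_test n)) $ j) = norm (distr_pairing T (sin_test n))"
    by (simp add: norm_vec_def norm_mult)
  ultimately have "norm (fourier T n) \<le> 1 / (2 * pi) * (norm (distr_pairing T (cos_test n)) + norm (distr_pairing T (sin_test n)))"
    using norm_triangle_ineq4[of "?v (distr_pairing T (cos_test n))" "\<chi> j. \<i> * ?v (distr_pairing T (sin_test n)) $ j"]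
    by (simp add: norm_of_real_vec divide_simps)
  also have "\<dots> \<le> 1 * (norm (distr_pairing T (cos_test n)) + norm (distr_pairing T (sin_test n)))"
    using pi_ge_two by (intro mult_right_mono) (auto simp: divide_simps)
  finally show ?thesis by simp
qed

lemma norm_fourier_le_tests_bound:
  assumes "q > 1" "tests_bound q M T"
  shows "norm (fourier T (int n)) \<le> 2 * M * q ^ n"
proof -
  have "norm (distr_pairing T ((1 / q ^ n) *\<^sub>R cos_test (int n))) \<le> M"
    "norm (distr_pairing T ((1 / q ^ n) *\<^sub>R sin_test (int n))) \<le> M"
    using assms(2) by (auto simp: tests_bound_def geometric_tests_def)
  then have "norm (distr_pairing T (cos_test (int n))) \<le> M * q ^ n"
    "norm (distr_pairing T (sin_test (int n))) \<le> M * q ^ n"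
    using assms(1) by (simp_all add: distr_pairing_scaleR divide_simps)
  then show ?thesis using norm_fourier_le[of T "int n"] by linarith
qed

lemma fourier_add: "fourier (S + T) n = fourier S n + fourier T n"
  by (simp add: fourier_def vec_eq_iff plus_circle_distr.rep_eq add_divide_distrib diff_divide_distrib distrib_left)

lemma fourier_scaleR: "fourier (c *\<^sub>R T) n = c *\<^sub>R fourier T n"
  unfolding fourier_def vec_eq_iff
  by (simp add: scaleR_circle_distr.rep_eq, simp add: scaleR_conv_of_real right_diff_distrib mult.left_commute)

section \<open>The bilinear form on sequences of Fourier coefficients\<close>

lemma cdot_commute: "x \<cdot> y = y \<cdot> x"
  by (simp add: cdot_def mult.commute)

lemma cdot_add_right: "z \<cdot> (x + y) = z \<cdot> x + z \<cdot> y"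
  by (simp add: cdot_def distrib_left sum.distrib)

lemma cdot_scaleR_right: "z \<cdot> (c *\<^sub>R x) = c *\<^sub>R (z \<cdot> x)"
  by (simp add: cdot_def scaleR_right.sum)

lemma vcnj_add: "vcnj (x + y) = vcnj x + vcnj y"
  by (simp add: vcnj_def vec_eq_iff)

lemma vcnj_scaleR: "vcnj (c *\<^sub>R x) = c *\<^sub>R vcnj x"
  by (simp add: vcnj_def vec_eq_iff)

lemma norm_vcnj: "norm (vcnj x) = norm x"
  by (simp add: vcnj_def norm_vec_def)

lemma norm_cdot_le: "norm (x \<cdot> y) \<le> norm x * norm y"
proof -
  have "norm (x \<cdot> y) \<le> (\<Sum>j\<in>UNIV. \<bar>norm (x $ j)\<bar> * \<bar>norm (y $ j)\<bar>)"
    unfolding cdot_def by (rule order_trans[OF norm_sum]) (simp add: norm_mult)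
  also have "\<dots> \<le> norm x * norm y"
    unfolding norm_vec_def by (rule L2_set_mult_ineq)
  finally show ?thesis .
qed

lemma Re_cdot_vcnj_commute: "Re (x \<cdot> vcnj y) = Re (y \<cdot> vcnj x)"
  by (simp add: cdot_def vcnj_def mult.commute)

type_synonym 'm coeffs = "nat \<Rightarrow> complex ^ 'm"

text \<open>
  The form is written on sequences of Fourier coefficients, indexed by the natural numbers since
  negative indices do not occur in it. In the compactness argument limits of coefficients are taken
  index by index, and this avoids having to produce a distribution with the limiting coefficients.
\<close>

definition coeff_term :: "real \<Rightarrow> 'm::finite coeffs \<Rightarrow> 'm coeffs \<Rightarrow> 'm coeffs \<Rightarrow> 'm coeffs \<Rightarrow> nat \<Rightarrow> real" where
  "coeff_term t \<alpha> \<beta> \<gamma> \<delta> n = 8 * pi * real n / (t ^ (2 * n) - 1) *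
     Re (\<alpha> n \<cdot> vcnj (\<gamma> n) + \<beta> n \<cdot> vcnj (\<delta> n) - t ^ n *\<^sub>R (\<alpha> n \<cdot> vcnj (\<delta> n)) - t ^ n *\<^sub>R (\<beta> n \<cdot> vcnj (\<gamma> n)))"

definition coeff_form :: "real \<Rightarrow> 'm::finite coeffs \<Rightarrow> 'm coeffs \<Rightarrow> 'm coeffs \<Rightarrow> 'm coeffs \<Rightarrow> real" where
  "coeff_form t \<alpha> \<beta> \<gamma> \<delta> = 2 * pi * (Re ((\<beta> 0 - \<alpha> 0) \<cdot> (\<delta> 0 - \<gamma> 0)) / ln t) + (\<Sum>n. coeff_term t \<alpha> \<beta> \<gamma> \<delta> n)"

text \<open>
  The size of the coefficients of the form, multiplied by \<open>t\<^sup>n\<^sup>/\<^sup>4 t\<^sup>n\<^sup>/\<^sup>4\<close> for two arguments whose Fourier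
  coefficients grow at most like \<open>t\<^sup>n\<^sup>/\<^sup>4\<close>.
\<close>

definition form_weight :: "real \<Rightarrow> nat \<Rightarrow> real" where
  "form_weight t n = 8 * pi * real n / (t ^ (2 * n) - 1) * (1 + t ^ n) * sqrt t ^ n"

text \<open>
  For large \<open>n\<close> the weight is comparable to \<open>n t\<^sup>-\<^sup>2\<^sup>n t\<^sup>n t\<^sup>n\<^sup>/\<^sup>2 = n t\<^sup>-\<^sup>n\<^sup>/\<^sup>2\<close>.
\<close>

lemma summable_form_weight:
  assumes t: "t > 1"
  shows "summable (form_weight t)"
proof -
  define x where "x = 1 / sqrt t"
  have x: "0 < x" "x < 1" using t by (auto simp: x_def)
  have "summable (\<lambda>n. real n * x ^ n)"
    using sums_summable[OF geometric_deriv_sums[of x]] x summable_geometric[of x]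
      summable_diff[of "\<lambda>n. real (Suc n) * x ^ n" "\<lambda>n. x ^ n"] by (simp add: algebra_simps)
  then have s: "summable (\<lambda>n. 16 * pi / (1 - 1 / t\<^sup>2) * (real n * x ^ n))" by (rule summable_mult)
  have "norm (form_weight t n) \<le> 16 * pi / (1 - 1 / t\<^sup>2) * (real n * x ^ n)" for n
  proof (cases "n = 0")
    case False
    define T where "T = t ^ n"
    have T: "T \<ge> t" using False t by (simp add: T_def self_le_power)
    then have T1: "T > 1" using t by simp
    have s: "sqrt t ^ n = sqrt T" by (simp add: T_def real_sqrt_power)
    have sx: "x ^ n = 1 / sqrt T" by (simp add: x_def power_divide s)
    have sT: "sqrt T * sqrt T = T" using T1 by simp
    have "(1 - 1 / t\<^sup>2) * T\<^sup>2 \<le> T\<^sup>2 - 1"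
      using T t by (simp add: field_simps power_mono)
    then have "1 / (T\<^sup>2 - 1) \<le> 1 / ((1 - 1 / t\<^sup>2) * T\<^sup>2)"
      using t T1 by (intro divide_left_mono mult_pos_pos) (auto simp: one_less_power)
    then have "8 * pi * real n * (1 / (T\<^sup>2 - 1)) * (1 + T) * sqrt T
        \<le> 8 * pi * real n * (1 / ((1 - 1 / t\<^sup>2) * T\<^sup>2)) * (2 * T) * sqrt T"
      using T1 t by (intro mult_right_mono mult_mono mult_left_mono) (auto intro!: mult_nonneg_nonneg simp: one_le_power)
    also have "\<dots> = 16 * pi / (1 - 1 / t\<^sup>2) * (real n * (1 / sqrt T))"
    proof -
      have "1 / T\<^sup>2 * T * sqrt T = 1 / sqrt T"
        using T1 sT by (simp add: field_simps power2_eq_square)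
      then have "8 * pi * real n * (1 / (D * T\<^sup>2)) * (2 * T) * sqrt T = 16 * pi / D * (real n * (1 / sqrt T))" for D
      proof -
        have "8 * pi * real n * (1 / (D * T\<^sup>2)) * (2 * T) * sqrt T = 16 * pi / D * (real n * (1 / T\<^sup>2 * T * sqrt T))"
          by (simp add: divide_inverse)
        then show ?thesis by (simp only: \<open>1 / T\<^sup>2 * T * sqrt T = 1 / sqrt T\<close>)
      qed
      then show ?thesis .
    qed
    finally have le: "8 * pi * real n * (1 / (T\<^sup>2 - 1)) * (1 + T) * sqrt T \<le> 16 * pi / (1 - 1 / t\<^sup>2) * (real n * (1 / sqrt T))" .
    have "form_weight t n = 8 * pi * real n * (1 / (T\<^sup>2 - 1)) * (1 + T) * sqrt T"
      by (simp add: form_weight_def s T_def power_mult mult.commute[of 2])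
    moreover have "0 \<le> 8 * pi * real n * (1 / (T\<^sup>2 - 1)) * (1 + T) * sqrt T"
      using T1 by (auto intro!: mult_nonneg_nonneg simp: one_le_power)
    ultimately show ?thesis using le by (simp only: sx real_norm_def abs_of_nonneg)
  qed (simp add: form_weight_def)
  then show ?thesis by (intro summable_comparison_test[OF _ s] exI[of _ 0] allI impI)
qed

lemma form_weight_nonneg: "t > 1 \<Longrightarrow> 0 \<le> form_weight t n"
  unfolding form_weight_def by (auto intro!: mult_nonneg_nonneg divide_nonneg_nonneg simp: one_le_power)

text \<open>
  Only the second pair of arguments is assumed to be geometrically bounded: for the first pair the
  bound keeps the actual size, which tends to zero index by index in the compactness argument.
\<close>

lemma abs_coeff_term_le:
  assumes t: "t > 1"
    and c: "norm (\<gamma> n) \<le> B * sqrt (sqrt t) ^ n" "norm (\<delta> n) \<le> B * sqrt (sqrt t) ^ n"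
  shows "\<bar>coeff_term t \<alpha> \<beta> \<gamma> \<delta> n\<bar> \<le> B * form_weight t n * ((norm (\<alpha> n) + norm (\<beta> n)) / sqrt (sqrt t) ^ n)"
proof -
  define q where "q = sqrt (sqrt t)"
  have q: "q > 1" "q * q = sqrt t" using t by (auto simp: q_def)
  let ?w = "8 * pi * real n / (t ^ (2 * n) - 1)"
  have w: "0 \<le> ?w" using t by (auto intro!: divide_nonneg_nonneg simp: one_le_power)
  have p: "norm (x \<cdot> vcnj y) \<le> norm x * norm y" for x y :: "complex ^ 'a"
    using norm_cdot_le[of x "vcnj y"] by (simp add: norm_vcnj)
  let ?X = "\<alpha> n \<cdot> vcnj (\<gamma> n) + \<beta> n \<cdot> vcnj (\<delta> n) - t ^ n *\<^sub>R (\<alpha> n \<cdot> vcnj (\<delta> n)) - t ^ n *\<^sub>R (\<beta> n \<cdot> vcnj (\<gamma> n))"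
  have Bq: "0 \<le> B * q ^ n" using c(1) by (auto simp: q_def intro: order_trans[OF norm_ge_zero])
  have m: "norm x * norm y \<le> norm x * (B * q ^ n)" if "norm y \<le> B * q ^ n" for x y :: "complex ^ 'a"
    using that by (intro mult_left_mono) auto
  have "norm ?X \<le> norm (\<alpha> n \<cdot> vcnj (\<gamma> n)) + norm (\<beta> n \<cdot> vcnj (\<delta> n)) + norm (t ^ n *\<^sub>R (\<alpha> n \<cdot> vcnj (\<delta> n))) + norm (t ^ n *\<^sub>R (\<beta> n \<cdot> vcnj (\<gamma> n)))"
    by (intro order_trans[OF norm_triangle_ineq4] add_right_mono norm_triangle_ineq)
  also have "\<dots> \<le> norm (\<alpha> n) * (B * q ^ n) + norm (\<beta> n) * (B * q ^ n) + t ^ n * (norm (\<alpha> n) * (B * q ^ n)) + t ^ n * (norm (\<beta> n) * (B * q ^ n))"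
    using t c[folded q_def] unfolding norm_scaleR
    by (intro add_mono mult_mono order_trans[OF p m]) auto
  also have "\<dots> = (1 + t ^ n) * (B * q ^ n) * (norm (\<alpha> n) + norm (\<beta> n))" by (simp add: algebra_simps)
  finally have X: "norm ?X \<le> (1 + t ^ n) * (B * q ^ n) * (norm (\<alpha> n) + norm (\<beta> n))" .
  have "\<bar>coeff_term t \<alpha> \<beta> \<gamma> \<delta> n\<bar> = ?w * \<bar>Re ?X\<bar>"
    unfolding coeff_term_def using w by (simp only: abs_mult abs_of_nonneg)
  also have "\<dots> \<le> ?w * ((1 + t ^ n) * (B * q ^ n) * (norm (\<alpha> n) + norm (\<beta> n)))"
    by (intro mult_left_mono w order_trans[OF abs_Re_le_cmod X])
  also have "\<dots> = B * form_weight t n * ((norm (\<alpha> n) + norm (\<beta> n)) / q ^ n)"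
    using q by (simp add: form_weight_def power_mult_distrib flip: q(2))
  finally show ?thesis by (simp add: q_def)
qed

text \<open>
  The rate \<open>t\<^sup>n\<^sup>/\<^sup>4\<close> is one for which the product of two sequences remains summable against coefficients of
  order \<open>n t\<^sup>-\<^sup>n\<close>.
\<close>

definition geom_bounded :: "real \<Rightarrow> real \<Rightarrow> 'm::finite coeffs \<Rightarrow> bool" where
  "geom_bounded t A \<alpha> \<longleftrightarrow> (\<forall>n. norm (\<alpha> n) \<le> A * sqrt (sqrt t) ^ n)"

lemma abs_coeff_term_le_weight:
  assumes t: "t > 1" and b: "geom_bounded t A \<alpha>" "geom_bounded t A \<beta>" "geom_bounded t B \<gamma>" "geom_bounded t B \<delta>"
  shows "\<bar>coeff_term t \<alpha> \<beta> \<gamma> \<delta> n\<bar> \<le> 2 * A * B * form_weight t n"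
proof -
  have q: "sqrt (sqrt t) ^ n > 0" using t by simp
  have B: "0 \<le> B" using b(3) unfolding geom_bounded_def by (auto dest!: spec[of _ 0] intro: order_trans[OF norm_ge_zero])
  have "\<bar>coeff_term t \<alpha> \<beta> \<gamma> \<delta> n\<bar> \<le> B * form_weight t n * ((norm (\<alpha> n) + norm (\<beta> n)) / sqrt (sqrt t) ^ n)"
    using b by (intro abs_coeff_term_le[OF t]) (auto simp: geom_bounded_def)
  also have "\<dots> \<le> B * form_weight t n * (2 * A)"
  proof (rule mult_left_mono)
    have "norm (\<alpha> n) + norm (\<beta> n) \<le> 2 * A * sqrt (sqrt t) ^ n"
      using b(1,2) unfolding geom_bounded_def by (auto dest!: spec[of _ n])
    then show "(norm (\<alpha> n) + norm (\<beta> n)) / sqrt (sqrt t) ^ n \<le> 2 * A" using q by (simp add: divide_le_eq)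
  qed (use B form_weight_nonneg[OF t] in simp)
  finally show ?thesis by (simp add: mult_ac)
qed

lemma summable_coeff_term:
  assumes t: "t > 1" and b: "geom_bounded t A \<alpha>" "geom_bounded t A \<beta>" "geom_bounded t B \<gamma>" "geom_bounded t B \<delta>"
  shows "summable (\<lambda>n. \<bar>coeff_term t \<alpha> \<beta> \<gamma> \<delta> n\<bar>)" "summable (coeff_term t \<alpha> \<beta> \<gamma> \<delta>)"
proof -
  show "summable (\<lambda>n. \<bar>coeff_term t \<alpha> \<beta> \<gamma> \<delta> n\<bar>)"
    by (rule summable_comparison_test[OF _ summable_mult[OF summable_form_weight[OF t], of "2 * A * B"]])
       (use abs_coeff_term_le_weight[OF assms] in simp)
  then show "summable (coeff_term t \<alpha> \<beta> \<gamma> \<delta>)" by (rule summable_rabs_cancel)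
qed

lemma abs_coeff_form_le:
  assumes t: "t > 1" and b: "geom_bounded t A \<alpha>" "geom_bounded t A \<beta>" "geom_bounded t B \<gamma>" "geom_bounded t B \<delta>"
  shows "\<bar>coeff_form t \<alpha> \<beta> \<gamma> \<delta>\<bar> \<le> (8 * pi / ln t + 2 * (\<Sum>n. form_weight t n)) * A * B"
proof -
  have "norm (\<beta> 0 - \<alpha> 0) \<le> 2 * A"
    using b(1,2) norm_triangle_ineq4[of "\<beta> 0" "\<alpha> 0"] unfolding geom_bounded_def by (auto dest!: spec[of _ 0])
  moreover have "norm (\<delta> 0 - \<gamma> 0) \<le> 2 * B"
    using b(3,4) norm_triangle_ineq4[of "\<delta> 0" "\<gamma> 0"] unfolding geom_bounded_def by (auto dest!: spec[of _ 0])
  ultimately have "norm (\<beta> 0 - \<alpha> 0) * norm (\<delta> 0 - \<gamma> 0) \<le> (2 * A) * (2 * B)"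
    using order_trans[OF norm_ge_zero, of "\<beta> 0 - \<alpha> 0" "2 * A"] by (intro mult_mono) auto
  then have "\<bar>Re ((\<beta> 0 - \<alpha> 0) \<cdot> (\<delta> 0 - \<gamma> 0))\<bar> \<le> 4 * A * B"
    using order_trans[OF abs_Re_le_cmod norm_cdot_le[of "\<beta> 0 - \<alpha> 0" "\<delta> 0 - \<gamma> 0"]] by linarith
  then have "2 * pi * (\<bar>Re ((\<beta> 0 - \<alpha> 0) \<cdot> (\<delta> 0 - \<gamma> 0))\<bar> / ln t) \<le> 2 * pi * (4 * A * B / ln t)"
    using t by (intro mult_left_mono divide_right_mono) auto
  then have 1: "\<bar>2 * pi * (Re ((\<beta> 0 - \<alpha> 0) \<cdot> (\<delta> 0 - \<gamma> 0)) / ln t)\<bar> \<le> 2 * pi * (4 * A * B / ln t)"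
    using t by (simp add: abs_mult)
  have "\<bar>\<Sum>n. coeff_term t \<alpha> \<beta> \<gamma> \<delta> n\<bar> \<le> (\<Sum>n. \<bar>coeff_term t \<alpha> \<beta> \<gamma> \<delta> n\<bar>)"
    by (rule summable_rabs[OF summable_coeff_term(1)[OF assms]])
  also have "\<dots> \<le> (\<Sum>n. 2 * A * B * form_weight t n)"
    by (intro suminf_le abs_coeff_term_le_weight[OF assms] summable_coeff_term(1)[OF assms] summable_mult summable_form_weight t)
  also have "\<dots> = 2 * A * B * (\<Sum>n. form_weight t n)"
    by (rule suminf_mult[OF summable_form_weight[OF t]])
  finally have "\<bar>coeff_form t \<alpha> \<beta> \<gamma> \<delta>\<bar> \<le> 2 * pi * (4 * A * B / ln t) + 2 * A * B * (\<Sum>n. form_weight t n)"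
    using 1 unfolding coeff_form_def by linarith
  also have "\<dots> = (8 * pi / ln t + 2 * (\<Sum>n. form_weight t n)) * A * B"
    by (simp add: algebra_simps)
  finally show ?thesis .
qed

lemma coeff_term_add_right:
  "coeff_term t \<alpha> \<beta> (\<lambda>n. \<gamma> n + \<gamma>' n) (\<lambda>n. \<delta> n + \<delta>' n) n = coeff_term t \<alpha> \<beta> \<gamma> \<delta> n + coeff_term t \<alpha> \<beta> \<gamma>' \<delta>' n"
  unfolding coeff_term_def vcnj_add cdot_add_right distrib_left[symmetric]
  by (rule arg_cong) (simp add: algebra_simps)

lemma coeff_term_scaleR_right:
  "coeff_term t \<alpha> \<beta> (\<lambda>n. c *\<^sub>R \<gamma> n) (\<lambda>n. c *\<^sub>R \<delta> n) n = c * coeff_term t \<alpha> \<beta> \<gamma> \<delta> n"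
  unfolding coeff_term_def vcnj_scaleR cdot_scaleR_right mult.left_commute[of c]
  by (rule arg_cong) (simp add: algebra_simps)

lemma coeff_term_commute: "coeff_term t \<alpha> \<beta> \<gamma> \<delta> n = coeff_term t \<gamma> \<delta> \<alpha> \<beta> n"
proof -
  note c = Re_cdot_vcnj_commute[of "\<alpha> n" "\<gamma> n"] Re_cdot_vcnj_commute[of "\<beta> n" "\<delta> n"]
    Re_cdot_vcnj_commute[of "\<alpha> n" "\<delta> n"] Re_cdot_vcnj_commute[of "\<beta> n" "\<gamma> n"]
  show ?thesis unfolding coeff_term_def
    by (rule arg_cong) (simp add: c)
qed

lemma coeff_form_commute: "coeff_form t \<alpha> \<beta> \<gamma> \<delta> = coeff_form t \<gamma> \<delta> \<alpha> \<beta>"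
  unfolding coeff_form_def
  unfolding ext[of "coeff_term t \<alpha> \<beta> \<gamma> \<delta>" "coeff_term t \<gamma> \<delta> \<alpha> \<beta>", OF coeff_term_commute]
  by (simp add: cdot_commute[of "\<beta> 0 - \<alpha> 0"])

lemma coeff_form_add_right:
  assumes t: "t > 1" and b: "geom_bounded t A \<alpha>" "geom_bounded t A \<beta>" "geom_bounded t B \<gamma>" "geom_bounded t B \<delta>"
    "geom_bounded t B' \<gamma>'" "geom_bounded t B' \<delta>'"
  shows "coeff_form t \<alpha> \<beta> (\<lambda>n. \<gamma> n + \<gamma>' n) (\<lambda>n. \<delta> n + \<delta>' n) = coeff_form t \<alpha> \<beta> \<gamma> \<delta> + coeff_form t \<alpha> \<beta> \<gamma>' \<delta>'"
proof -
  have "(\<Sum>n. coeff_term t \<alpha> \<beta> (\<lambda>n. \<gamma> n + \<gamma>' n) (\<lambda>n. \<delta> n + \<delta>' n) n)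
      = (\<Sum>n. coeff_term t \<alpha> \<beta> \<gamma> \<delta> n) + (\<Sum>n. coeff_term t \<alpha> \<beta> \<gamma>' \<delta>' n)"
    unfolding coeff_term_add_right
    by (rule suminf_add[symmetric, OF summable_coeff_term(2)[OF t b(1-4)] summable_coeff_term(2)[OF t b(1,2,5,6)]])
  moreover have "(\<beta> 0 - \<alpha> 0) \<cdot> (\<delta> 0 + \<delta>' 0 - (\<gamma> 0 + \<gamma>' 0)) = (\<beta> 0 - \<alpha> 0) \<cdot> (\<delta> 0 - \<gamma> 0) + (\<beta> 0 - \<alpha> 0) \<cdot> (\<delta>' 0 - \<gamma>' 0)"
    by (simp add: algebra_simps flip: cdot_add_right)
  ultimately show ?thesis unfolding coeff_form_def by (simp add: add_divide_distrib distrib_left)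
qed

lemma coeff_form_scaleR_right:
  assumes t: "t > 1" and b: "geom_bounded t A \<alpha>" "geom_bounded t A \<beta>" "geom_bounded t B \<gamma>" "geom_bounded t B \<delta>"
  shows "coeff_form t \<alpha> \<beta> (\<lambda>n. c *\<^sub>R \<gamma> n) (\<lambda>n. c *\<^sub>R \<delta> n) = c * coeff_form t \<alpha> \<beta> \<gamma> \<delta>"
proof -
  have "(\<Sum>n. coeff_term t \<alpha> \<beta> (\<lambda>n. c *\<^sub>R \<gamma> n) (\<lambda>n. c *\<^sub>R \<delta> n) n) = c * (\<Sum>n. coeff_term t \<alpha> \<beta> \<gamma> \<delta> n)"
    unfolding coeff_term_scaleR_right by (rule suminf_mult[OF summable_coeff_term(2)[OF assms]])
  moreover have "(\<beta> 0 - \<alpha> 0) \<cdot> (c *\<^sub>R \<delta> 0 - c *\<^sub>R \<gamma> 0) = c *\<^sub>R ((\<beta> 0 - \<alpha> 0) \<cdot> (\<delta> 0 - \<gamma> 0))"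
    by (simp add: cdot_scaleR_right flip: scaleR_diff_right)
  ultimately show ?thesis unfolding coeff_form_def by (simp add: distrib_left)
qed

section \<open>Continuity and compactness on distributions\<close>

abbreviation fourier_seq :: "'m::finite circle_distr \<Rightarrow> 'm coeffs" where
  "fourier_seq T \<equiv> (\<lambda>n. fourier T (int n))"

lemma geom_bounded_fourier:
  assumes "t > 1" "tests_bound (sqrt (sqrt t)) M T"
  shows "geom_bounded t (2 * M) (fourier_seq T)"
  using norm_fourier_le_tests_bound[OF _ assms(2)] assms(1) by (simp add: geom_bounded_def)

lemma geom_bounded_mono: "geom_bounded t A \<alpha> \<Longrightarrow> A \<le> B \<Longrightarrow> t > 1 \<Longrightarrow> geom_bounded t B \<alpha>"
  unfolding geom_bounded_def by (meson less_imp_le mult_right_mono order_trans real_sqrt_ge_0_iff zero_le_power zero_less_one)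

lemma ex_geom_bounded_pair:
  assumes t: "t > 1"
  obtains A where "geom_bounded t A (fourier_seq S)" "geom_bounded t A (fourier_seq T)"
proof -
  have q: "sqrt (sqrt t) > 1" using t by simp
  obtain M N where "tests_bound (sqrt (sqrt t)) M S" "tests_bound (sqrt (sqrt t)) N T"
    using ex_tests_bound[OF q] by metis
  then have "geom_bounded t (2 * M) (fourier_seq S)" "geom_bounded t (2 * N) (fourier_seq T)"
    using geom_bounded_fourier t by blast+
  then show thesis
    using that[of "max (2 * M) (2 * N)"] geom_bounded_mono t by (meson max.cobounded1 max.cobounded2)
qed

lemma form_term_eq: "form_term t (a, b) (c, d) = coeff_term t (fourier_seq a) (fourier_seq b) (fourier_seq c) (fourier_seq d)"
  by (rule ext) (simp only: form_term_def coeff_term_def prod.case)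

text \<open>
  The factor \<open>n\<close> makes the term with index \<open>0\<close> vanish, so the sum over positive indices is a series over
  all natural numbers.
\<close>

lemma has_sum_form_term:
  assumes t: "t > 1"
  shows "(form_term t (a, b) (c, d) has_sum (\<Sum>n. coeff_term t (fourier_seq a) (fourier_seq b) (fourier_seq c) (fourier_seq d) n)) {0<..}"
proof -
  obtain A where A: "geom_bounded t A (fourier_seq a)" "geom_bounded t A (fourier_seq b)" using ex_geom_bounded_pair[OF t] .
  obtain B where B: "geom_bounded t B (fourier_seq c)" "geom_bounded t B (fourier_seq d)" using ex_geom_bounded_pair[OF t] .
  note s = summable_coeff_term[OF t A B]
  have "(form_term t (a, b) (c, d) has_sum (\<Sum>n. coeff_term t (fourier_seq a) (fourier_seq b) (fourier_seq c) (fourier_seq d) n)) UNIV"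
    unfolding form_term_eq
    by (rule norm_summable_imp_has_sum) (use s in \<open>simp_all add: summable_sums\<close>)
  then show ?thesis
    by (rule has_sum_cong_neutral[THEN iffD1, rotated -1]) (auto simp: form_term_eq coeff_term_def)
qed

lemma annulus_form_eq:
  assumes t: "t > 1"
  shows "annulus_form t (a, b) (c, d) = coeff_form t (fourier_seq a) (fourier_seq b) (fourier_seq c) (fourier_seq d)"
  unfolding annulus_form_def coeff_form_def prod.case of_nat_0
  using infsumI[OF has_sum_form_term[OF t, of a b c d]] by simp

lemma linear_coeff_form:
  assumes t: "t > 1" and A: "geom_bounded t A \<alpha>" "geom_bounded t A \<beta>"
  shows "linear (\<lambda>(c, d). coeff_form t \<alpha> \<beta> (fourier_seq c) (fourier_seq d))"
proof (rule linearI)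
  fix v w :: "'a circle_distr \<times> 'a circle_distr" and r :: real
  obtain c d where v: "v = (c, d)" by (cases v)
  obtain c' d' where w: "w = (c', d')" by (cases w)
  obtain B where B: "geom_bounded t B (fourier_seq c)" "geom_bounded t B (fourier_seq d)" using ex_geom_bounded_pair[OF t] .
  obtain B' where B': "geom_bounded t B' (fourier_seq c')" "geom_bounded t B' (fourier_seq d')" using ex_geom_bounded_pair[OF t] .
  show "(case v + w of (c, d) \<Rightarrow> coeff_form t \<alpha> \<beta> (fourier_seq c) (fourier_seq d)) =
      (case v of (c, d) \<Rightarrow> coeff_form t \<alpha> \<beta> (fourier_seq c) (fourier_seq d)) + (case w of (c, d) \<Rightarrow> coeff_form t \<alpha> \<beta> (fourier_seq c) (fourier_seq d))"
    unfolding v w using coeff_form_add_right[OF t A B B'] by (simp add: fourier_add)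
  show "(case r *\<^sub>R v of (c, d) \<Rightarrow> coeff_form t \<alpha> \<beta> (fourier_seq c) (fourier_seq d)) =
      r *\<^sub>R (case v of (c, d) \<Rightarrow> coeff_form t \<alpha> \<beta> (fourier_seq c) (fourier_seq d))"
    unfolding v using coeff_form_scaleR_right[OF t A B] by (simp add: fourier_scaleR)
qed

text \<open>
  These are the neighbourhoods given by the bounded set of geometric test functions. A bound strictly
  below \<open>\<eta>\<close> that is uniform over the set leaves room for a perturbation, which makes the neighbourhood
  open.
\<close>

definition distr_nhd :: "real \<Rightarrow> 'm::finite circle_distr \<Rightarrow> real \<Rightarrow> 'm circle_distr set" where
  "distr_nhd q T \<eta> = {S. \<exists>\<delta><\<eta>. tests_bound q \<delta> (S - T)}"

lemma open_distr_nhd: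
  assumes "q > 1"
  shows "open (distr_nhd q T \<eta>)"
  unfolding open_circle_distr_def
proof
  fix S assume "S \<in> distr_nhd q T \<eta>"
  then obtain \<delta> where \<delta>: "\<delta> < \<eta>" "tests_bound q \<delta> (S - T)" by (auto simp: distr_nhd_def)
  define e where "e = (\<eta> - \<delta>) / 2"
  have e: "e > 0" "\<delta> + e < \<eta>" using \<delta>(1) by (auto simp: e_def field_simps)
  have "R \<in> distr_nhd q T \<eta>" if R: "\<forall>\<phi>\<in>geometric_tests q. norm (distr_pairing R \<phi> - distr_pairing S \<phi>) < e" for R
  proof -
    have "norm (distr_pairing (R - T) \<phi>) \<le> \<delta> + e" if \<phi>: "\<phi> \<in> geometric_tests q" for \<phi>
    proof -
      have "norm (distr_pairing S \<phi> - distr_pairing T \<phi>) \<le> \<delta>"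
        using \<delta>(2) \<phi> by (simp add: tests_bound_def minus_circle_distr.rep_eq)
      then show ?thesis
        using R[rule_format, OF \<phi>] norm_triangle_ineq[of "distr_pairing R \<phi> - distr_pairing S \<phi>" "distr_pairing S \<phi> - distr_pairing T \<phi>"]
        by (simp add: minus_circle_distr.rep_eq)
    qed
    then show ?thesis using e(2) by (auto simp: distr_nhd_def tests_bound_def)
  qed
  then show "\<exists>K \<epsilon>. bounded_tests K \<and> \<epsilon> > 0 \<and>
      {R. \<forall>\<phi>\<in>K. norm (distr_pairing R \<phi> - distr_pairing S \<phi>) < \<epsilon>} \<subseteq> distr_nhd q T \<eta>"
    using bounded_geometric_tests[OF assms] e(1) by (intro exI[of _ "geometric_tests q"] exI[of _ e]) auto
qed

lemma self_in_distr_nhd: "\<eta> > 0 \<Longrightarrow> T \<in> distr_nhd q T \<eta>"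
  by (auto simp: distr_nhd_def tests_bound_def zero_circle_distr.rep_eq intro!: exI[of _ 0])

text \<open>
  By linearity it suffices to bound the form near the origin, where the geometric bound of the
  Fourier coefficients is proportional to the size of the neighbourhood.
\<close>

lemma continuous_coeff_form:
  assumes t: "t > 1" and A: "geom_bounded t A \<alpha>" "geom_bounded t A \<beta>"
  shows "continuous_on UNIV (\<lambda>(c, d). coeff_form t \<alpha> \<beta> (fourier_seq c) (fourier_seq d))"
proof -
  let ?L = "\<lambda>(c, d). coeff_form t \<alpha> \<beta> (fourier_seq c) (fourier_seq d)"
  define q where "q = sqrt (sqrt t)"
  have q: "q > 1" using t by (simp add: q_def)
  define M where "M = \<bar>(8 * pi / ln t + 2 * (\<Sum>n. form_weight t n)) * A\<bar>"
  have "open (?L -` V)" if V: "open V" for V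
    unfolding open_prod_def
  proof
    fix x assume x: "x \<in> ?L -` V"
    obtain c d where x': "x = (c, d)" by (cases x)
    obtain e where e: "e > 0" "ball (?L x) e \<subseteq> V" using x V by (auto simp: open_contains_ball)
    define \<eta> where "\<eta> = e / (2 * (M + 1))"
    have M: "M \<ge> 0" by (simp add: M_def)
    then have \<eta>: "\<eta> > 0" "M * (2 * \<eta>) < e" using e(1) by (auto simp: \<eta>_def field_simps)
    have "?L y \<in> V" if y: "y \<in> distr_nhd q c \<eta> \<times> distr_nhd q d \<eta>" for y
    proof -
      obtain c' d' where y': "y = (c', d')" by (cases y)
      have tb: "tests_bound q \<eta> (c' - c)" "tests_bound q \<eta> (d' - d)"
        using y unfolding y' distr_nhd_def tests_bound_def by fastforce+
      have "?L y - ?L x = ?L (y - x)" by (rule linear_diff[OF linear_coeff_form[OF assms], symmetric])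
      also have "\<dots> = coeff_form t \<alpha> \<beta> (fourier_seq (c' - c)) (fourier_seq (d' - d))" by (simp add: x' y')
      finally have "\<bar>?L y - ?L x\<bar> \<le> (8 * pi / ln t + 2 * (\<Sum>n. form_weight t n)) * A * (2 * \<eta>)"
        using abs_coeff_form_le[OF t A geom_bounded_fourier[OF t] geom_bounded_fourier[OF t]] tb
        unfolding q_def by metis
      also have "\<dots> \<le> M * (2 * \<eta>)" unfolding M_def using \<eta>(1) by (intro mult_right_mono abs_ge_self) auto
      also have "\<dots> < e" by (rule \<eta>)
      finally have "?L y \<in> ball (?L x) e" by (simp add: dist_real_def abs_minus_commute)
      then show ?thesis using e(2) by blast
    qed
    then show "\<exists>P Q. open P \<and> open Q \<and> x \<in> P \<times> Q \<and> P \<times> Q \<subseteq> ?L -` V"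
      using open_distr_nhd[OF q] self_in_distr_nhd[OF \<eta>(1)] unfolding x'
      by (intro exI[of _ "distr_nhd q c \<eta>"] exI[of _ "distr_nhd q d \<eta>"]) auto
  qed
  then show ?thesis by (simp add: continuous_on_open_vimage)
qed

lemma annulus_form_conv:
  assumes "t > 1"
  shows "annulus_form t (a, b) = (\<lambda>(c, d). coeff_form t (fourier_seq a) (fourier_seq b) (fourier_seq c) (fourier_seq d))"
  by (rule ext) (simp add: annulus_form_eq[OF assms] split: prod.split)

lemma annulus_form_commute:
  assumes "t > 1"
  shows "annulus_form t u v = annulus_form t v u"
  by (cases u, cases v) (simp only: annulus_form_eq[OF assms] coeff_form_commute)

lemma linear_annulus_form:
  assumes t: "t > 1"
  shows "linear (annulus_form t u)"
proof (cases u)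
  case (Pair a b)
  obtain A where "geom_bounded t A (fourier_seq a)" "geom_bounded t A (fourier_seq b)" using ex_geom_bounded_pair[OF t] .
  then show ?thesis unfolding Pair annulus_form_conv[OF t] by (rule linear_coeff_form[OF t])
qed

lemma bilinear_annulus_form:
  assumes t: "t > 1"
  shows "bilinear (annulus_form t :: 'm::finite circle_distr \<times> 'm circle_distr \<Rightarrow> _)"
  unfolding bilinear_def
proof (intro conjI allI)
  fix v :: "'m circle_distr \<times> 'm circle_distr"
  show "linear (annulus_form t v)" by (rule linear_annulus_form[OF t])
  then show "linear (\<lambda>u. annulus_form t u v)"
    unfolding annulus_form_commute[OF t, of _ v] .
qed

text \<open>
  A bounded set is absorbed by the neighbourhood of \<open>0\<close> on which the coefficients are bounded by
  \<open>2 t\<^sup>n\<^sup>/\<^sup>4\<close>, and the coefficients scale linearly.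
\<close>

lemma vN_bounded_imp_geom_bounded:
  fixes S :: "('m::finite circle_distr \<times> 'm circle_distr) set"
  assumes t: "t > 1" and S: "vN_bounded S"
  obtains B where "\<And>c d. (c, d) \<in> S \<Longrightarrow> geom_bounded t B (fourier_seq c) \<and> geom_bounded t B (fourier_seq d)"
proof -
  define q where "q = sqrt (sqrt t)"
  have q: "q > 1" using t by (simp add: q_def)
  let ?U = "distr_nhd q (0 :: 'm circle_distr) 1 \<times> distr_nhd q (0 :: 'm circle_distr) 1"
  have "open ?U" by (intro open_Times open_distr_nhd q)
  moreover have "0 \<in> ?U" by (simp add: zero_prod_def self_in_distr_nhd)
  ultimately have "\<exists>k>0. S \<subseteq> (*\<^sub>R) k ` ?U" by (intro S[unfolded vN_bounded_def, THEN spec, THEN mp] conjI)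
  then obtain k where k: "k > 0" "S \<subseteq> (*\<^sub>R) k ` ?U" by (elim exE conjE)
  have *: "geom_bounded t (2 * k) (fourier_seq (k *\<^sub>R c))" if "c \<in> distr_nhd q 0 1" for c :: "'m circle_distr"
  proof -
    have "tests_bound q 1 c" using that unfolding distr_nhd_def tests_bound_def by fastforce
    then have "geom_bounded t 2 (fourier_seq c)" using geom_bounded_fourier[OF t, of 1] by (simp add: q_def)
    then have "norm (k *\<^sub>R fourier_seq c n) \<le> 2 * k * sqrt (sqrt t) ^ n" for n
      using mult_left_mono[of "norm (fourier_seq c n)" "2 * sqrt (sqrt t) ^ n" k] k(1) by (simp add: geom_bounded_def mult_ac)
    then show ?thesis unfolding geom_bounded_def fourier_scaleR by blast
  qed
  show thesis
  proof (rule that)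
    fix c d assume "(c, d) \<in> S"
    from subsetD[OF k(2) this] obtain p where p: "p \<in> ?U" "(c, d) = k *\<^sub>R p" by (elim imageE)
    define c' d' where "c' = fst p" and "d' = snd p"
    then have "c = k *\<^sub>R c'" "d = k *\<^sub>R d'" "c' \<in> distr_nhd q 0 1" "d' \<in> distr_nhd q 0 1"
      using p by (auto simp: scaleR_prod_def)
    then show "geom_bounded t (2 * k) (fourier_seq c) \<and> geom_bounded t (2 * k) (fourier_seq d)" using * by blast
  qed
qed

lemma coeff_form_diff_left:
  assumes t: "t > 1" and b: "geom_bounded t A \<alpha>" "geom_bounded t A \<beta>" "geom_bounded t A \<alpha>'" "geom_bounded t A \<beta>'"
    "geom_bounded t B \<gamma>" "geom_bounded t B \<delta>"
  shows "coeff_form t \<alpha> \<beta> \<gamma> \<delta> - coeff_form t \<alpha>' \<beta>' \<gamma> \<delta> = coeff_form t (\<lambda>n. \<alpha> n - \<alpha>' n) (\<lambda>n. \<beta> n - \<beta>' n) \<gamma> \<delta>"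
proof -
  have m: "geom_bounded t A (\<lambda>n. (-1) *\<^sub>R \<alpha>' n)" "geom_bounded t A (\<lambda>n. (-1) *\<^sub>R \<beta>' n)"
    using b by (simp_all add: geom_bounded_def)
  have "coeff_form t \<gamma> \<delta> (\<lambda>n. \<alpha> n + (-1) *\<^sub>R \<alpha>' n) (\<lambda>n. \<beta> n + (-1) *\<^sub>R \<beta>' n)
      = coeff_form t \<gamma> \<delta> \<alpha> \<beta> + (-1) * coeff_form t \<gamma> \<delta> \<alpha>' \<beta>'"
    unfolding coeff_form_add_right[OF t b(5,6,1,2) m] coeff_form_scaleR_right[OF t b(5,6,3,4)] ..
  then show ?thesis by (simp add: coeff_form_commute[of t _ _ \<gamma> \<delta>])
qed

text \<open>
  On the neighbourhood defined by the geometric test functions the coefficients divided by \<open>t\<^sup>n\<^sup>/\<^sup>4\<close> are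
  bounded. A diagonal subsequence makes all of them converge, and the functional with the limiting
  coefficients is the limit: the errors are dominated by multiples of \<open>form_weight\<close>, so they can be
  summed before passing to the limit.
\<close>

lemma compact_annulus_form:
  assumes t: "t > 1"
  shows "compact_bilinear (annulus_form t :: 'm::finite circle_distr \<times> 'm circle_distr \<Rightarrow> _)"
  unfolding compact_bilinear_def
proof (intro conjI allI)
  fix u :: "'m circle_distr \<times> 'm circle_distr"
  show "continuous_on UNIV (annulus_form t u)"
  proof (cases u)
    case (Pair a b)
    obtain A where "geom_bounded t A (fourier_seq a)" "geom_bounded t A (fourier_seq b)" using ex_geom_bounded_pair[OF t] .
    then show ?thesis unfolding Pair annulus_form_conv[OF t] by (rule continuous_coeff_form[OF t])
  qed
next
  define q where "q = sqrt (sqrt t)"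
  have q: "q > 1" using t by (simp add: q_def)
  then have qn: "q ^ n > 0" for n by simp
  let ?U = "distr_nhd q (0 :: 'm circle_distr) 1 \<times> distr_nhd q (0 :: 'm circle_distr) 1"
  have 1: "open ?U" "0 \<in> ?U"
    using q by (auto simp: zero_prod_def self_in_distr_nhd intro!: open_Times open_distr_nhd)
  have 2: "\<exists>L r. linear L \<and> continuous_on UNIV L \<and> strict_mono (r :: nat \<Rightarrow> nat) \<and>
      (\<forall>S. vN_bounded S \<longrightarrow> uniform_limit S (\<lambda>k. annulus_form t (u (r k))) L sequentially)"
    if u: "range u \<subseteq> ?U" for u :: "nat \<Rightarrow> 'm circle_distr \<times> 'm circle_distr"
  proof -
    define a b where "a = (\<lambda>k. fourier_seq (fst (u k)))" and "b = (\<lambda>k. fourier_seq (snd (u k)))"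
    have uk: "u k = (fst (u k), snd (u k))" for k by simp
    have tb: "geom_bounded t 2 (fourier_seq c)" if "c \<in> distr_nhd q 0 1" for c :: "'m circle_distr"
    proof -
      have "tests_bound q 1 c" using that unfolding distr_nhd_def tests_bound_def by fastforce
      then show ?thesis using geom_bounded_fourier[OF t, of 1] by (simp add: q_def)
    qed
    have ab: "geom_bounded t 2 (a k)" "geom_bounded t 2 (b k)" for k
      using u uk[of k] unfolding a_def b_def by (auto intro!: tb simp: image_subset_iff mem_Times_iff)
    define f where "f = (\<lambda>k n. (inverse (q ^ n) *\<^sub>R a k n, inverse (q ^ n) *\<^sub>R b k n))"
    have "norm (f k n) \<le> 4" for k n
    proof -
      have "norm (inverse (q ^ n) *\<^sub>R a k n) \<le> 2" "norm (inverse (q ^ n) *\<^sub>R b k n) \<le> 2"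
        using ab[of k] qn[of n] by (simp_all add: geom_bounded_def q_def field_simps)
      then show ?thesis unfolding f_def using norm_Pair_le[of "inverse (q ^ n) *\<^sub>R a k n" "inverse (q ^ n) *\<^sub>R b k n"] by linarith
    qed
    then have fb: "\<And>k n. norm (f k n) \<le> 4" .
    obtain r where r: "strict_mono (r :: nat \<Rightarrow> nat)" "\<And>n. \<exists>l. (\<lambda>k. f (r k) n) \<longlonglongrightarrow> l"
      using function_convergent_subsequence[of UNIV f 4, OF _ fb] by (metis UNIV_I countableI_type)
    then obtain l where l: "\<And>n. (\<lambda>k. f (r k) n) \<longlonglongrightarrow> l n" by metis
    define \<alpha> \<beta> where "\<alpha> = (\<lambda>n. q ^ n *\<^sub>R fst (l n))" and "\<beta> = (\<lambda>n. q ^ n *\<^sub>R snd (l n))"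
    have lim: "(\<lambda>k. a (r k) n) \<longlonglongrightarrow> \<alpha> n" "(\<lambda>k. b (r k) n) \<longlonglongrightarrow> \<beta> n" for n
      using tendsto_scaleR[OF tendsto_const tendsto_fst[OF l[of n]], of "q ^ n"]
        tendsto_scaleR[OF tendsto_const tendsto_snd[OF l[of n]], of "q ^ n"] q
      unfolding \<alpha>_def \<beta>_def f_def by simp_all
    have \<alpha>\<beta>: "geom_bounded t 2 \<alpha>" "geom_bounded t 2 \<beta>"
      unfolding geom_bounded_def
      using Lim_norm_ubound[OF trivial_limit_sequentially lim(1)] Lim_norm_ubound[OF trivial_limit_sequentially lim(2)] ab
      by (auto simp: geom_bounded_def)
    let ?L = "\<lambda>(c, d). coeff_form t \<alpha> \<beta> (fourier_seq c) (fourier_seq d)"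
    have "uniform_limit S (\<lambda>k. annulus_form t (u (r k))) ?L sequentially" if S: "vN_bounded S" for S
    proof -
      obtain B where B: "\<And>c d. (c, d) \<in> S \<Longrightarrow> geom_bounded t B (fourier_seq c) \<and> geom_bounded t B (fourier_seq d)"
        by (rule vN_bounded_imp_geom_bounded[OF t S]) (rule that)
      \<comment> \<open>The majorant of the \<open>n\<close>-th error term does not depend on the argument of the functional, so its sum
        controls the error uniformly on the bounded set.\<close>
      define h where "h = (\<lambda>n k. form_weight t n * ((norm (a (r k) n - \<alpha> n) + norm (b (r k) n - \<beta> n)) / q ^ n))"
      have d: "norm (a (r k) n - \<alpha> n) \<le> 4 * q ^ n" "norm (b (r k) n - \<beta> n) \<le> 4 * q ^ n" for k n
        using ab[of "r k"] \<alpha>\<beta> norm_triangle_ineq4[of "a (r k) n" "\<alpha> n"] norm_triangle_ineq4[of "b (r k) n" "\<beta> n"]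
        unfolding geom_bounded_def q_def by (smt (verit))+
      have hb: "norm (h n k) \<le> 8 * form_weight t n" for n k
      proof -
        have "(norm (a (r k) n - \<alpha> n) + norm (b (r k) n - \<beta> n)) / q ^ n \<le> 8"
          using d[of k n] qn[of n] by (simp add: divide_le_eq)
        then have "form_weight t n * ((norm (a (r k) n - \<alpha> n) + norm (b (r k) n - \<beta> n)) / q ^ n) \<le> form_weight t n * 8"
          by (intro mult_left_mono form_weight_nonneg t)
        then show ?thesis unfolding h_def using form_weight_nonneg[OF t, of n] qn[of n]
          by (simp add: abs_of_nonneg mult.commute)
      qed
      have hs: "summable (\<lambda>n. h n k)" for k
        by (rule summable_comparison_test[OF _ summable_mult[OF summable_form_weight[OF t], of 8]])
           (use hb in auto)
      have "(\<lambda>k. h n k) \<longlonglongrightarrow> form_weight t n * ((norm (\<alpha> n - \<alpha> n) + norm (\<beta> n - \<beta> n)) / q ^ n)" for n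
        unfolding h_def using q by (intro tendsto_intros lim) auto
      then have h0: "(\<lambda>k. h n k) \<longlonglongrightarrow> 0" for n by simp
      have "((\<lambda>k. \<Sum>n. h n k) \<longlongrightarrow> (\<Sum>n. 0)) sequentially"
        using tannerys_theorem[OF h0 _ summable_mult[OF summable_form_weight[OF t], of 8] sequentially_bot] hb
        by (auto simp: always_eventually case_prod_beta)
      then have hlim: "(\<lambda>k. \<Sum>n. h n k) \<longlonglongrightarrow> 0" by simp
      define z where "z = (\<lambda>k. norm ((b (r k) 0 - \<beta> 0) - (a (r k) 0 - \<alpha> 0)))"
      have "z \<longlonglongrightarrow> norm ((\<beta> 0 - \<beta> 0) - (\<alpha> 0 - \<alpha> 0))"
        unfolding z_def by (intro tendsto_intros lim)
      then have zlim: "z \<longlonglongrightarrow> 0" by simp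
      define E where "E = (\<lambda>k. 2 * pi * (z k * (2 * \<bar>B\<bar>) / ln t) + \<bar>B\<bar> * (\<Sum>n. h n k))"
      have "E \<longlonglongrightarrow> 2 * pi * (0 * (2 * \<bar>B\<bar>) / ln t) + \<bar>B\<bar> * 0"
        unfolding E_def using t by (intro tendsto_intros zlim hlim) auto
      then have E0: "E \<longlonglongrightarrow> 0" by simp
      have main: "\<bar>annulus_form t (u (r k)) v - ?L v\<bar> \<le> E k" if v: "v \<in> S" for v k
      proof -
        obtain c d where v': "v = (c, d)" by (cases v)
        have cd: "geom_bounded t B (fourier_seq c)" "geom_bounded t B (fourier_seq d)" using B v v' by auto
        have B': "geom_bounded t \<bar>B\<bar> (fourier_seq c)" "geom_bounded t \<bar>B\<bar> (fourier_seq d)"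
          using cd t by (auto intro: geom_bounded_mono)
        let ?x = "\<lambda>n. a (r k) n - \<alpha> n" and ?y = "\<lambda>n. b (r k) n - \<beta> n"
        have "annulus_form t (u (r k)) v = coeff_form t (a (r k)) (b (r k)) (fourier_seq c) (fourier_seq d)"
          unfolding v' a_def b_def by (subst uk) (rule annulus_form_eq[OF t])
        then have e: "annulus_form t (u (r k)) v - ?L v = coeff_form t ?x ?y (fourier_seq c) (fourier_seq d)"
          using coeff_form_diff_left[OF t ab \<alpha>\<beta> cd] by (simp add: v')
        have le: "\<bar>coeff_term t ?x ?y (fourier_seq c) (fourier_seq d) n\<bar> \<le> \<bar>B\<bar> * h n k" for n
          using abs_coeff_term_le[OF t, of "fourier_seq c" n "\<bar>B\<bar>" "fourier_seq d" ?x ?y] B'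
          by (simp add: geom_bounded_def h_def q_def mult.assoc)
        have s: "summable (\<lambda>n. \<bar>B\<bar> * h n k)" by (rule summable_mult[OF hs])
        have s': "summable (\<lambda>n. \<bar>coeff_term t ?x ?y (fourier_seq c) (fourier_seq d) n\<bar>)"
          by (rule summable_comparison_test[OF _ s]) (use le in auto)
        have "\<bar>\<Sum>n. coeff_term t ?x ?y (fourier_seq c) (fourier_seq d) n\<bar> \<le> (\<Sum>n. \<bar>coeff_term t ?x ?y (fourier_seq c) (fourier_seq d) n\<bar>)"
          by (rule summable_rabs[OF s'])
        also have "\<dots> \<le> (\<Sum>n. \<bar>B\<bar> * h n k)" by (intro suminf_le le s s')
        also have "\<dots> = \<bar>B\<bar> * (\<Sum>n. h n k)" by (rule suminf_mult[OF hs])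
        finally have 2: "\<bar>\<Sum>n. coeff_term t ?x ?y (fourier_seq c) (fourier_seq d) n\<bar> \<le> \<bar>B\<bar> * (\<Sum>n. h n k)" .
        have "norm (fourier_seq d 0 - fourier_seq c 0) \<le> 2 * \<bar>B\<bar>"
          using B' norm_triangle_ineq4[of "fourier_seq d 0" "fourier_seq c 0"] unfolding geom_bounded_def by (auto dest!: spec[of _ 0])
        then have "norm ((?y 0 - ?x 0) \<cdot> (fourier_seq d 0 - fourier_seq c 0)) \<le> z k * (2 * \<bar>B\<bar>)"
          unfolding z_def by (intro order_trans[OF norm_cdot_le] mult_left_mono) auto
        then have "\<bar>Re ((?y 0 - ?x 0) \<cdot> (fourier_seq d 0 - fourier_seq c 0))\<bar> \<le> z k * (2 * \<bar>B\<bar>)"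
          by (rule order_trans[OF abs_Re_le_cmod])
        then have "2 * pi * (\<bar>Re ((?y 0 - ?x 0) \<cdot> (fourier_seq d 0 - fourier_seq c 0))\<bar> / ln t) \<le> 2 * pi * (z k * (2 * \<bar>B\<bar>) / ln t)"
          using t by (intro mult_left_mono divide_right_mono) auto
        then have 3: "\<bar>2 * pi * (Re ((?y 0 - ?x 0) \<cdot> (fourier_seq d 0 - fourier_seq c 0)) / ln t)\<bar> \<le> 2 * pi * (z k * (2 * \<bar>B\<bar>) / ln t)"
          using t by (simp add: abs_mult)
        show ?thesis unfolding e unfolding coeff_form_def E_def using 2 3 by linarith
      qed
      show ?thesis
      proof (rule uniform_limitI)
        fix e :: real assume "e > 0"
        then have "eventually (\<lambda>k. E k < e) sequentially" using E0 by (rule order_tendstoD(2)[rotated])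
        then show "\<forall>\<^sub>F k in sequentially. \<forall>v\<in>S. dist (annulus_form t (u (r k)) v) (?L v) < e"
          by eventually_elim (use main in \<open>auto simp: dist_real_def intro: le_less_trans\<close>)
      qed
    qed
    then show ?thesis
      using linear_coeff_form[OF t \<alpha>\<beta>] continuous_coeff_form[OF t \<alpha>\<beta>] r(1) by blast
  qed
  show "\<exists>U. open U \<and> 0 \<in> U \<and>
     (\<forall>u::nat \<Rightarrow> 'm circle_distr \<times> 'm circle_distr. range u \<subseteq> U \<longrightarrow>
       (\<exists>L r. linear L \<and> continuous_on UNIV L \<and> strict_mono (r :: nat \<Rightarrow> nat) \<and>
         (\<forall>S. vN_bounded S \<longrightarrow> uniform_limit S (\<lambda>k. annulus_form t (u (r k))) L sequentially)))"
    by (intro exI[of _ ?U] conjI allI impI 1) (rule 2)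
qed

section \<open>Integration in logarithmic polar coordinates\<close>

definition logpolar :: "real \<Rightarrow> real \<Rightarrow> complex" where
  "logpolar s \<theta> = of_real (exp s) * cis \<theta>"

lemma norm_logpolar [simp]: "norm (logpolar s \<theta>) = exp s"
  by (simp add: logpolar_def norm_mult)

lemma Re_logpolar: "Re (logpolar s \<theta>) = exp s * cos \<theta>"
  and Im_logpolar: "Im (logpolar s \<theta>) = exp s * sin \<theta>"
  by (simp_all add: logpolar_def)

lemma measurable_logpolar_pair [measurable]: "(\<lambda>p. logpolar (fst p) (snd p)) \<in> borel_measurable (borel \<Otimes>\<^sub>M borel)"
  unfolding logpolar_def borel_prod by (intro borel_measurable_continuous_onI continuous_intros)

text \<open>
  A linear map that permutes orthonormal bases maps boxes to boxes with the same side lengths, and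
  boxes determine Lebesgue measure.
\<close>

lemma distr_lborel_basis_bij:
  fixes f :: "'a::euclidean_space \<Rightarrow> 'b::euclidean_space"
  assumes f: "linear f" and bij: "bij_betw f Basis Basis"
  shows "distr lborel borel f = lborel"
proof (rule lborel_eqI[symmetric])
  have "continuous_on UNIV f" by (intro linear_continuous_on linear_conv_bounded_linear[THEN iffD1] f)
  then have fm: "f \<in> borel_measurable lborel" by (simp add: borel_measurable_continuous_onI)
  have fB: "f b \<in> Basis" if "b \<in> Basis" for b using bij that by (auto simp: bij_betw_def)
  have inj: "f b = f b' \<longleftrightarrow> b = b'" if "b \<in> Basis" "b' \<in> Basis" for b b'
    using bij that by (auto simp: bij_betw_def inj_on_def)
  have inner_f: "f x \<bullet> f b = x \<bullet> b" if b: "b \<in> Basis" for x b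
  proof -
    have "f x = f (\<Sum>c\<in>Basis. (x \<bullet> c) *\<^sub>R c)" by (simp add: euclidean_representation)
    also have "\<dots> = (\<Sum>c\<in>Basis. (x \<bullet> c) *\<^sub>R f c)" by (simp add: linear_sum[OF f] linear_scale[OF f])
    finally have "f x \<bullet> f b = (\<Sum>c\<in>Basis. (x \<bullet> c) * (f c \<bullet> f b))" by (simp add: inner_sum_left)
    also have "\<dots> = (\<Sum>c\<in>Basis. if c = b then x \<bullet> c else 0)"
      by (intro sum.cong refl) (use fB b inj in \<open>auto simp: inner_Basis\<close>)
    finally show ?thesis using b by simp
  qed
  fix l u :: 'b assume lu: "\<And>b. b \<in> Basis \<Longrightarrow> l \<bullet> b \<le> u \<bullet> b"
  define pull where "pull = (\<lambda>y :: 'b. \<Sum>b\<in>Basis. (y \<bullet> f b) *\<^sub>R b)"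
  have pull: "pull y \<bullet> b = y \<bullet> f b" if "b \<in> Basis" for y b
    unfolding pull_def using that by simp
  have Bim: "Basis = f ` Basis" using bij by (simp add: bij_betw_def)
  have "f -` box l u = box (pull l) (pull u)"
    unfolding box_def by (subst Bim) (auto simp: pull inner_f)
  then have "emeasure (distr lborel borel f) (box l u) = emeasure lborel (box (pull l) (pull u))"
    using fm by (subst emeasure_distr) auto
  also have "\<dots> = (\<Prod>b\<in>Basis. (pull u - pull l) \<bullet> b)"
    using lu fB by (subst emeasure_lborel_box_eq) (auto simp: pull)
  also have "(\<Prod>b\<in>Basis. (pull u - pull l) \<bullet> b) = (\<Prod>b\<in>Basis. (u - l) \<bullet> f b)"
    by (intro prod.cong refl) (simp add: pull inner_diff_left)
  also have "\<dots> = (\<Prod>b\<in>Basis. (u - l) \<bullet> b)"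
    by (rule prod.reindex_bij_betw[OF bij])
  finally show "emeasure (distr lborel borel f) (box l u) = ennreal (\<Prod>b\<in>Basis. (u - l) \<bullet> b)" .
qed simp

lemma Basis_real2: "(Basis :: (real^2) set) = {axis 1 1, axis 2 1}"
  by (auto simp: Basis_vec_def UNIV_2)

text \<open>
  The change of variables formula is about \<open>real ^ 'n\<close>, whereas Fubini's theorem is about pairs. The two
  coordinate maps transport Lebesgue measure between these types and the complex plane.
\<close>

definition pair_of_vec :: "real^2 \<Rightarrow> real \<times> real" where
  "pair_of_vec v = (v $ 1, v $ 2)"

definition complex_of_vec :: "real^2 \<Rightarrow> complex" where
  "complex_of_vec v = Complex (v $ 1) (v $ 2)"

lemma distr_pair_of_vec: "distr lborel borel pair_of_vec = lborel"
proof (rule distr_lborel_basis_bij)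
  show "linear pair_of_vec" by (rule linearI) (auto simp: pair_of_vec_def)
  have "inj_on pair_of_vec Basis" by (auto simp: inj_on_def pair_of_vec_def vec_eq_iff forall_2)
  then show "bij_betw pair_of_vec Basis Basis"
    by (auto simp: bij_betw_def Basis_real2 pair_of_vec_def Basis_prod_def axis_def)
qed

lemma distr_complex_of_vec: "distr lborel borel complex_of_vec = lborel"
proof (rule distr_lborel_basis_bij)
  show "linear complex_of_vec" by (rule linearI) (auto simp: complex_of_vec_def complex_eq_iff)
  have "inj_on complex_of_vec Basis" by (auto simp: inj_on_def complex_of_vec_def vec_eq_iff forall_2)
  then show "bij_betw complex_of_vec Basis Basis"
    by (auto simp: bij_betw_def Basis_real2 complex_of_vec_def Basis_complex_def axis_def complex_eq_iff)
qed

lemma measurable_pair_of_vec [measurable]: "pair_of_vec \<in> borel_measurable borel"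
  unfolding pair_of_vec_def by (intro borel_measurable_continuous_onI continuous_intros)

lemma measurable_complex_of_vec [measurable]: "complex_of_vec \<in> borel_measurable borel"
  unfolding complex_of_vec_def Complex_eq by (intro borel_measurable_continuous_onI continuous_intros)

definition open_annulus :: "real \<Rightarrow> complex set" where
  "open_annulus t = {z. 1 < norm z \<and> norm z < t}"

lemma open_open_annulus: "open (open_annulus t)"
  unfolding open_annulus_def by (intro open_Collect_conj open_Collect_less continuous_intros)

lemma open_annulus_borel [measurable]: "open_annulus t \<in> sets borel"
  by (rule borel_open[OF open_open_annulus])

lemma logpolar_in_open_annulus: "0 < t \<Longrightarrow> logpolar s \<theta> \<in> open_annulus t \<longleftrightarrow> s \<in> {0<..<ln t}"
  by (auto simp: open_annulus_def) (metis exp_less_cancel_iff exp_ln)+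

text \<open>
  The positive real axis is removed so that the angle is a coordinate with values in an open interval;
  this changes the annulus only by a null set.
\<close>

definition slit_annulus :: "real \<Rightarrow> complex set" where
  "slit_annulus t = open_annulus t - {z. Im z = 0 \<and> 0 \<le> Re z}"

lemma slit_annulus_borel [measurable]: "slit_annulus t \<in> sets borel"
proof -
  have "closed {z :: complex. Im z = 0 \<and> 0 \<le> Re z}"
    by (intro closed_Collect_conj closed_Collect_eq closed_Collect_le continuous_intros)
  then show ?thesis unfolding slit_annulus_def by (intro sets.Diff open_annulus_borel borel_closed)
qed

lemma cis_not_nonneg_real:
  assumes "0 < \<theta>" "\<theta> < 2 * pi" "sin \<theta> = 0"
  shows "cos \<theta> < 0"
proof -
  have "\<theta> = pi" using assms sin_zero_pi_iff[of "\<theta> - pi"] by (auto simp: sin_diff)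
  then show ?thesis by simp
qed

lemma slit_annulus_image:
  assumes "t > 1"
  shows "slit_annulus t = (\<lambda>(s, \<theta>). logpolar s \<theta>) ` ({0<..<ln t} \<times> {0<..<2*pi})"
proof (intro subset_antisym subsetI)
  fix z assume z: "z \<in> slit_annulus t"
  then have n: "1 < norm z" "norm z < t" by (auto simp: slit_annulus_def open_annulus_def)
  then have z0: "z \<noteq> 0" by auto
  have "Arg2pi z \<noteq> 0" using z by (auto simp: slit_annulus_def Arg2pi_eq_0 complex_is_Real_iff)
  then have "Arg2pi z \<in> {0<..<2*pi}" using Arg2pi[of z] by auto
  moreover have "ln (norm z) \<in> {0<..<ln t}" using n z0 by (auto intro!: ln_gt_zero)
  moreover have "logpolar (ln (norm z)) (Arg2pi z) = z"
    using Arg2pi_eq[of z] z0 by (simp add: logpolar_def cis_conv_exp)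
  ultimately show "z \<in> (\<lambda>(s, \<theta>). logpolar s \<theta>) ` ({0<..<ln t} \<times> {0<..<2*pi})"
    by (intro image_eqI[of _ _ "(ln (norm z), Arg2pi z)"]) auto
next
  fix z assume "z \<in> (\<lambda>(s, \<theta>). logpolar s \<theta>) ` ({0<..<ln t} \<times> {0<..<2*pi})"
  then obtain s \<theta> where z: "z = logpolar s \<theta>" and s: "s \<in> {0<..<ln t}" and \<theta>: "0 < \<theta>" "\<theta> < 2 * pi" by auto
  have "\<not> (Im z = 0 \<and> 0 \<le> Re z)"
    using cis_not_nonneg_real[OF \<theta>] by (auto simp: z Re_logpolar Im_logpolar zero_le_mult_iff)
  then show "z \<in> slit_annulus t" using s assms logpolar_in_open_annulus[of t s \<theta>]
    by (auto simp: slit_annulus_def z)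
qed

lemma AE_slit_annulus: "AE z in lborel. z \<in> open_annulus t \<longleftrightarrow> z \<in> slit_annulus t"
proof -
  have "negligible {z :: complex. \<i> \<bullet> z = 0}" by (rule negligible_hyperplane) simp
  then have "negligible {z :: complex. Im z = 0}" by (simp add: inner_complex_def)
  then have "{z :: complex. Im z = 0} \<in> null_sets lebesgue" by (simp only: negligible_iff_null_sets)
  then have "AE z in lebesgue. z \<notin> {z :: complex. Im z = 0}" by (rule AE_not_in)
  then have "AE z in lborel. z \<notin> {z :: complex. Im z = 0}" by (simp add: AE_completion_iff)
  then show ?thesis by eventually_elim (auto simp: slit_annulus_def)
qed

text \<open>
  Change of variables for \<open>(s, \<theta>) \<mapsto> exp (s + \<i> \<theta>)\<close>, whose Jacobian determinant is \<open>exp (2 s)\<close>. Stating the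
  result for measures of sets gives the formula for all nonnegative functions by pushing forward
  measures.
\<close>

lemma emeasure_slit_annulus_Int:
  assumes t: "t > 1" and A: "A \<in> sets (borel :: complex measure)"
  shows "emeasure lborel (slit_annulus t \<inter> A) =
    (\<integral>\<^sup>+p. ennreal (exp (2 * fst p)) * indicator (({0<..<ln t} \<times> {0<..<2*pi}) \<inter> {p. logpolar (fst p) (snd p) \<in> A}) p \<partial>lborel)"
proof -
  define Q where "Q = {0<..<ln t} \<times> {0<..<2*pi}"
  define R where "R = Q \<inter> {p. logpolar (fst p) (snd p) \<in> A}"
  define S where "S = pair_of_vec -` R"
  define G :: "real^2 \<Rightarrow> real^2" where "G = (\<lambda>v. vector [exp (v $ 1) * cos (v $ 2), exp (v $ 1) * sin (v $ 2)])"
  define G' :: "real^2 \<Rightarrow> real^2 \<Rightarrow> real^2" where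
    "G' = (\<lambda>v h. vector [exp (v $ 1) * cos (v $ 2) * h $ 1 - exp (v $ 1) * sin (v $ 2) * h $ 2,
                         exp (v $ 1) * sin (v $ 2) * h $ 1 + exp (v $ 1) * cos (v $ 2) * h $ 2])"
  have CG: "complex_of_vec (G v) = logpolar (v $ 1) (v $ 2)" for v
    by (simp add: complex_of_vec_def G_def complex_eq_iff Re_logpolar Im_logpolar)
  have injC: "inj complex_of_vec"
    by (auto simp: inj_def complex_of_vec_def vec_eq_iff forall_2)
  have surjC: "\<exists>v. z = complex_of_vec v" for z
    by (intro exI[of _ "vector [Re z, Im z]"]) (simp add: complex_of_vec_def)
  have Qb: "Q \<in> sets (borel :: (real \<times> real) measure)" unfolding Q_def by (intro borel_open open_Times) auto
  have lpm: "(\<lambda>p. logpolar (fst p) (snd p)) \<in> borel_measurable (borel :: (real \<times> real) measure)"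
    using measurable_logpolar_pair by (simp add: borel_prod)
  have Rb: "R \<in> sets (borel :: (real \<times> real) measure)"
    unfolding R_def using Qb measurable_sets_borel[OF lpm A] by (auto simp: vimage_def)
  have Sb: "S \<in> sets borel" unfolding S_def by (rule measurable_sets_borel[OF measurable_pair_of_vec Rb])
  have der: "(G has_derivative G' v) (at v within S)" for v
    unfolding has_derivative_componentwise_within[of G] Basis_real2
    by (auto simp: G_def G'_def inner_axis intro!: derivative_eq_intros bounded_linear_imp_has_derivative[OF bounded_linear_vec_nth] simp: algebra_simps)
  have det: "\<bar>det (matrix (G' v))\<bar> = exp (2 * v $ 1)" for v
  proof -
    have "det (matrix (G' v)) = exp (v $ 1) * cos (v $ 2) * (exp (v $ 1) * cos (v $ 2)) + exp (v $ 1) * sin (v $ 2) * (exp (v $ 1) * sin (v $ 2))"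
      unfolding det_2 matrix_def G'_def by (simp add: axis_def)
    also have "\<dots> = (exp (v $ 1))\<^sup>2 * ((cos (v $ 2))\<^sup>2 + (sin (v $ 2))\<^sup>2)" by algebra
    finally have "det (matrix (G' v)) = (exp (v $ 1))\<^sup>2 * ((cos (v $ 2))\<^sup>2 + (sin (v $ 2))\<^sup>2)" .
    then show ?thesis by (simp add: exp_double)
  qed
  have inj: "inj_on G S"
  proof (rule inj_onI)
    fix v w assume v: "v \<in> S" and w: "w \<in> S" and e: "G v = G w"
    then have lp: "logpolar (v $ 1) (v $ 2) = logpolar (w $ 1) (w $ 2)" by (simp flip: CG)
    then have 1: "v $ 1 = w $ 1" using norm_logpolar[of "v $ 1" "v $ 2"] norm_logpolar[of "w $ 1" "w $ 2"] by simp
    then have "cis (v $ 2) = cis (w $ 2)" using lp by (simp add: logpolar_def)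
    then obtain n :: int where n: "v $ 2 = w $ 2 + 2 * pi * n"
      using sin_cos_eq_iff[of "v $ 2" "w $ 2"] by (auto simp: complex_eq_iff)
    have "\<bar>2 * pi * n\<bar> < 2 * pi * 1"
      using n v w by (auto simp: S_def R_def Q_def pair_of_vec_def)
    then have "\<bar>real_of_int n\<bar> < 1" by (simp add: abs_mult)
    then have "n = 0" by linarith
    then show "v = w" using 1 n by (simp add: vec_eq_iff forall_2)
  qed
  have img: "G ` S = complex_of_vec -` (slit_annulus t \<inter> A)"
  proof -
    have "complex_of_vec ` (G ` S) = (\<lambda>v. logpolar (v $ 1) (v $ 2)) ` S" by (simp add: image_image CG)
    also have "\<dots> = (\<lambda>(s, \<theta>). logpolar s \<theta>) ` R"
    proof -
      have "R = pair_of_vec ` S"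
      proof -
        have "\<exists>v. p = pair_of_vec v" for p
          by (intro exI[of _ "vector [fst p, snd p]"]) (simp add: pair_of_vec_def)
        then have "surj pair_of_vec" by (simp add: surj_def)
        then show ?thesis unfolding S_def by (simp add: surj_image_vimage_eq)
      qed
      then show ?thesis by (simp add: image_image pair_of_vec_def)
    qed
    also have "\<dots> = slit_annulus t \<inter> A" unfolding slit_annulus_image[OF t] R_def Q_def by auto
    finally have "complex_of_vec ` (G ` S) = slit_annulus t \<inter> A" .
    then show ?thesis using injC by (metis inj_vimage_image_eq)
  qed
  have bm: "slit_annulus t \<inter> A \<in> sets borel" using A by auto
  have GSb: "G ` S \<in> sets borel" unfolding img by (rule measurable_sets_borel[OF measurable_complex_of_vec bm])
  let ?f = "\<lambda>v :: real^2. exp (2 * v $ 1)"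
  have fm: "?f \<in> borel_measurable borel" by (intro borel_measurable_continuous_onI continuous_intros)
  have "bounded S"
  proof -
    have "S \<subseteq> cbox (vector [0, 0]) (vector [ln t, 2*pi])"
      by (auto simp: S_def R_def Q_def pair_of_vec_def mem_box_cart forall_2)
    then show ?thesis using bounded_cbox bounded_subset by blast
  qed
  then have fin: "emeasure lborel S < \<infinity>" by (rule emeasure_bounded_finite)
  have int: "set_integrable lborel S ?f"
    unfolding set_integrable_def
  proof (rule Bochner_Integration.integrable_bound[where f = "\<lambda>v. indicator S v * t\<^sup>2"])
    show "integrable lborel (\<lambda>v. indicator S v * t\<^sup>2)" using fin Sb by (intro integrable_mult_left) (simp add: integrable_indicator_iff)
    show "(\<lambda>v. indicator S v *\<^sub>R ?f v) \<in> borel_measurable lborel" using Sb fm by simp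
    have "?f v \<le> t\<^sup>2" if "v \<in> S" for v
    proof -
      have "exp (v $ 1) \<le> t" using that t
        by (auto simp: S_def R_def Q_def pair_of_vec_def) (metis exp_le_cancel_iff exp_ln less_eq_real_def order_less_trans zero_less_one)
      then have "(exp (v $ 1))\<^sup>2 \<le> t\<^sup>2" by (intro power_mono) auto
      then show ?thesis by (simp add: exp_double)
    qed
    then show "AE v in lborel. norm (indicator S v *\<^sub>R ?f v) \<le> norm (indicator S v * t\<^sup>2)"
      by (intro AE_I2) (auto simp: indicator_def)
  qed
  have hi: "(?f has_integral (LINT v:S|lborel. ?f v)) S"
    using set_borel_integral_eq_integral[OF int] by (metis integrable_integral)
  then have m: "G ` S \<in> lmeasurable" "measure lebesgue (G ` S) = (LINT v:S|lborel. ?f v)"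
    using has_measure_differentiable_image[OF _ der inj, of "LINT v:S|lborel. ?f v"] Sb by (auto simp: det)
  have "emeasure lborel (slit_annulus t \<inter> A) = emeasure (distr lborel borel complex_of_vec) (slit_annulus t \<inter> A)"
    by (simp add: distr_complex_of_vec)
  also have "\<dots> = emeasure lborel (G ` S)"
    using bm by (subst emeasure_distr) (auto simp: img)
  also have "\<dots> = emeasure lebesgue (G ` S)" using GSb by simp
  also have "\<dots> = ennreal (LINT v:S|lborel. ?f v)"
    by (simp only: emeasure_eq_measure2[OF m(1)] m(2))
  also have "\<dots> = (\<integral>\<^sup>+v. ennreal (indicator S v *\<^sub>R ?f v) \<partial>lborel)"
    unfolding set_lebesgue_integral_def
    by (rule nn_integral_eq_integral[symmetric]) (use int in \<open>auto simp: set_integrable_def\<close>)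
  also have "\<dots> = (\<integral>\<^sup>+v. ennreal (exp (2 * fst (pair_of_vec v))) * indicator R (pair_of_vec v) \<partial>lborel)"
    by (intro nn_integral_cong) (auto simp: S_def pair_of_vec_def indicator_def)
  also have "\<dots> = (\<integral>\<^sup>+p. ennreal (exp (2 * fst p)) * indicator R p \<partial>(distr lborel borel pair_of_vec))"
  proof (rule nn_integral_distr[symmetric])
    have "(\<lambda>p :: real \<times> real. exp (2 * fst p)) \<in> borel_measurable borel"
      by (intro borel_measurable_continuous_onI continuous_intros)
    then have "(\<lambda>p. ennreal (exp (2 * fst p)) * indicator R p) \<in> borel_measurable (borel :: (real \<times> real) measure)"
      using Rb by simp
    then show "(\<lambda>p. ennreal (exp (2 * fst p)) * indicator R p) \<in> borel_measurable (distr lborel borel pair_of_vec)"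
      by simp
  qed simp
  finally show ?thesis unfolding distr_pair_of_vec R_def Q_def .
qed

theorem nn_integral_annulus_logpolar:
  fixes w :: "complex \<Rightarrow> ennreal"
  assumes t: "t > 1" and [measurable]: "w \<in> borel_measurable borel"
  shows "(\<integral>\<^sup>+z. w z * indicator (open_annulus t) z \<partial>lborel) =
    (\<integral>\<^sup>+s. (\<integral>\<^sup>+\<theta>. ennreal (exp (2 * s)) * w (logpolar s \<theta>) \<partial>circle_measure) * indicator {0<..<ln t} s \<partial>lborel)"
proof -
  define Q where "Q = {0<..<ln t} \<times> {0<..<2*pi}"
  define lp where "lp = (\<lambda>p. logpolar (fst p) (snd p))"
  have Qb: "Q \<in> sets (borel :: (real \<times> real) measure)" unfolding Q_def by (intro borel_open open_Times) auto
  have lpm [measurable]: "lp \<in> borel_measurable (borel :: (real \<times> real) measure)"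
    unfolding lp_def using measurable_logpolar_pair by (simp add: borel_prod)
  have em: "(\<lambda>p. ennreal (exp (2 * fst p))) \<in> borel_measurable (borel :: (real \<times> real) measure)"
    by (intro measurable_compose[OF _ measurable_ennreal] borel_measurable_continuous_onI continuous_intros)
  let ?d = "\<lambda>p. ennreal (exp (2 * fst p)) * indicator Q p"
  have dm: "?d \<in> borel_measurable (borel :: (real \<times> real) measure)" using em Qb by simp
  have eq: "density lborel (indicator (slit_annulus t)) = distr (density lborel ?d) borel lp"
  proof (rule measure_eqI)
    fix A assume "A \<in> sets (density lborel (indicator (slit_annulus t)))"
    then have A: "A \<in> sets borel" by simp
    have vA: "lp -` A \<in> sets borel" by (rule measurable_sets_borel[OF lpm A])
    have "emeasure (density lborel (indicator (slit_annulus t))) A = emeasure lborel (slit_annulus t \<inter> A)"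
      using A by (subst emeasure_density) (simp_all flip: indicator_inter_arith add: Int_commute)
    also have "\<dots> = (\<integral>\<^sup>+p. ?d p * indicator (lp -` A) p \<partial>lborel)"
      unfolding emeasure_slit_annulus_Int[OF t A] Q_def lp_def
      by (intro nn_integral_cong) (auto simp: indicator_def)
    also have "\<dots> = emeasure (density lborel ?d) (lp -` A)"
      using vA dm by (subst emeasure_density) auto
    also have "\<dots> = emeasure (distr (density lborel ?d) borel lp) A"
      using A lpm by (subst emeasure_distr) auto
    finally show "emeasure (density lborel (indicator (slit_annulus t))) A = emeasure (distr (density lborel ?d) borel lp) A" .
  qed simp
  have "(\<integral>\<^sup>+z. w z * indicator (open_annulus t) z \<partial>lborel) = (\<integral>\<^sup>+z. indicator (slit_annulus t) z * w z \<partial>lborel)"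
    using AE_slit_annulus[of t] by (intro nn_integral_cong_AE) (auto elim!: eventually_mono simp: indicator_def)
  also have "\<dots> = (\<integral>\<^sup>+z. w z \<partial>density lborel (indicator (slit_annulus t)))"
    by (subst nn_integral_density) auto
  also have "\<dots> = (\<integral>\<^sup>+p. w (lp p) \<partial>density lborel ?d)"
    unfolding eq using lpm by (subst nn_integral_distr) auto
  also have "\<dots> = (\<integral>\<^sup>+p. ?d p * w (lp p) \<partial>lborel)"
    using dm by (subst nn_integral_density) auto
  also have "\<dots> = (\<integral>\<^sup>+p. ?d p * w (lp p) \<partial>(lborel \<Otimes>\<^sub>M lborel))" by (simp add: lborel_prod)
  also have "\<dots> = (\<integral>\<^sup>+s. \<integral>\<^sup>+\<theta>. ?d (s, \<theta>) * w (lp (s, \<theta>)) \<partial>lborel \<partial>lborel)"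
  proof (rule lborel.nn_integral_fst[symmetric])
    show "(\<lambda>p. ?d p * w (lp p)) \<in> borel_measurable (lborel \<Otimes>\<^sub>M lborel)"
      unfolding lborel_prod using dm by simp
  qed
  also have "\<dots> = (\<integral>\<^sup>+s. (\<integral>\<^sup>+\<theta>. ennreal (exp (2 * s)) * w (logpolar s \<theta>) \<partial>circle_measure) * indicator {0<..<ln t} s \<partial>lborel)"
  proof (intro nn_integral_cong)
    fix s :: real
    have lps: "(\<lambda>\<theta>. logpolar s \<theta>) \<in> borel_measurable borel"
      unfolding logpolar_def by (intro borel_measurable_continuous_onI continuous_intros)
    then have m: "(\<lambda>\<theta>. ennreal (exp (2 * s)) * w (logpolar s \<theta>)) \<in> borel_measurable borel" by measurable
    have "(\<integral>\<^sup>+\<theta>. ?d (s, \<theta>) * w (lp (s, \<theta>)) \<partial>lborel)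
        = (\<integral>\<^sup>+\<theta>. (ennreal (exp (2 * s)) * w (logpolar s \<theta>)) * indicator {0..2*pi} \<theta> * indicator {0<..<ln t} s \<partial>lborel)"
      using AE_lborel_singleton[of 0] AE_lborel_singleton[of "2*pi"]
      by (intro nn_integral_cong_AE, eventually_elim) (auto simp: Q_def lp_def indicator_def)
    also have "\<dots> = (\<integral>\<^sup>+\<theta>. (ennreal (exp (2 * s)) * w (logpolar s \<theta>)) * indicator {0..2*pi} \<theta> \<partial>lborel) * indicator {0<..<ln t} s"
      using m by (intro nn_integral_multc) auto
    also have "(\<integral>\<^sup>+\<theta>. (ennreal (exp (2 * s)) * w (logpolar s \<theta>)) * indicator {0..2*pi} \<theta> \<partial>lborel)
        = (\<integral>\<^sup>+\<theta>. ennreal (exp (2 * s)) * w (logpolar s \<theta>) \<partial>circle_measure)"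
      unfolding circle_measure_def using m by (subst nn_integral_restrict_space) auto
    finally show "(\<integral>\<^sup>+\<theta>. ?d (s, \<theta>) * w (lp (s, \<theta>)) \<partial>lborel) =
        (\<integral>\<^sup>+\<theta>. ennreal (exp (2 * s)) * w (logpolar s \<theta>) \<partial>circle_measure) * indicator {0<..<ln t} s" .
  qed
  finally show ?thesis .
qed

section \<open>One Fourier mode\<close>

text \<open>
  The minimum of \<open>\<integral> |v'|\<^sup>2 + n\<^sup>2 |v|\<^sup>2 ds\<close> over the functions on the interval from \<open>0\<close> to \<open>ln t\<close> with end
  values \<open>\<alpha>\<close> and \<open>\<beta>\<close>, attained by the solution of \<open>v'' = n\<^sup>2 v\<close>; here \<open>T = exp (|n| ln t)\<close>.
\<close>

definition mode_energy :: "real \<Rightarrow> complex \<Rightarrow> complex \<Rightarrow> int \<Rightarrow> real" where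
  "mode_energy t \<alpha> \<beta> n = (if n = 0 then (norm (\<beta> - \<alpha>))\<^sup>2 / ln t
     else let T = t ^ nat \<bar>n\<bar> in real_of_int \<bar>n\<bar> / (T\<^sup>2 - 1) * ((T\<^sup>2 + 1) * ((norm \<alpha>)\<^sup>2 + (norm \<beta>)\<^sup>2) - 4 * T * Re (\<alpha> * cnj \<beta>)))"

definition radial :: "real \<Rightarrow> real measure" where
  "radial L = restrict_space lborel {0<..<L}"

lemma space_radial [simp]: "space (radial L) = {0<..<L}"
  by (simp add: radial_def space_restrict_space)

lemma measurable_radialI: "f \<in> borel_measurable borel \<Longrightarrow> f \<in> borel_measurable (radial L)"
  unfolding radial_def by (intro measurable_restrict_space1) simp

lemma measurable_radial_continuous:
  fixes f :: "real \<Rightarrow> complex"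
  assumes "continuous_on {0<..<L} f"
  shows "f \<in> borel_measurable (radial L)"
  unfolding radial_def using borel_measurable_continuous_on_restrict[OF assms]
  by (simp cong: measurable_cong_sets sets_restrict_space_cong)

lemma AE_radial: "(AE x in radial L. P x) \<longleftrightarrow> (AE x in lborel. x \<in> {0<..<L} \<longrightarrow> P x)"
  unfolding radial_def by (subst AE_restrict_space_iff) auto

lemma emeasure_radial: "0 \<le> L \<Longrightarrow> emeasure (radial L) (space (radial L)) = ennreal L"
  unfolding space_radial radial_def by (simp add: emeasure_restrict_space)

lemma finite_measure_radial: "finite_measure (radial L)"
  using emeasure_bounded_finite[of "{0<..<L}"]
  by (intro finite_measureI) (simp add: radial_def emeasure_restrict_space space_restrict_space less_top)

text \<open>
  Fatou's lemma bounds the distance of the pointwise limit from the \<open>L\<^sup>2\<close> limit by zero.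
\<close>

lemma AE_eq_of_L2_limit:
  fixes f :: "nat \<Rightarrow> 'a \<Rightarrow> complex"
  assumes [measurable]: "\<And>k. f k \<in> borel_measurable M" "h \<in> borel_measurable M" "g \<in> borel_measurable M"
    and lim: "\<And>x. x \<in> space M \<Longrightarrow> (\<lambda>k. f k x) \<longlonglongrightarrow> g x"
    and L2: "(\<lambda>k. \<integral>\<^sup>+x. ennreal ((norm (f k x - h x))\<^sup>2) \<partial>M) \<longlonglongrightarrow> 0"
  shows "AE x in M. h x = g x"
proof -
  have "(\<integral>\<^sup>+x. ennreal ((norm (g x - h x))\<^sup>2) \<partial>M)
      \<le> (\<integral>\<^sup>+x. liminf (\<lambda>k. ennreal ((norm (f k x - h x))\<^sup>2)) \<partial>M)"
  proof (rule nn_integral_mono)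
    fix x assume "x \<in> space M"
    then have "(\<lambda>k. ennreal ((norm (f k x - h x))\<^sup>2)) \<longlonglongrightarrow> ennreal ((norm (g x - h x))\<^sup>2)"
      by (intro tendsto_intros lim)
    then show "ennreal ((norm (g x - h x))\<^sup>2) \<le> liminf (\<lambda>k. ennreal ((norm (f k x - h x))\<^sup>2))"
      by (simp only: lim_imp_Liminf[OF trivial_limit_sequentially] order_refl)
  qed
  also have "\<dots> \<le> liminf (\<lambda>k. \<integral>\<^sup>+x. ennreal ((norm (f k x - h x))\<^sup>2) \<partial>M)"
    by (rule nn_integral_liminf) simp
  also have "\<dots> = 0" by (rule lim_imp_Liminf[OF trivial_limit_sequentially L2])
  finally have "(\<integral>\<^sup>+x. ennreal ((norm (g x - h x))\<^sup>2) \<partial>M) = 0" by simp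
  then have "AE x in M. ennreal ((norm (g x - h x))\<^sup>2) = 0"
    by (subst (asm) nn_integral_0_iff_AE) auto
  then show ?thesis by eventually_elim auto
qed

lemma L2_limit_imp_L1_limit:
  fixes f :: "nat \<Rightarrow> 'a \<Rightarrow> complex"
  assumes [measurable]: "\<And>k. f k \<in> borel_measurable M" and M: "emeasure M (space M) < \<infinity>"
    and L2: "(\<lambda>k. \<integral>\<^sup>+x. ennreal ((norm (f k x))\<^sup>2) \<partial>M) \<longlonglongrightarrow> 0"
  shows "(\<lambda>k. \<integral>\<^sup>+x. ennreal (norm (f k x)) \<partial>M) \<longlonglongrightarrow> 0"
proof -
  have cs: "(\<integral>\<^sup>+x. ennreal (norm (f k x)) \<partial>M)\<^sup>2 \<le> (\<integral>\<^sup>+x. ennreal ((norm (f k x))\<^sup>2) \<partial>M) * emeasure M (space M)" for k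
    using Cauchy_Schwarz_nn_integral[of "\<lambda>x. ennreal (norm (f k x))" M "\<lambda>_. 1"] by (simp add: ennreal_power)
  obtain c where c: "emeasure M (space M) = ennreal c" "0 \<le> c" using M by (cases "emeasure M (space M)") auto
  have "(\<lambda>k. (\<integral>\<^sup>+x. ennreal ((norm (f k x))\<^sup>2) \<partial>M) * emeasure M (space M)) \<longlonglongrightarrow> 0 * emeasure M (space M)"
    unfolding mult.commute[of _ "emeasure M (space M)"] using M by (intro ennreal_tendsto_cmult L2) auto
  then have lim: "(\<lambda>k. (\<integral>\<^sup>+x. ennreal ((norm (f k x))\<^sup>2) \<partial>M) * emeasure M (space M)) \<longlonglongrightarrow> 0" by simp
  show ?thesis
  proof (rule order_tendstoI)
    fix y :: ennreal assume y: "0 < y"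
    then obtain e where e: "0 < e" "ennreal e < y"
      by (metis dense ennreal_cases ennreal_less_zero_iff less_top_ennreal not_less_zero order_less_le_trans top_greatest zero_less_iff_neq_zero)
    have "eventually (\<lambda>k. (\<integral>\<^sup>+x. ennreal ((norm (f k x))\<^sup>2) \<partial>M) * emeasure M (space M) < (ennreal e)\<^sup>2) sequentially"
      using e(1) by (intro order_tendstoD(2)[OF lim]) (simp add: ennreal_power)
    then show "eventually (\<lambda>k. (\<integral>\<^sup>+x. ennreal (norm (f k x)) \<partial>M) < y) sequentially"
    proof eventually_elim
      case (elim k)
      then have "(\<integral>\<^sup>+x. ennreal (norm (f k x)) \<partial>M)\<^sup>2 < (ennreal e)\<^sup>2" using cs[of k] by (rule le_less_trans[rotated])
      then have "\<not> ennreal e \<le> (\<integral>\<^sup>+x. ennreal (norm (f k x)) \<partial>M)"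
        by (meson leD power_mono zero_le)
      then show ?case using e(2) by (simp add: not_le order_less_trans)
    qed
  qed (simp add: not_less_zero)
qed

lemma constant_on_interval:
  fixes f :: "real \<Rightarrow> complex"
  assumes "\<And>s. s \<in> {0<..<L} \<Longrightarrow> (f has_vector_derivative 0) (at s)"
  shows "\<exists>c. \<forall>s\<in>{0<..<L}. f s = c"
proof -
  obtain c where "\<And>s. s \<in> {0<..<L} \<Longrightarrow> f s = c"
    by (rule has_vector_derivative_zero_constant[of "{0<..<L}" f])
       (use assms in \<open>auto intro: has_vector_derivative_at_within\<close>)
  then show ?thesis by auto
qed

text \<open>
  The operator factors: \<open>(V' + k V) exp (- k s)\<close> is constant for both \<open>k = m\<close> and \<open>k = - m\<close>, and \<open>V\<close> is
  recovered from the two constants by linear algebra.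
\<close>

lemma second_order_ode:
  fixes V V1 :: "real \<Rightarrow> complex" and m :: real
  assumes m: "m > 0" and V: "\<And>s. s \<in> {0<..<L} \<Longrightarrow> (V has_vector_derivative V1 s) (at s)"
    and V1: "\<And>s. s \<in> {0<..<L} \<Longrightarrow> (V1 has_vector_derivative of_real (m\<^sup>2) * V s) (at s)"
  obtains A B where "\<And>s. s \<in> {0<..<L} \<Longrightarrow> V s = A * of_real (exp (m * s)) + B * of_real (exp (- m * s))"
proof -
  have const: "\<exists>c. \<forall>s\<in>{0<..<L}. (V1 s + of_real k * V s) * of_real (exp (- k * s)) = c" if k: "k\<^sup>2 = m\<^sup>2" for k :: real
  proof (rule constant_on_interval)
    fix s assume s: "s \<in> {0<..<L}"
    have e: "((\<lambda>s. complex_of_real (exp (- k * s))) has_vector_derivative of_real (- k * exp (- k * s))) (at s)"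
      by (rule has_vector_derivative_of_real) (auto intro!: derivative_eq_intros simp: has_real_derivative_iff_has_vector_derivative[symmetric])
    have "((\<lambda>s. (V1 s + of_real k * V s) * of_real (exp (- k * s))) has_vector_derivative
        ((V1 s + of_real k * V s) * of_real (- k * exp (- k * s)) + (of_real (m\<^sup>2) * V s + of_real k * V1 s) * of_real (exp (- k * s)))) (at s)"
      by (intro has_vector_derivative_mult has_vector_derivative_add e V1 V s has_vector_derivative_mult_right)
    moreover have "(V1 s + of_real k * V s) * of_real (- k * exp (- k * s)) + (of_real (m\<^sup>2) * V s + of_real k * V1 s) * of_real (exp (- k * s)) = 0"
      unfolding k[symmetric] by (simp add: power2_eq_square algebra_simps)
    ultimately show "((\<lambda>s. (V1 s + of_real k * V s) * of_real (exp (- k * s))) has_vector_derivative 0) (at s)"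
      by simp
  qed
  obtain c where c: "\<And>s. s \<in> {0<..<L} \<Longrightarrow> (V1 s + of_real m * V s) * of_real (exp (- m * s)) = c" using const[of m] by auto
  obtain d where d: "\<And>s. s \<in> {0<..<L} \<Longrightarrow> (V1 s + of_real (- m) * V s) * of_real (exp (m * s)) = d" using const[of "- m"] by auto
  show thesis
  proof (rule that)
    fix s assume s: "s \<in> {0<..<L}"
    have ee: "complex_of_real (exp (- m * s)) * of_real (exp (m * s)) = 1"
      by (simp flip: of_real_mult exp_add)
    have "V1 s + of_real m * V s = c * of_real (exp (m * s))"
      unfolding c[OF s, symmetric] using ee by (simp add: mult.assoc)
    moreover have "V1 s - of_real m * V s = d * of_real (exp (- m * s))"
      unfolding d[OF s, symmetric] using ee by (simp add: mult.assoc mult.commute)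
    ultimately have "2 * of_real m * V s = c * of_real (exp (m * s)) - d * of_real (exp (- m * s))"
      by (simp add: algebra_simps)
    then show "V s = c / (2 * of_real m) * of_real (exp (m * s)) + (- d / (2 * of_real m)) * of_real (exp (- m * s))"
      using m by (simp add: field_simps)
  qed
qed

lemma second_order_ode_zero:
  fixes V V1 :: "real \<Rightarrow> complex"
  assumes V: "\<And>s. s \<in> {0<..<L} \<Longrightarrow> (V has_vector_derivative V1 s) (at s)"
    and V1: "\<And>s. s \<in> {0<..<L} \<Longrightarrow> (V1 has_vector_derivative 0) (at s)"
  obtains A B where "\<And>s. s \<in> {0<..<L} \<Longrightarrow> V s = A + B * of_real s"
proof -
  have "\<exists>c. \<forall>s\<in>{0<..<L}. V1 s = c"
    by (rule constant_on_interval) (rule V1)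
  then obtain B where B: "\<And>s. s \<in> {0<..<L} \<Longrightarrow> V1 s = B" by auto
  have "\<exists>c. \<forall>s\<in>{0<..<L}. V s - B * of_real s = c"
  proof (rule constant_on_interval)
    fix s assume s: "s \<in> {0<..<L}"
    have "((\<lambda>s. complex_of_real s) has_vector_derivative of_real 1) (at s)"
      by (rule has_vector_derivative_of_real) simp
    then have "((\<lambda>s. V s - B * of_real s) has_vector_derivative V1 s - B * of_real 1) (at s)"
      by (intro has_vector_derivative_diff V s has_vector_derivative_mult_right)
    then show "((\<lambda>s. V s - B * of_real s) has_vector_derivative 0) (at s)"
      using B[OF s] by simp
  qed
  then obtain A where "\<And>s. s \<in> {0<..<L} \<Longrightarrow> V s - B * of_real s = A" by auto
  then show thesis by (intro that[of A B]) (simp add: algebra_simps)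
qed

text \<open>
  The solution is given by exponentials or is affine, so it extends to the whole line; the energy is a
  function of the end values of the extension. On the open interval alone \<open>V\<close> has no end values.
\<close>

lemma mode_solution_energy:
  fixes V V1 :: "real \<Rightarrow> complex" and n :: int
  assumes t: "t > 1" and V: "\<And>s. s \<in> {0<..<ln t} \<Longrightarrow> (V has_vector_derivative V1 s) (at s)"
    and V1: "\<And>s. s \<in> {0<..<ln t} \<Longrightarrow> (V1 has_vector_derivative of_int (n\<^sup>2) * V s) (at s)"
  obtains X Y where "\<And>s. s \<in> {0<..<ln t} \<Longrightarrow> V s = X s"
    "\<And>s. (X has_vector_derivative Y s) (at s)" "continuous_on UNIV Y"
    "((\<lambda>s. (norm (Y s))\<^sup>2 + (real_of_int n)\<^sup>2 * (norm (X s))\<^sup>2) has_integral mode_energy t (X 0) (X (ln t)) n) {0..ln t}"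
proof (cases "n = 0")
  case True
  have L: "ln t > 0" using t by simp
  obtain A B where AB: "\<And>s. s \<in> {0<..<ln t} \<Longrightarrow> V s = A + B * of_real s"
    using second_order_ode_zero[of "ln t" V V1] V V1 True by auto
  show thesis
  proof (rule that[OF AB])
    show "((\<lambda>s. A + B * complex_of_real s) has_vector_derivative B) (at s)" for s
    proof -
      have "((\<lambda>s. complex_of_real s) has_vector_derivative of_real 1) (at s)"
        by (rule has_vector_derivative_of_real) simp
      then have "((\<lambda>s. A + B * complex_of_real s) has_vector_derivative 0 + B * of_real 1) (at s)"
        by (intro has_vector_derivative_add has_vector_derivative_const has_vector_derivative_mult_right)
      then show ?thesis by simp
    qed
    have "mode_energy t (A + B * complex_of_real 0) (A + B * complex_of_real (ln t)) n = ln t * (norm B)\<^sup>2"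
      using True L by (simp add: mode_energy_def norm_mult power_mult_distrib power2_eq_square)
    then show "((\<lambda>s. (norm B)\<^sup>2 + (real_of_int n)\<^sup>2 * (norm (A + B * complex_of_real s))\<^sup>2) has_integral
        mode_energy t (A + B * complex_of_real 0) (A + B * complex_of_real (ln t)) n) {0..ln t}"
      using True L has_integral_const_real[of "(norm B)\<^sup>2" 0 "ln t"] by simp
  qed auto
next
  case False
  define m where "m = real_of_int \<bar>n\<bar>"
  have m: "m > 0" using False by (simp add: m_def)
  have m2: "of_int (n\<^sup>2) = complex_of_real (m\<^sup>2)" "m\<^sup>2 = (real_of_int n)\<^sup>2" by (simp_all add: m_def)
  obtain A B where AB: "\<And>s. s \<in> {0<..<ln t} \<Longrightarrow> V s = A * of_real (exp (m * s)) + B * of_real (exp (- m * s))"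
    using second_order_ode[OF m V V1[unfolded m2(1)]] by blast
  let ?X = "\<lambda>s. A * complex_of_real (exp (m * s)) + B * of_real (exp (- m * s))"
  let ?Y = "\<lambda>s. A * complex_of_real (m * exp (m * s)) + B * of_real (- m * exp (- m * s))"
  define T where "T = t ^ nat \<bar>n\<bar>"
  have T: "T > 1" unfolding T_def using t False by (intro one_less_power) auto
  have "m = real (nat \<bar>n\<bar>)" by (simp add: m_def)
  then have "exp (m * ln t) = T" unfolding T_def using t by (simp only: exp_of_nat_mult) simp
  then have eT: "exp (m * ln t) = T" "exp (- m * ln t) = 1 / T" "exp (2 * m * ln t) = T\<^sup>2" "exp (- 2 * m * ln t) = 1 / T\<^sup>2"
    by (simp_all add: exp_minus inverse_eq_divide mult.assoc exp_double power_one_over)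
  have Xder: "(?X has_vector_derivative ?Y s) (at s)" for s
    by (intro has_vector_derivative_add has_vector_derivative_mult_right has_vector_derivative_of_real)
       (auto intro!: derivative_eq_intros simp: has_real_derivative_iff_has_vector_derivative[symmetric])
  have Ycont: "continuous_on UNIV ?Y" by (intro continuous_intros)
  \<comment> \<open>By the parallelogram law the mixed terms of \<open>|V'|\<^sup>2\<close> and \<open>n\<^sup>2 |V|\<^sup>2\<close> cancel.\<close>
  have sq: "(norm (?Y s))\<^sup>2 + m\<^sup>2 * (norm (?X s))\<^sup>2 = 2 * m\<^sup>2 * ((norm A)\<^sup>2 * exp (2 * m * s) + (norm B)\<^sup>2 * exp (- 2 * m * s))" for s
  proof -
    define x y where "x = A * complex_of_real (exp (m * s))" and "y = B * complex_of_real (exp (- m * s))"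
    have "?Y s = of_real m * (x - y)" "?X s = x + y" by (simp_all add: x_def y_def algebra_simps)
    then have "(norm (?Y s))\<^sup>2 + m\<^sup>2 * (norm (?X s))\<^sup>2 = m\<^sup>2 * ((norm (x - y))\<^sup>2 + (norm (x + y))\<^sup>2)"
      by (simp add: norm_mult power_mult_distrib distrib_left)
    also have "(norm (x - y))\<^sup>2 + (norm (x + y))\<^sup>2 = 2 * ((norm x)\<^sup>2 + (norm y)\<^sup>2)"
      unfolding cmod_power2 by (simp add: power2_eq_square algebra_simps)
    finally have e: "(norm (?Y s))\<^sup>2 + m\<^sup>2 * (norm (?X s))\<^sup>2 = m\<^sup>2 * (2 * ((norm x)\<^sup>2 + (norm y)\<^sup>2))" .
    have nx: "(norm x)\<^sup>2 = (norm A)\<^sup>2 * exp (2 * m * s)" "(norm y)\<^sup>2 = (norm B)\<^sup>2 * exp (- 2 * m * s)"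
      using exp_double[of "m * s"] exp_double[of "- m * s"]
      by (simp_all add: x_def y_def norm_mult power_mult_distrib mult.assoc)
    show ?thesis unfolding e nx by simp
  qed
  have hi: "((\<lambda>s. 2 * m\<^sup>2 * ((norm A)\<^sup>2 * exp (2 * m * s) + (norm B)\<^sup>2 * exp (- 2 * m * s))) has_integral
      (m * ((norm A)\<^sup>2 * exp (2 * m * ln t) - (norm B)\<^sup>2 * exp (- 2 * m * ln t)) - m * ((norm A)\<^sup>2 * exp (2 * m * 0) - (norm B)\<^sup>2 * exp (- 2 * m * 0)))) {0..ln t}"
  proof (rule fundamental_theorem_of_calculus)
    show "((\<lambda>s. m * ((norm A)\<^sup>2 * exp (2 * m * s) - (norm B)\<^sup>2 * exp (- 2 * m * s))) has_vector_derivative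
        2 * m\<^sup>2 * ((norm A)\<^sup>2 * exp (2 * m * s) + (norm B)\<^sup>2 * exp (- 2 * m * s))) (at s within {0..ln t})" for s
      unfolding has_real_derivative_iff_has_vector_derivative[symmetric]
      by (auto intro!: derivative_eq_intros simp: power2_eq_square algebra_simps)
  qed (use t in simp)
  have X0: "?X 0 = A + B" by simp
  have XL: "?X (ln t) = A * of_real T + B / of_real T" unfolding eT by simp
  have "mode_energy t (?X 0) (?X (ln t)) n =
      m * ((norm A)\<^sup>2 * T\<^sup>2 - (norm B)\<^sup>2 * (1 / T\<^sup>2)) - m * ((norm A)\<^sup>2 - (norm B)\<^sup>2)"
  proof -
    have T0: "T \<noteq> 0" "T\<^sup>2 - 1 \<noteq> 0" using T by (auto simp: power2_eq_1_iff)
    define N where "N = (T\<^sup>2 + 1) * ((norm (?X 0))\<^sup>2 + (norm (?X (ln t)))\<^sup>2) - 4 * T * Re (?X 0 * cnj (?X (ln t)))"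
    have "mode_energy t (?X 0) (?X (ln t)) n = m / (T\<^sup>2 - 1) * N"
      using False by (simp only: mode_energy_def if_False Let_def T_def m_def N_def)
    also have "N = (T\<^sup>2 - 1) * ((norm A)\<^sup>2 * (T\<^sup>2 - 1) + (norm B)\<^sup>2 * (1 - 1 / T\<^sup>2))"
    proof -
      define a b c d where "a = Re A" and "b = Im A" and "c = Re B" and "d = Im B"
      have nA: "(norm A)\<^sup>2 = a\<^sup>2 + b\<^sup>2" "(norm B)\<^sup>2 = c\<^sup>2 + d\<^sup>2" by (simp_all add: cmod_power2 a_def b_def c_def d_def)
      have n0: "(norm (A + B))\<^sup>2 = (a + c)\<^sup>2 + (b + d)\<^sup>2" by (simp add: cmod_power2 a_def b_def c_def d_def)
      have nL: "(norm (A * of_real T + B / of_real T))\<^sup>2 = (a * T + c / T)\<^sup>2 + (b * T + d / T)\<^sup>2"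
        by (simp add: cmod_power2 a_def b_def c_def d_def)
      have re: "Re ((A + B) * cnj (A * of_real T + B / of_real T)) = (a + c) * (a * T + c / T) + (b + d) * (b * T + d / T)"
        by (simp add: a_def b_def c_def d_def algebra_simps add_divide_distrib)
      show ?thesis unfolding N_def X0 XL nA n0 nL re using T0(1)
        by (simp add: field_simps power2_eq_square)
    qed
    also have "m / (T\<^sup>2 - 1) * ((T\<^sup>2 - 1) * ((norm A)\<^sup>2 * (T\<^sup>2 - 1) + (norm B)\<^sup>2 * (1 - 1 / T\<^sup>2)))
        = m * ((norm A)\<^sup>2 * (T\<^sup>2 - 1) + (norm B)\<^sup>2 * (1 - 1 / T\<^sup>2))"
      using T0 by simp
    also have "\<dots> = m * ((norm A)\<^sup>2 * T\<^sup>2 - (norm B)\<^sup>2 * (1 / T\<^sup>2)) - m * ((norm A)\<^sup>2 - (norm B)\<^sup>2)"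
      by (simp only: right_diff_distrib distrib_left mult_1_right)
    finally show ?thesis .
  qed
  then have me: "mode_energy t (?X 0) (?X (ln t)) n =
     (m * ((norm A)\<^sup>2 * exp (2 * m * ln t) - (norm B)\<^sup>2 * exp (- 2 * m * ln t)) - m * ((norm A)\<^sup>2 * exp (2 * m * 0) - (norm B)\<^sup>2 * exp (- 2 * m * 0)))"
    unfolding eT by simp
  show thesis
  proof (rule that[OF AB Xder Ycont])
    show "((\<lambda>s. (norm (?Y s))\<^sup>2 + (real_of_int n)\<^sup>2 * (norm (?X s))\<^sup>2) has_integral mode_energy t (?X 0) (?X (ln t)) n) {0..ln t}"
      unfolding me m2(2)[symmetric] sq by (rule hi)
  qed
qed

lemma integral_radial:
  fixes f :: "real \<Rightarrow> complex"
  shows "(LINT x|radial L. f x) = (LINT x|lborel. indicator {0<..<L} x *\<^sub>R f x)"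
  unfolding radial_def by (subst integral_restrict_space) auto

lemma integrable_radial_iff:
  fixes f :: "real \<Rightarrow> complex"
  shows "integrable (radial L) f \<longleftrightarrow> integrable lborel (\<lambda>x. indicator {0<..<L} x *\<^sub>R f x)"
  unfolding radial_def by (subst integrable_restrict_space) auto

lemma integral_radial_derivative:
  fixes G g :: "real \<Rightarrow> complex"
  assumes der: "\<And>s. (G has_vector_derivative g s) (at s)" and g: "continuous_on UNIV g"
    and ab: "0 \<le> a" "a \<le> b" "b \<le> L"
  shows "integrable (radial L) g" "(LINT s|radial L. indicator {a..b} s *\<^sub>R g s) = G b - G a"
proof -
  have si: "set_integrable lborel {c..d} g" for c d
    by (rule borel_integrable_atLeastAtMost') (use g continuous_on_subset in blast)
  have "set_integrable lborel {0<..<L} g"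
    by (rule set_integrable_subset[OF si[of 0 L]]) auto
  then show "integrable (radial L) g" by (simp add: integrable_radial_iff set_integrable_def)
  have "(LINT s|radial L. indicator {a..b} s *\<^sub>R g s) = (LINT s|lborel. indicator {a..b} s *\<^sub>R g s)"
    unfolding integral_radial
  proof (rule integral_cong_AE)
    have gm: "g \<in> borel_measurable lborel" using g by (simp add: borel_measurable_continuous_onI)
    then show "(\<lambda>x. indicator {0<..<L} x *\<^sub>R indicator {a..b} x *\<^sub>R g x) \<in> borel_measurable lborel"
      "(\<lambda>x. indicator {a..b} x *\<^sub>R g x) \<in> borel_measurable lborel" by auto
    show "AE x in lborel. indicator {0<..<L} x *\<^sub>R indicator {a..b} x *\<^sub>R g x = indicator {a..b} x *\<^sub>R g x"
      using AE_lborel_singleton[of 0] AE_lborel_singleton[of L] by eventually_elim (use ab in \<open>auto simp: indicator_def\<close>)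
  qed
  also have "\<dots> = integral {a..b} g"
    using set_borel_integral_eq_integral(2)[OF si[of a b]] by (simp add: set_lebesgue_integral_def)
  also have "\<dots> = G b - G a"
    by (rule integral_unique, rule fundamental_theorem_of_calculus[OF ab(2)], rule has_vector_derivative_at_within[OF der])
  finally show "(LINT s|radial L. indicator {a..b} s *\<^sub>R g s) = G b - G a" .
qed

lemma L2_imp_integrable:
  fixes p :: "'a \<Rightarrow> complex"
  assumes M: "finite_measure M" and p: "p \<in> borel_measurable M"
    and p2: "(\<integral>\<^sup>+x. ennreal ((norm (p x))\<^sup>2) \<partial>M) < \<infinity>"
  shows "integrable M p"
proof -
  interpret finite_measure M by fact
  have "integrable M (\<lambda>x. (norm (p x))\<^sup>2)"
    using p p2 by (intro integrableI_bounded) auto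
  then have "integrable M (\<lambda>x. norm (p x))"
    by (rule square_integrable_imp_integrable[rotated]) (use p in simp)
  then show ?thesis using p by (simp only: integrable_norm_iff)
qed

lemma continuous_eq_of_AE_eq:
  fixes f g :: "real \<Rightarrow> complex"
  assumes L: "0 < L" and f: "continuous_on {0..L} f" and g: "continuous_on {0..L} g"
    and ae: "AE x in radial L. f x = g x" and x: "x \<in> {0..L}"
  shows "f x = g x"
proof -
  let ?h = "\<lambda>x. f x - g x"
  have h: "continuous_on {0..L} ?h" by (intro continuous_intros f g)
  have "?h s = 0" if s: "s \<in> {0<..<L}" for s
  proof (rule ccontr)
    assume nz: "?h s \<noteq> 0"
    define S where "S = {0<..<L} \<inter> ?h -` (- {0})"
    have "continuous_on {0<..<L} ?h" by (rule continuous_on_subset[OF h]) auto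
    then have "open S" unfolding S_def Int_commute[of "{0<..<L}"]
      using continuous_on_open_vimage[of "{0<..<L}" ?h] by auto
    moreover have "S \<noteq> {}" using nz s by (auto simp: S_def)
    moreover have "negligible S"
    proof -
      have "AE x in lborel. x \<notin> S" using ae unfolding AE_radial by eventually_elim (auto simp: S_def)
      then have "emeasure lborel {x \<in> space lborel. \<not> x \<notin> S} = 0"
        using \<open>open S\<close> by (intro AE_E2) auto
      then show ?thesis using \<open>open S\<close>
        by (simp add: negligible_iff_null_sets null_sets_def emeasure_completion borel_open)
    qed
    ultimately show False using open_not_negligible by blast
  qed
  then have "?h x = 0"
    by (rule continuous_constant_on_closure[of "{0<..<L}" ?h 0 x, rotated]) (use h L x in auto)
  then show ?thesis by simp
qed

text \<open>
  Here \<open>v k\<close> are the modes of smooth approximations, \<open>p\<close> and \<open>q\<close> those of the limits of their two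
  derivatives, and \<open>V\<close> is the mode of the harmonic function. From the convergence at \<open>0\<close> and the
  \<open>L\<^sup>2\<close> convergence of the derivatives to \<open>p\<close>, the \<open>v k\<close> converge at every point of the closed interval to
  \<open>w s = \<alpha> + \<integral> p\<close>, the integral being taken from \<open>0\<close> to \<open>s\<close>. This continuous function agrees with \<open>V\<close> almost
  everywhere, so it is the solution of the differential equation up to the ends, with end values
  \<open>\<alpha>\<close> and \<open>\<beta>\<close>, and \<open>p\<close> is its derivative.
\<close>

theorem mode_limit:
  fixes v pv :: "nat \<Rightarrow> real \<Rightarrow> complex" and V V1 p q :: "real \<Rightarrow> complex" and n :: int
  assumes t: "t > 1"
    and dv: "\<And>k s. (v k has_vector_derivative pv k s) (at s)" "\<And>k. continuous_on UNIV (pv k)"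
    and pm [measurable]: "p \<in> borel_measurable (radial (ln t))" "q \<in> borel_measurable (radial (ln t))"
    and p2: "(\<integral>\<^sup>+s. ennreal ((norm (p s))\<^sup>2) \<partial>radial (ln t)) < \<infinity>"
    and lim_p: "(\<lambda>k. \<integral>\<^sup>+s. ennreal ((norm (pv k s - p s))\<^sup>2) \<partial>radial (ln t)) \<longlonglongrightarrow> 0"
    and lim_q: "(\<lambda>k. \<integral>\<^sup>+s. ennreal ((norm (\<i> * of_int n * v k s - q s))\<^sup>2) \<partial>radial (ln t)) \<longlonglongrightarrow> 0"
    and lim_V: "(\<lambda>k. \<integral>\<^sup>+s. ennreal ((norm (v k s - V s))\<^sup>2) \<partial>radial (ln t)) \<longlonglongrightarrow> 0"
    and lim_0: "(\<lambda>k. v k 0) \<longlonglongrightarrow> \<alpha>" and lim_L: "(\<lambda>k. v k (ln t)) \<longlonglongrightarrow> \<beta>"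
    and V: "\<And>s. s \<in> {0<..<ln t} \<Longrightarrow> (V has_vector_derivative V1 s) (at s)"
    and V1: "\<And>s. s \<in> {0<..<ln t} \<Longrightarrow> (V1 has_vector_derivative of_int (n\<^sup>2) * V s) (at s)"
  shows "(\<integral>\<^sup>+s. ennreal ((norm (p s))\<^sup>2 + (norm (q s))\<^sup>2) \<partial>radial (ln t)) = ennreal (mode_energy t \<alpha> \<beta> n)"
proof -
  define L where "L = ln t"
  have L: "L > 0" using t by (simp add: L_def)
  note lims = lim_p[folded L_def] lim_q[folded L_def] lim_V[folded L_def]
  have [measurable]: "p \<in> borel_measurable (radial L)" "q \<in> borel_measurable (radial L)"
    using pm by (simp_all add: L_def)
  have [measurable]: "pv k \<in> borel_measurable (radial L)" "v k \<in> borel_measurable (radial L)" for k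
  proof -
    have "continuous_on UNIV (v k)"
      by (rule continuous_at_imp_continuous_on) (use dv(1) in \<open>auto intro: has_vector_derivative_continuous\<close>)
    then show "pv k \<in> borel_measurable (radial L)" "v k \<in> borel_measurable (radial L)"
      using dv(2)[of k] by (auto intro!: measurable_radialI borel_measurable_continuous_onI)
  qed
  obtain X Y where X: "\<And>s. s \<in> {0<..<L} \<Longrightarrow> V s = X s"
    and XY: "\<And>s. (X has_vector_derivative Y s) (at s)" and Yc: "continuous_on UNIV Y"
    and en: "((\<lambda>s. (norm (Y s))\<^sup>2 + (real_of_int n)\<^sup>2 * (norm (X s))\<^sup>2) has_integral mode_energy t (X 0) (X L) n) {0..L}"
    using mode_solution_energy[OF t V V1] unfolding L_def by blast
  have Xc: "continuous_on UNIV X"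
    by (rule continuous_at_imp_continuous_on) (use XY in \<open>auto intro: has_vector_derivative_continuous\<close>)
  have [measurable]: "X \<in> borel_measurable (radial L)" "Y \<in> borel_measurable (radial L)"
    using Xc Yc by (auto intro!: measurable_radialI borel_measurable_continuous_onI)
  have ip: "integrable (radial L) p"
    using L2_imp_integrable[OF finite_measure_radial pm(1) p2] by (simp add: L_def)
  define J where "J = (\<lambda>a b. LINT s|radial L. indicator {a..b} s *\<^sub>R p s)"
  have ind: "integrable (radial L) (\<lambda>s. indicator {a..b} s *\<^sub>R f s)" if "integrable (radial L) f" for a b and f :: "real \<Rightarrow> complex"
  proof (rule Bochner_Integration.integrable_bound[OF that])
    show "(\<lambda>s. indicator {a..b} s *\<^sub>R f s) \<in> borel_measurable (radial L)"
      using that by (intro borel_measurable_scaleR measurable_radialI[of "indicator {a..b}"]) auto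
  qed (auto intro!: AE_I2 simp: indicator_def)
  have J: "(\<lambda>k. v k b - v k a) \<longlonglongrightarrow> J a b" if ab: "0 \<le> a" "a \<le> b" "b \<le> L" for a b
  proof -
    have le: "ennreal (norm (v k b - v k a - J a b)) \<le> (\<integral>\<^sup>+s. ennreal (norm (pv k s - p s)) \<partial>radial L)" for k
    proof -
      note i = integral_radial_derivative[OF dv(1) dv(2) ab, of k]
      have "v k b - v k a - J a b = (LINT s|radial L. indicator {a..b} s *\<^sub>R pv k s - indicator {a..b} s *\<^sub>R p s)"
        unfolding J_def i(2)[symmetric] by (rule Bochner_Integration.integral_diff[symmetric]) (intro ind i(1) ip)+
      also have "ennreal (norm \<dots>) \<le> (\<integral>\<^sup>+s. ennreal (norm (indicator {a..b} s *\<^sub>R pv k s - indicator {a..b} s *\<^sub>R p s)) \<partial>radial L)"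
        by (intro integral_norm_bound_ennreal Bochner_Integration.integrable_diff ind i(1) ip)
      also have "\<dots> \<le> (\<integral>\<^sup>+s. ennreal (norm (pv k s - p s)) \<partial>radial L)"
        by (intro nn_integral_mono ennreal_leI) (auto simp: indicator_def)
      finally show ?thesis .
    qed
    have "(\<lambda>k. \<integral>\<^sup>+s. ennreal (norm (pv k s - p s)) \<partial>radial L) \<longlonglongrightarrow> 0"
      by (rule L2_limit_imp_L1_limit[OF _ _ lims(1)]) (use L emeasure_radial[of L] in auto)
    from tendsto_sandwich[OF always_eventually always_eventually tendsto_const this, OF allI allI, OF zero_le le]
    have "(\<lambda>k. ennreal (norm (v k b - v k a - J a b))) \<longlonglongrightarrow> ennreal 0" by simp
    then have "(\<lambda>k. norm (v k b - v k a - J a b)) \<longlonglongrightarrow> 0"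
      by (rule tendsto_ennrealD) (rule always_eventually, simp, simp)
    then show ?thesis by (rule LIM_zero_cancel[OF tendsto_norm_zero_cancel])
  qed
  define w where "w = (\<lambda>s. \<alpha> + J 0 s)"
  have vw: "(\<lambda>k. v k s) \<longlonglongrightarrow> w s" if "s \<in> {0..L}" for s
    using tendsto_add[OF lim_0 J[of 0 s]] that by (simp add: w_def)
  have w0: "w 0 = \<alpha>" using LIMSEQ_unique[OF vw[of 0] lim_0] L by simp
  have wL: "w L = \<beta>" using LIMSEQ_unique[OF vw[of L]] lim_L L by (simp add: L_def)
  have wJ: "w b - w a = J a b" if "0 \<le> a" "a \<le> b" "b \<le> L" for a b
    using LIMSEQ_unique[OF tendsto_diff[OF vw[of b] vw[of a]] J[OF that]] that by simp
  have [measurable]: "w \<in> borel_measurable (radial L)"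
    by (rule borel_measurable_LIMSEQ_metric[where f = v]) (auto intro: vw)
  have wc: "continuous_on {0..L} w"
  proof -
    let ?p = "\<lambda>x. indicator {0<..<L} x *\<^sub>R p x"
    have i: "integrable lborel ?p" using ip by (simp add: integrable_radial_iff)
    then have si: "set_integrable lborel {a..b} ?p" for a b
      using integrable_mult_indicator[OF _ i, of "{a..b}"] by (simp add: set_integrable_def)
    have "J 0 s = integral {0..s} ?p" for s
      using set_borel_integral_eq_integral(2)[OF si[of 0 s]]
      by (simp add: J_def integral_radial set_lebesgue_integral_def mult.commute)
    moreover have "continuous_on {0..L} (\<lambda>s. integral {0..s} ?p)"
      by (rule indefinite_integral_continuous_1) (use set_borel_integral_eq_integral(1)[OF si] in blast)
    ultimately show ?thesis unfolding w_def by (intro continuous_intros) simp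
  qed
  have VX: "AE s in radial L. V s = X s" by (rule AE_I2) (use X in auto)
  have Vm: "V \<in> borel_measurable (radial L)"
  proof (rule measurable_radial_continuous)
    show "continuous_on {0<..<L} V"
    proof (intro continuous_at_imp_continuous_on ballI)
      fix s assume "s \<in> {0<..<L}"
      then have "s \<in> {0<..<ln t}" by (simp only: L_def)
      from has_vector_derivative_continuous[OF V[OF this]] show "isCont V s" .
    qed
  qed
  have "AE s in radial L. V s = w s"
    by (rule AE_eq_of_L2_limit[OF _ Vm _ _ lims(3)]) (use vw in auto)
  with VX have aXw: "AE s in radial L. X s = w s" by eventually_elim simp
  have Xw: "X s = w s" if "s \<in> {0..L}" for s
    by (rule continuous_eq_of_AE_eq[OF L continuous_on_subset[OF Xc subset_UNIV] wc aXw that])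
  have qX: "AE s in radial L. q s = \<i> * of_int n * X s"
  proof (rule AE_eq_of_L2_limit[OF _ _ _ _ lims(2)])
    show "(\<lambda>k. \<i> * of_int n * v k s) \<longlonglongrightarrow> \<i> * of_int n * X s" if "s \<in> space (radial L)" for s
      using that vw[of s] Xw[of s] by (intro tendsto_intros) auto
  qed auto
  \<comment> \<open>Both functions have the same primitive on every subinterval.\<close>
  have pY: "AE s in radial L. p s = Y s"
  proof -
    let ?f = "\<lambda>s. indicator {0<..<L} s *\<^sub>R (p s - Y s)"
    have iY: "integrable (radial L) Y" by (rule integral_radial_derivative(1)[OF XY Yc, of 0 0]) (use L in auto)
    have "AE s in lborel. ?f s = 0"
    proof (rule AE_zero_of_interval_integrals)
      show "integrable lborel ?f"
        using Bochner_Integration.integrable_diff[OF ip iY] by (simp only: integrable_radial_iff)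
      fix a b :: real assume ab: "a \<le> b"
      define a' b' where "a' = max 0 (min L a)" and "b' = max 0 (min L b)"
      have ab': "0 \<le> a'" "a' \<le> b'" "b' \<le> L" using ab L by (auto simp: a'_def b'_def)
      have "set_lebesgue_integral lborel {a..b} ?f = (LINT s|radial L. indicator {a'..b'} s *\<^sub>R (p s - Y s))"
        unfolding set_lebesgue_integral_def integral_radial
        by (intro Bochner_Integration.integral_cong refl) (auto simp: indicator_def a'_def b'_def)
      also have "\<dots> = J a' b' - (X b' - X a')"
        unfolding J_def integral_radial_derivative(2)[OF XY Yc ab', symmetric] scaleR_diff_right
        by (intro Bochner_Integration.integral_diff ind ip iY)
      also have "\<dots> = 0" using wJ[OF ab'] Xw[of a'] Xw[of b'] ab' by simp
      finally show "set_lebesgue_integral lborel {a..b} ?f = 0" .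
    qed
    then show ?thesis unfolding AE_radial by eventually_elim auto
  qed
  let ?e = "\<lambda>s. (norm (Y s))\<^sup>2 + (real_of_int n)\<^sup>2 * (norm (X s))\<^sup>2"
  have ec: "continuous_on UNIV ?e" by (intro continuous_intros Xc Yc)
  have "(\<integral>\<^sup>+s. ennreal ((norm (p s))\<^sup>2 + (norm (q s))\<^sup>2) \<partial>radial L) = (\<integral>\<^sup>+s. ennreal (?e s) \<partial>radial L)"
    using pY qX by (intro nn_integral_cong_AE, eventually_elim) (simp add: norm_mult power_mult_distrib)
  also have "\<dots> = (\<integral>\<^sup>+s. ennreal (?e s) * indicator {0<..<L} s \<partial>lborel)"
    unfolding radial_def by (subst nn_integral_restrict_space) auto
  also have "\<dots> = (\<integral>\<^sup>+s. ennreal (indicator {0..L} s * ?e s) \<partial>lborel)"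
    using AE_lborel_singleton[of 0] AE_lborel_singleton[of L]
    by (intro nn_integral_cong_AE, eventually_elim) (auto simp: indicator_def)
  also have "\<dots> = ennreal (mode_energy t (X 0) (X L) n)"
  proof (rule nn_integral_has_integral_lborel)
    show "(\<lambda>s. indicator {0..L} s * ?e s) \<in> borel_measurable borel"
      using borel_measurable_continuous_onI[OF ec] by simp
    have "(\<lambda>s. indicator {0..L} s * ?e s) = (\<lambda>s. if s \<in> {0..L} then ?e s else 0)"
      by (auto simp: indicator_def)
    then show "((\<lambda>s. indicator {0..L} s * ?e s) has_integral mode_energy t (X 0) (X L) n) UNIV"
      using en by (simp only: has_integral_restrict_UNIV)
  qed simp
  also have "X 0 = \<alpha>" using Xw[of 0] w0 L by simp
  also have "X L = \<beta>" using Xw[of L] wL L by simp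
  finally show ?thesis by (simp only: L_def)
qed

section \<open>Fourier modes of functions on the annulus\<close>

text \<open>
  The partial derivatives are given as functions, so that a chain of such facts describes second
  derivatives; the differential is real-linear but written in complex arithmetic.
\<close>

definition C1_on :: "complex set \<Rightarrow> (complex \<Rightarrow> complex) \<Rightarrow> (complex \<Rightarrow> complex) \<Rightarrow> (complex \<Rightarrow> complex) \<Rightarrow> bool" where
  "C1_on V u ux uy \<longleftrightarrow> (\<forall>z\<in>V. (u has_derivative (\<lambda>h. of_real (Re h) * ux z + of_real (Im h) * uy z)) (at z))
     \<and> continuous_on V ux \<and> continuous_on V uy"

text \<open>
  The derivatives with respect to \<open>s\<close> and \<open>\<theta>\<close> at \<open>z = exp (s + \<i> \<theta>)\<close>, as functions of the partial
  derivatives. They are defined for arbitrary pairs of functions because they are also applied to weak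
  gradients.
\<close>

definition ds :: "(complex \<Rightarrow> complex) \<Rightarrow> (complex \<Rightarrow> complex) \<Rightarrow> complex \<Rightarrow> complex" where
  "ds ux uy z = of_real (Re z) * ux z + of_real (Im z) * uy z"

definition d\<theta> :: "(complex \<Rightarrow> complex) \<Rightarrow> (complex \<Rightarrow> complex) \<Rightarrow> complex \<Rightarrow> complex" where
  "d\<theta> ux uy z = of_real (Re z) * uy z - of_real (Im z) * ux z"

lemma norm_ds_d\<theta>: "(norm (ds p q z))\<^sup>2 + (norm (d\<theta> p q z))\<^sup>2 = (norm z)\<^sup>2 * ((norm (p z))\<^sup>2 + (norm (q z))\<^sup>2)"
  unfolding ds_def d\<theta>_def cmod_power2 by (simp add: power2_eq_square algebra_simps)

lemma ds_diff: "ds p q z - ds p' q' z = ds (\<lambda>z. p z - p' z) (\<lambda>z. q z - q' z) z"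
  and d\<theta>_diff: "d\<theta> p q z - d\<theta> p' q' z = d\<theta> (\<lambda>z. p z - p' z) (\<lambda>z. q z - q' z) z"
  by (simp_all add: ds_def d\<theta>_def algebra_simps)

lemma continuous_on_ds: "continuous_on V p \<Longrightarrow> continuous_on V q \<Longrightarrow> continuous_on V (ds p q)"
  and continuous_on_d\<theta>: "continuous_on V p \<Longrightarrow> continuous_on V q \<Longrightarrow> continuous_on V (d\<theta> p q)"
  unfolding ds_def d\<theta>_def by (intro continuous_intros; assumption)+

lemma measurable_ds [measurable]:
  assumes [measurable]: "p \<in> borel_measurable borel" "q \<in> borel_measurable borel"
  shows "ds p q \<in> borel_measurable borel" "d\<theta> p q \<in> borel_measurable borel"
  unfolding ds_def[abs_def] d\<theta>_def[abs_def] by simp_all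

lemma C1_on_continuous: "C1_on V u ux uy \<Longrightarrow> continuous_on V u"
  unfolding C1_on_def by (intro continuous_at_imp_continuous_on ballI) (auto dest!: bspec has_derivative_continuous)

lemma has_vector_derivative_logpolar_s: "((\<lambda>s. logpolar s \<theta>) has_vector_derivative logpolar s \<theta>) (at s)"
proof -
  have "((\<lambda>s. complex_of_real (exp s)) has_vector_derivative of_real (exp s)) (at s)"
    by (rule has_vector_derivative_of_real) (auto intro!: derivative_eq_intros simp: has_real_derivative_iff_has_vector_derivative[symmetric])
  then show ?thesis unfolding logpolar_def by (rule has_vector_derivative_mult_left)
qed

lemma has_vector_derivative_logpolar_\<theta>: "((\<lambda>\<theta>. logpolar s \<theta>) has_vector_derivative \<i> * logpolar s \<theta>) (at \<theta>)"
proof -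
  have "((\<lambda>z. exp (\<i> * z)) has_field_derivative \<i> * exp (\<i> * of_real \<theta>)) (at (of_real \<theta>))"
    by (auto intro!: derivative_eq_intros)
  note * = has_vector_derivative_real_field[OF this, of UNIV]
  have "cis = (\<lambda>x. exp (\<i> * of_real x))" by (rule ext) (rule cis_conv_exp)
  then have "(cis has_vector_derivative \<i> * cis \<theta>) (at \<theta>)" using * cis_conv_exp[of \<theta>] by simp
  from has_vector_derivative_mult_right[OF this, of "of_real (exp s)"] show ?thesis
    unfolding logpolar_def by (simp add: mult.left_commute)
qed

lemma C1_on_ds:
  assumes u: "C1_on V u ux uy" and z: "logpolar s \<theta> \<in> V"
  shows "((\<lambda>s. u (logpolar s \<theta>)) has_vector_derivative ds ux uy (logpolar s \<theta>)) (at s)"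
proof -
  have "(u has_derivative (\<lambda>h. of_real (Re h) * ux (logpolar s \<theta>) + of_real (Im h) * uy (logpolar s \<theta>)))
      (at (logpolar s \<theta>) within range (\<lambda>s. logpolar s \<theta>))"
    using u z unfolding C1_on_def by (blast intro: has_derivative_at_withinI)
  from vector_derivative_diff_chain_within[OF has_vector_derivative_logpolar_s this]
  show ?thesis by (simp add: o_def ds_def)
qed

lemma C1_on_d\<theta>:
  assumes u: "C1_on V u ux uy" and z: "logpolar s \<theta> \<in> V"
  shows "((\<lambda>\<theta>. u (logpolar s \<theta>)) has_vector_derivative d\<theta> ux uy (logpolar s \<theta>)) (at \<theta>)"
proof -
  have "(u has_derivative (\<lambda>h. of_real (Re h) * ux (logpolar s \<theta>) + of_real (Im h) * uy (logpolar s \<theta>)))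
      (at (logpolar s \<theta>) within range (\<lambda>\<theta>. logpolar s \<theta>))"
    using u z unfolding C1_on_def by (blast intro: has_derivative_at_withinI)
  from vector_derivative_diff_chain_within[OF has_vector_derivative_logpolar_\<theta> this]
  show ?thesis by (simp add: o_def d\<theta>_def)
qed

definition mode :: "(complex \<Rightarrow> complex) \<Rightarrow> int \<Rightarrow> real \<Rightarrow> complex" where
  "mode u n s = fourier_coeff (\<lambda>\<theta>. u (logpolar s \<theta>)) n"

lemma continuous_on_logpolar: "continuous_on A (\<lambda>p. logpolar (fst p) (snd p))"
  unfolding logpolar_def by (intro continuous_intros)

lemma continuous_on_circle:
  assumes "continuous_on V u" "\<And>\<theta>. logpolar s \<theta> \<in> V"
  shows "continuous_on A (\<lambda>\<theta>. u (logpolar s \<theta>))"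
proof -
  have "continuous_on A (\<lambda>\<theta>. logpolar s \<theta>)" unfolding logpolar_def by (intro continuous_intros)
  then show ?thesis using assms(2) by (intro continuous_on_compose2[OF assms(1)]) auto
qed

lemma mode_eq_integral:
  assumes "continuous_on V u" "\<And>\<theta>. logpolar s \<theta> \<in> V"
  shows "mode u n s = integral {0..2*pi} (\<lambda>\<theta>. u (logpolar s \<theta>) * cis (- (of_int n * \<theta>))) / (2 * pi)"
  unfolding mode_def fourier_coeff_def
  by (subst circ_integral_continuous(2)) (intro continuous_intros continuous_on_circle[OF assms], simp)

text \<open>
  Integration by parts; the boundary terms cancel by periodicity.
\<close>

lemma mode_d\<theta>:
  assumes u: "C1_on V u ux uy" and V: "\<And>\<theta>. logpolar s \<theta> \<in> V"
  shows "mode (d\<theta> ux uy) n s = \<i> * of_int n * mode u n s"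
proof -
  let ?c = "\<lambda>\<theta>. cis (- (of_int n * \<theta>))"
  let ?f = "\<lambda>\<theta>. u (logpolar s \<theta>) * ?c \<theta>"
  have cd: "continuous_on V (d\<theta> ux uy)" using u by (auto simp: C1_on_def intro: continuous_on_d\<theta>)
  have cu: "continuous_on V u" using u by (rule C1_on_continuous)
  have cder: "(?c has_vector_derivative - \<i> * of_int n * ?c \<theta>) (at \<theta>)" for \<theta>
  proof -
    have "((\<lambda>z. exp (- \<i> * of_int n * z)) has_field_derivative (- \<i> * of_int n) * exp (- \<i> * of_int n * of_real \<theta>)) (at (of_real \<theta>))"
      by (auto intro!: derivative_eq_intros)
    from has_vector_derivative_real_field[OF this] show ?thesis by (simp add: cis_conv_exp mult.assoc)
  qed
  have "(?f has_vector_derivative (u (logpolar s \<theta>) * (- \<i> * of_int n * ?c \<theta>) + d\<theta> ux uy (logpolar s \<theta>) * ?c \<theta>)) (at \<theta> within {0..2*pi})" for \<theta>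
    by (intro has_vector_derivative_at_within[OF has_vector_derivative_mult] cder C1_on_d\<theta>[OF u] V)
  then have "((\<lambda>\<theta>. u (logpolar s \<theta>) * (- \<i> * of_int n * ?c \<theta>) + d\<theta> ux uy (logpolar s \<theta>) * ?c \<theta>) has_integral (?f (2*pi) - ?f 0)) {0..2*pi}"
    by (intro fundamental_theorem_of_calculus) auto
  moreover have "?f (2*pi) = ?f 0"
  proof -
    have "?c (2*pi) = 1" using cis_multiple_2pi[of "- of_int n"] by (simp add: mult_ac)
    then show ?thesis by (simp add: logpolar_def)
  qed
  ultimately have 0: "((\<lambda>\<theta>. u (logpolar s \<theta>) * (- \<i> * of_int n * ?c \<theta>) + d\<theta> ux uy (logpolar s \<theta>) * ?c \<theta>) has_integral 0) {0..2*pi}" by simp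
  have 1: "(?f has_integral integral {0..2*pi} ?f) {0..2*pi}"
    by (intro integrable_integral integrable_continuous_real continuous_intros continuous_on_circle[OF cu V])
  have "((\<lambda>\<theta>. u (logpolar s \<theta>) * (- \<i> * of_int n * ?c \<theta>) + d\<theta> ux uy (logpolar s \<theta>) * ?c \<theta> + \<i> * of_int n * ?f \<theta>)
      has_integral (0 + \<i> * of_int n * integral {0..2*pi} ?f)) {0..2*pi}"
    by (intro has_integral_add 0 has_integral_mult_right 1)
  then have "integral {0..2*pi} (\<lambda>\<theta>. d\<theta> ux uy (logpolar s \<theta>) * ?c \<theta>) = \<i> * of_int n * integral {0..2*pi} ?f"
    by (intro integral_unique) (simp add: algebra_simps)
  then show ?thesis
    unfolding mode_eq_integral[OF cd V] mode_eq_integral[OF cu V] by simp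
qed

lemma mode_ds:
  assumes u: "C1_on V u ux uy" and V: "\<And>s \<theta>. s \<in> {a<..<b} \<Longrightarrow> logpolar s \<theta> \<in> V" and s: "s \<in> {a<..<b}"
  shows "(mode u n has_vector_derivative mode (ds ux uy) n s) (at s)"
proof -
  let ?c = "\<lambda>\<theta>. cis (- (of_int n * \<theta>))"
  have cd: "continuous_on V (ds ux uy)" using u by (auto simp: C1_on_def intro: continuous_on_ds)
  have cu: "continuous_on V u" using u by (rule C1_on_continuous)
  have "((\<lambda>s. integral (cbox 0 (2*pi)) (\<lambda>\<theta>. u (logpolar s \<theta>) * ?c \<theta>)) has_vector_derivative
      integral (cbox 0 (2*pi)) (\<lambda>\<theta>. ds ux uy (logpolar s \<theta>) * ?c \<theta>)) (at s within {a<..<b})"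
  proof (rule leibniz_rule_vector_derivative)
    show "((\<lambda>s. u (logpolar s \<theta>) * ?c \<theta>) has_vector_derivative ds ux uy (logpolar s \<theta>) * ?c \<theta>) (at s within {a<..<b})"
      if "s \<in> {a<..<b}" for s \<theta>
      by (intro has_vector_derivative_at_within[OF has_vector_derivative_mult_left] C1_on_ds[OF u] V that)
    show "(\<lambda>\<theta>. u (logpolar s \<theta>) * ?c \<theta>) integrable_on cbox 0 (2*pi)" if "s \<in> {a<..<b}" for s
      unfolding cbox_interval
      by (intro integrable_continuous_real continuous_intros continuous_on_circle[OF cu V] that)
    have "continuous_on ({a<..<b} \<times> cbox 0 (2*pi)) (\<lambda>p. ds ux uy (logpolar (fst p) (snd p)) * ?c (snd p))"
      by (intro continuous_intros continuous_on_compose2[OF cd continuous_on_logpolar]) (auto intro: V)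
    then show "continuous_on ({a<..<b} \<times> cbox 0 (2*pi)) (\<lambda>(s, \<theta>). ds ux uy (logpolar s \<theta>) * ?c \<theta>)"
      by (simp add: case_prod_beta')
  qed (use s in auto)
  then have "((\<lambda>s. integral {0..2*pi} (\<lambda>\<theta>. u (logpolar s \<theta>) * ?c \<theta>)) has_vector_derivative
      integral {0..2*pi} (\<lambda>\<theta>. ds ux uy (logpolar s \<theta>) * ?c \<theta>)) (at s)"
    using s by (simp add: cbox_interval at_within_open[of s "{a<..<b}"])
  from has_vector_derivative_divide[OF this, of "2 * pi"]
  have "((\<lambda>s. integral {0..2*pi} (\<lambda>\<theta>. u (logpolar s \<theta>) * ?c \<theta>) / (2 * pi)) has_vector_derivative mode (ds ux uy) n s) (at s)"
    by (simp add: mode_eq_integral[OF cd V[OF s]])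
  then show ?thesis
    by (rule has_vector_derivative_transform_within_open[where S = "{a<..<b}"])
       (use s in \<open>auto simp: mode_eq_integral[OF cu V]\<close>)
qed

lemma measurable_logpolar_circ [measurable]:
  "(\<lambda>p. logpolar (fst p) (snd p)) \<in> borel_measurable (borel \<Otimes>\<^sub>M circle_measure)"
proof -
  have "(\<lambda>p. (fst p, snd p)) \<in> measurable (borel \<Otimes>\<^sub>M circle_measure) (borel \<Otimes>\<^sub>M borel)"
    using measurable_circI[of "\<lambda>x. x"] by (intro measurable_Pair) (auto intro: measurable_compose[OF measurable_snd])
  from measurable_compose[OF this measurable_logpolar_pair] show ?thesis by simp
qed

lemma measurable_section [measurable]:
  assumes "w \<in> borel_measurable borel"
  shows "(\<lambda>\<theta>. w (logpolar s \<theta>)) \<in> borel_measurable circle_measure"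
proof (rule measurable_circI, rule measurable_compose[OF _ assms])
  show "(\<lambda>\<theta>. logpolar s \<theta>) \<in> borel_measurable borel"
    unfolding logpolar_def by (intro borel_measurable_continuous_onI continuous_intros)
qed

lemma measurable_mode:
  assumes w: "w \<in> borel_measurable borel"
  shows "mode w n \<in> borel_measurable borel"
proof -
  have c: "(\<lambda>p :: real \<times> real. cis (- (of_int n * snd p))) \<in> borel_measurable (borel \<Otimes>\<^sub>M circle_measure)"
  proof (rule measurable_compose[OF measurable_snd])
    show "(\<lambda>x. cis (- (of_int n * x))) \<in> borel_measurable circle_measure" by (rule measurable_circI) measurable
  qed
  have "(\<lambda>p. w (logpolar (fst p) (snd p)) * cis (- (of_int n * snd p))) \<in> borel_measurable (borel \<Otimes>\<^sub>M circle_measure)"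
    by (intro borel_measurable_times c measurable_compose[OF measurable_logpolar_circ w])
  then have "(\<lambda>s. LINT \<theta>|circle_measure. w (logpolar s \<theta>) * cis (- (of_int n * \<theta>))) \<in> borel_measurable borel"
    by (intro circle_measure.borel_measurable_lebesgue_integral) (simp add: case_prod_beta')
  then show ?thesis unfolding mode_def fourier_coeff_def by simp
qed

definition circle_energy :: "(complex \<Rightarrow> complex) \<Rightarrow> real \<Rightarrow> ennreal" where
  "circle_energy w s = (\<integral>\<^sup>+\<theta>. ennreal ((norm (w (logpolar s \<theta>)))\<^sup>2) \<partial>circle_measure)"

lemma measurable_circle_energy:
  assumes w: "w \<in> borel_measurable borel"
  shows "circle_energy w \<in> borel_measurable borel"
proof -
  have "(\<lambda>p. ennreal ((norm (w (logpolar (fst p) (snd p))))\<^sup>2)) \<in> borel_measurable (borel \<Otimes>\<^sub>M circle_measure)"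
    using measurable_compose[OF measurable_logpolar_circ w] by simp
  then show ?thesis unfolding circle_energy_def
    by (intro circle_measure.borel_measurable_nn_integral) (simp add: case_prod_beta')
qed

lemma circle_L2_section_iff:
  assumes "w \<in> borel_measurable borel"
  shows "circle_L2 (\<lambda>\<theta>. w (logpolar s \<theta>)) \<longleftrightarrow> circle_energy w s < \<infinity>"
  unfolding circle_L2_iff_nn circle_energy_def using measurable_section[OF assms] by simp

text \<open>
  Bessel's inequality for a single coefficient, with \<open>1\<close> in place of the sharp constant \<open>1 / (2 \<pi>)\<close>.
\<close>

lemma norm_mode_le:
  assumes w: "w \<in> borel_measurable borel"
  shows "ennreal ((norm (mode w n s))\<^sup>2) \<le> circle_energy w s"
proof (cases "circle_energy w s < \<infinity>")
  case True
  then have g: "circle_L2 (\<lambda>\<theta>. w (logpolar s \<theta>))" by (simp only: circle_L2_section_iff[OF w])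
  have "1 * (norm (mode w n s))\<^sup>2 \<le> 2 * pi * (norm (mode w n s))\<^sup>2"
    using pi_ge_two by (intro mult_right_mono) auto
  then have "(norm (mode w n s))\<^sup>2 \<le> (LINT \<theta>|circle_measure. (norm (w (logpolar s \<theta>)))\<^sup>2)"
    using norm_fourier_coeff_le[OF g, of n] unfolding mode_def by simp
  then show ?thesis
    unfolding circle_energy_def nn_integral_norm_sq[OF g] by (rule ennreal_leI)
qed (simp add: not_less top_unique)

lemma mode_diff:
  assumes "circle_L2 (\<lambda>\<theta>. u (logpolar s \<theta>))" "circle_L2 (\<lambda>\<theta>. w (logpolar s \<theta>))"
  shows "mode (\<lambda>z. u z - w z) n s = mode u n s - mode w n s"
  unfolding mode_def by (rule fourier_coeff_diff) (intro circle_L2_integrable assms)+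

lemma nn_integral_radial:
  "f \<in> borel_measurable borel \<Longrightarrow> (\<integral>\<^sup>+s. f s \<partial>radial L) = (\<integral>\<^sup>+s. f s * indicator {0<..<L} s \<partial>lborel)"
  unfolding radial_def by (subst nn_integral_restrict_space) auto

text \<open>
  Conformal invariance: the factor \<open>|z|\<^sup>2\<close> in \<open>norm_ds_d\<theta>\<close> is the Jacobian determinant \<open>exp (2 s)\<close>.
\<close>

lemma nn_integral_annulus_energy:
  assumes t: "t > 1" and [measurable]: "p \<in> borel_measurable borel" "q \<in> borel_measurable borel"
  shows "(\<integral>\<^sup>+z. ennreal ((norm (p z))\<^sup>2 + (norm (q z))\<^sup>2) * indicator (open_annulus t) z \<partial>lborel) =
    (\<integral>\<^sup>+s. circle_energy (ds p q) s + circle_energy (d\<theta> p q) s \<partial>radial (ln t))"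
proof -
  have "(\<integral>\<^sup>+z. ennreal ((norm (p z))\<^sup>2 + (norm (q z))\<^sup>2) * indicator (open_annulus t) z \<partial>lborel) =
    (\<integral>\<^sup>+s. (\<integral>\<^sup>+\<theta>. ennreal (exp (2 * s)) * ennreal ((norm (p (logpolar s \<theta>)))\<^sup>2 + (norm (q (logpolar s \<theta>)))\<^sup>2) \<partial>circle_measure) * indicator {0<..<ln t} s \<partial>lborel)"
    by (rule nn_integral_annulus_logpolar[OF t]) measurable
  also have "\<dots> = (\<integral>\<^sup>+s. (circle_energy (ds p q) s + circle_energy (d\<theta> p q) s) * indicator {0<..<ln t} s \<partial>lborel)"
  proof (intro nn_integral_cong arg_cong2[where f = "(*)"] refl)
    fix s
    have "ennreal (exp (2 * s)) * ennreal ((norm (p (logpolar s \<theta>)))\<^sup>2 + (norm (q (logpolar s \<theta>)))\<^sup>2) =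
        ennreal ((norm (ds p q (logpolar s \<theta>)))\<^sup>2) + ennreal ((norm (d\<theta> p q (logpolar s \<theta>)))\<^sup>2)" for \<theta>
      using norm_ds_d\<theta>[of p q "logpolar s \<theta>"]
      by (simp add: exp_double flip: ennreal_plus ennreal_mult)
    then show "(\<integral>\<^sup>+\<theta>. ennreal (exp (2 * s)) * ennreal ((norm (p (logpolar s \<theta>)))\<^sup>2 + (norm (q (logpolar s \<theta>)))\<^sup>2) \<partial>circle_measure) =
        circle_energy (ds p q) s + circle_energy (d\<theta> p q) s"
      unfolding circle_energy_def by (simp only:) (rule nn_integral_add; measurable)
  qed
  also have "\<dots> = (\<integral>\<^sup>+s. circle_energy (ds p q) s + circle_energy (d\<theta> p q) s \<partial>radial (ln t))"
    by (rule nn_integral_radial[symmetric]) (intro borel_measurable_add measurable_circle_energy; measurable)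
  finally show ?thesis .
qed

text \<open>
  The Jacobian determinant \<open>exp (2 s)\<close> is at least \<open>1\<close> outside the unit disc.
\<close>

lemma nn_integral_circle_energy_le:
  assumes t: "t > 1" and [measurable]: "w \<in> borel_measurable borel"
  shows "(\<integral>\<^sup>+s. circle_energy w s \<partial>radial (ln t)) \<le> (\<integral>\<^sup>+z. ennreal ((norm (w z))\<^sup>2) * indicator (open_annulus t) z \<partial>lborel)"
proof -
  have "(\<integral>\<^sup>+s. circle_energy w s \<partial>radial (ln t)) = (\<integral>\<^sup>+s. circle_energy w s * indicator {0<..<ln t} s \<partial>lborel)"
    by (rule nn_integral_radial) (rule measurable_circle_energy, measurable)
  also have "\<dots> \<le> (\<integral>\<^sup>+s. (\<integral>\<^sup>+\<theta>. ennreal (exp (2 * s)) * ennreal ((norm (w (logpolar s \<theta>)))\<^sup>2) \<partial>circle_measure) * indicator {0<..<ln t} s \<partial>lborel)"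
  proof (rule nn_integral_mono)
    fix s :: real
    show "circle_energy w s * indicator {0<..<ln t} s \<le> (\<integral>\<^sup>+\<theta>. ennreal (exp (2 * s)) * ennreal ((norm (w (logpolar s \<theta>)))\<^sup>2) \<partial>circle_measure) * indicator {0<..<ln t} s"
    proof (cases "s \<in> {0<..<ln t}")
      case True
      then have "1 * x \<le> ennreal (exp (2 * s)) * x" for x :: ennreal
        by (intro mult_right_mono) auto
      then show ?thesis using True unfolding circle_energy_def
        by (auto intro!: nn_integral_mono)
    qed simp
  qed
  also have "\<dots> = (\<integral>\<^sup>+z. ennreal ((norm (w z))\<^sup>2) * indicator (open_annulus t) z \<partial>lborel)"
    by (rule nn_integral_annulus_logpolar[OF t, symmetric]) measurable
  finally show ?thesis .
qed

section \<open>The energy of a scalar harmonic function in terms of its boundary values\<close>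

lemma circle_L2_continuous:
  assumes m: "g \<in> borel_measurable circle_measure" and c: "continuous_on {0..2*pi} g"
  shows "circle_L2 g"
proof -
  have "bounded (g ` {0..2*pi})" by (intro compact_imp_bounded compact_continuous_image c) simp
  then obtain B where "\<And>x. x \<in> {0..2*pi} \<Longrightarrow> norm (g x) \<le> B" unfolding bounded_iff by blast
  then show ?thesis by (rule circle_L2_bounded[OF m])
qed

lemma circle_L2_section_continuous:
  assumes w: "w \<in> borel_measurable borel" and c: "continuous_on V w" "\<And>\<theta>. logpolar s \<theta> \<in> V"
  shows "circle_L2 (\<lambda>\<theta>. w (logpolar s \<theta>))"
  by (rule circle_L2_continuous[OF measurable_section[OF w] continuous_on_circle[OF c]])

lemma continuous_on_mode:
  assumes c: "continuous_on UNIV w"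
  shows "continuous_on UNIV (mode w n)"
proof -
  have "continuous_on (UNIV \<times> cbox 0 (2*pi)) (\<lambda>p. w (logpolar (fst p) (snd p)) * cis (- (of_int n * snd p)))"
    by (intro continuous_intros continuous_on_compose2[OF c continuous_on_logpolar]) auto
  then have "continuous_on (UNIV \<times> cbox 0 (2*pi)) (\<lambda>(s, \<theta>). w (logpolar s \<theta>) * cis (- (of_int n * \<theta>)))"
    by (simp add: case_prod_beta')
  then have "continuous_on UNIV (\<lambda>s. integral (cbox 0 (2*pi)) (\<lambda>\<theta>. w (logpolar s \<theta>) * cis (- (of_int n * \<theta>))))"
    by (rule integral_continuous_on_param)
  then have "continuous_on UNIV (\<lambda>s. integral {0..2*pi} (\<lambda>\<theta>. w (logpolar s \<theta>) * cis (- (of_int n * \<theta>))) / (2 * pi))"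
    by (intro continuous_intros) (simp_all add: cbox_interval)
  moreover have "mode w n = (\<lambda>s. integral {0..2*pi} (\<lambda>\<theta>. w (logpolar s \<theta>) * cis (- (of_int n * \<theta>))) / (2 * pi))"
    by (rule ext) (rule mode_eq_integral[OF c UNIV_I])
  ultimately show ?thesis by simp
qed

lemma norm_fourier_coeff_le_nn_integral:
  assumes g: "g \<in> borel_measurable circle_measure"
  shows "ennreal ((norm (fourier_coeff g n))\<^sup>2) \<le> (\<integral>\<^sup>+x. ennreal ((norm (g x))\<^sup>2) \<partial>circle_measure)"
proof (cases "circle_L2 g")
  case True
  have "1 * (norm (fourier_coeff g n))\<^sup>2 \<le> 2 * pi * (norm (fourier_coeff g n))\<^sup>2"
    using pi_ge_two by (intro mult_right_mono) auto
  then have "(norm (fourier_coeff g n))\<^sup>2 \<le> (LINT x|circle_measure. (norm (g x))\<^sup>2)"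
    using norm_fourier_coeff_le[OF True, of n] by linarith
  then show ?thesis unfolding nn_integral_norm_sq[OF True] by (rule ennreal_leI)
next
  case False
  then show ?thesis using g by (simp add: circle_L2_iff_nn not_less top_unique)
qed

lemma fourier_coeff_tendsto:
  assumes g: "\<And>k. circle_L2 (g k)" and a: "circle_L2 a"
    and lim: "(\<lambda>k. \<integral>\<^sup>+x. ennreal ((norm (g k x - a x))\<^sup>2) \<partial>circle_measure) \<longlonglongrightarrow> 0"
  shows "(\<lambda>k. fourier_coeff (g k) n) \<longlonglongrightarrow> fourier_coeff a n"
proof -
  have le: "ennreal ((norm (fourier_coeff (g k) n - fourier_coeff a n))\<^sup>2) \<le> (\<integral>\<^sup>+x. ennreal ((norm (g k x - a x))\<^sup>2) \<partial>circle_measure)" for k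
    using norm_fourier_coeff_le_nn_integral[of "\<lambda>x. g k x - a x" n] circle_L2_diff[OF g[of k] a]
    by (simp only: fourier_coeff_diff[OF circle_L2_integrable[OF g] circle_L2_integrable[OF a]] circle_L2_def)
  from tendsto_sandwich[OF always_eventually always_eventually tendsto_const lim, OF allI allI, OF zero_le le]
  have "(\<lambda>k. ennreal ((norm (fourier_coeff (g k) n - fourier_coeff a n))\<^sup>2)) \<longlonglongrightarrow> ennreal 0" by simp
  then have "(\<lambda>k. (norm (fourier_coeff (g k) n - fourier_coeff a n))\<^sup>2) \<longlonglongrightarrow> 0"
    by (rule tendsto_ennrealD) (rule always_eventually, simp, simp)
  then have "(\<lambda>k. sqrt ((norm (fourier_coeff (g k) n - fourier_coeff a n))\<^sup>2)) \<longlonglongrightarrow> sqrt 0" by (intro tendsto_real_sqrt)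
  then have "(\<lambda>k. norm (fourier_coeff (g k) n - fourier_coeff a n)) \<longlonglongrightarrow> 0" by simp
  then show ?thesis by (rule LIM_zero_cancel[OF tendsto_norm_zero_cancel])
qed

text \<open>
  Taking a mode is a contraction from \<open>L\<^sup>2\<close> of a circle, and the limit is square-integrable on almost
  every circle.
\<close>

lemma mode_L2_limit:
  assumes w: "\<And>k. w k \<in> borel_measurable borel" "w' \<in> borel_measurable borel"
    and wc: "\<And>k s. circle_L2 (\<lambda>\<theta>. w k (logpolar s \<theta>))" and ae: "AE s in radial L. circle_energy w' s < \<infinity>"
    and lim: "(\<lambda>k. \<integral>\<^sup>+s. circle_energy (\<lambda>z. w k z - w' z) s \<partial>radial L) \<longlonglongrightarrow> 0"
  shows "(\<lambda>k. \<integral>\<^sup>+s. ennreal ((norm (mode (w k) n s - mode w' n s))\<^sup>2) \<partial>radial L) \<longlonglongrightarrow> 0"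
proof -
  have le: "(\<integral>\<^sup>+s. ennreal ((norm (mode (w k) n s - mode w' n s))\<^sup>2) \<partial>radial L)
      \<le> (\<integral>\<^sup>+s. circle_energy (\<lambda>z. w k z - w' z) s \<partial>radial L)" for k
    using ae
  proof (intro nn_integral_mono_AE, eventually_elim)
    case (elim s)
    then have "circle_L2 (\<lambda>\<theta>. w' (logpolar s \<theta>))" by (simp only: circle_L2_section_iff[OF w(2)])
    then have e: "mode (\<lambda>z. w k z - w' z) n s = mode (w k) n s - mode w' n s" by (rule mode_diff[OF wc])
    have "(\<lambda>z. w k z - w' z) \<in> borel_measurable borel" using w by (intro borel_measurable_diff)
    from norm_mode_le[OF this, of n s] show ?case by (simp only: e)
  qed
  show ?thesis
    by (rule tendsto_sandwich[OF always_eventually always_eventually tendsto_const lim, OF allI allI, OF zero_le le])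
qed

lemma mode_cong: "(\<And>\<theta>. u (logpolar s \<theta>) = w (logpolar s \<theta>)) \<Longrightarrow> mode u n s = mode w n s"
  by (simp add: mode_def)

text \<open>
  The product rule, as \<open>ds Fx Fy\<close> contains the factors \<open>Re z\<close> and \<open>Im z\<close>.
\<close>

lemma C1_on_ds_dx:
  assumes "C1_on U Fx Fxx Fxy" "C1_on U Fy Fyx Fyy"
  shows "C1_on U (ds Fx Fy) (\<lambda>z. Fx z + of_real (Re z) * Fxx z + of_real (Im z) * Fyx z)
    (\<lambda>z. Fy z + of_real (Re z) * Fxy z + of_real (Im z) * Fyy z)"
  unfolding C1_on_def
proof (intro conjI ballI)
  note c = C1_on_continuous[OF assms(1)] C1_on_continuous[OF assms(2)]
  show "continuous_on U (\<lambda>z. Fx z + of_real (Re z) * Fxx z + of_real (Im z) * Fyx z)"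
    "continuous_on U (\<lambda>z. Fy z + of_real (Re z) * Fxy z + of_real (Im z) * Fyy z)"
    using assms c by (auto simp: C1_on_def intro!: continuous_intros)
  fix z assume z: "z \<in> U"
  have x: "(Fx has_derivative (\<lambda>h. of_real (Re h) * Fxx z + of_real (Im h) * Fxy z)) (at z)"
    and y: "(Fy has_derivative (\<lambda>h. of_real (Re h) * Fyx z + of_real (Im h) * Fyy z)) (at z)"
    using assms z by (auto simp: C1_on_def)
  have re: "((\<lambda>z. complex_of_real (Re z)) has_derivative (\<lambda>h. of_real (Re h))) (at z)"
    and im: "((\<lambda>z. complex_of_real (Im z)) has_derivative (\<lambda>h. of_real (Im h))) (at z)"
    by (auto intro!: derivative_eq_intros)
  show "(ds Fx Fy has_derivative (\<lambda>h. of_real (Re h) * (Fx z + of_real (Re z) * Fxx z + of_real (Im z) * Fyx z) +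
      of_real (Im h) * (Fy z + of_real (Re z) * Fxy z + of_real (Im z) * Fyy z))) (at z)"
    unfolding ds_def[abs_def]
    by (rule has_derivative_eq_rhs[OF has_derivative_add[OF has_derivative_mult[OF re x] has_derivative_mult[OF im y]]])
       (simp add: fun_eq_iff algebra_simps)
qed

lemma C1_on_d\<theta>_dx:
  assumes "C1_on U Fx Fxx Fxy" "C1_on U Fy Fyx Fyy"
  shows "C1_on U (d\<theta> Fx Fy) (\<lambda>z. Fy z + of_real (Re z) * Fyx z - of_real (Im z) * Fxx z)
    (\<lambda>z. of_real (Re z) * Fyy z - Fx z - of_real (Im z) * Fxy z)"
  unfolding C1_on_def
proof (intro conjI ballI)
  note c = C1_on_continuous[OF assms(1)] C1_on_continuous[OF assms(2)]
  show "continuous_on U (\<lambda>z. Fy z + of_real (Re z) * Fyx z - of_real (Im z) * Fxx z)"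
    "continuous_on U (\<lambda>z. of_real (Re z) * Fyy z - Fx z - of_real (Im z) * Fxy z)"
    using assms c by (auto simp: C1_on_def intro!: continuous_intros)
  fix z assume z: "z \<in> U"
  have x: "(Fx has_derivative (\<lambda>h. of_real (Re h) * Fxx z + of_real (Im h) * Fxy z)) (at z)"
    and y: "(Fy has_derivative (\<lambda>h. of_real (Re h) * Fyx z + of_real (Im h) * Fyy z)) (at z)"
    using assms z by (auto simp: C1_on_def)
  have re: "((\<lambda>z. complex_of_real (Re z)) has_derivative (\<lambda>h. of_real (Re h))) (at z)"
    and im: "((\<lambda>z. complex_of_real (Im z)) has_derivative (\<lambda>h. of_real (Im h))) (at z)"
    by (auto intro!: derivative_eq_intros)
  show "(d\<theta> Fx Fy has_derivative (\<lambda>h. of_real (Re h) * (Fy z + of_real (Re z) * Fyx z - of_real (Im z) * Fxx z) +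
      of_real (Im h) * (of_real (Re z) * Fyy z - Fx z - of_real (Im z) * Fxy z))) (at z)"
    unfolding d\<theta>_def[abs_def]
    by (rule has_derivative_eq_rhs[OF has_derivative_diff[OF has_derivative_mult[OF re y] has_derivative_mult[OF im x]]])
       (simp add: fun_eq_iff algebra_simps)
qed

text \<open>
  In the coordinates \<open>s\<close> and \<open>\<theta>\<close> the Laplacian is \<open>|z|\<^sup>-\<^sup>2 (\<partial>\<^sub>s\<^sup>2 + \<partial>\<^sub>\<theta>\<^sup>2)\<close>, so the second \<open>s\<close>-derivative of a
  harmonic function is minus its second \<open>\<theta>\<close>-derivative, and the latter multiplies the mode by \<open>- n\<^sup>2\<close>.
\<close>

lemma mode_harmonic:
  assumes F: "C1_on (open_annulus t) F Fx Fy" "C1_on (open_annulus t) Fx Fxx Fxy" "C1_on (open_annulus t) Fy Fyx Fyy"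
    and harm: "\<And>z. z \<in> open_annulus t \<Longrightarrow> Fxx z + Fyy z = 0" and t: "t > 1" and s: "s \<in> {0<..<ln t}"
  shows "(mode F n has_vector_derivative mode (ds Fx Fy) n s) (at s)"
    "(mode (ds Fx Fy) n has_vector_derivative of_int (n\<^sup>2) * mode F n s) (at s)"
proof -
  have U: "logpolar s \<theta> \<in> open_annulus t" if "s \<in> {0<..<ln t}" for s \<theta>
    using that t by (simp add: logpolar_in_open_annulus)
  show "(mode F n has_vector_derivative mode (ds Fx Fy) n s) (at s)"
    by (rule mode_ds[OF F(1) U s])
  \<comment> \<open>\<open>?P\<close> and \<open>?Q\<close> are the partial derivatives of the \<open>s\<close>-derivative, \<open>?P'\<close> and \<open>?Q'\<close> those of the
    \<open>\<theta>\<close>-derivative.\<close>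
  let ?P = "\<lambda>z. Fx z + of_real (Re z) * Fxx z + of_real (Im z) * Fyx z"
  let ?Q = "\<lambda>z. Fy z + of_real (Re z) * Fxy z + of_real (Im z) * Fyy z"
  let ?P' = "\<lambda>z. Fy z + of_real (Re z) * Fyx z - of_real (Im z) * Fxx z"
  let ?Q' = "\<lambda>z. of_real (Re z) * Fyy z - Fx z - of_real (Im z) * Fxy z"
  have 1: "(mode (ds Fx Fy) n has_vector_derivative mode (ds ?P ?Q) n s) (at s)"
    by (rule mode_ds[OF C1_on_ds_dx[OF F(2,3)] U s])
  have "ds ?P ?Q z = - 1 * d\<theta> ?P' ?Q' z" if "z \<in> open_annulus t" for z
  proof -
    have "Fyy z = - Fxx z" using harm[OF that] by (simp add: add_eq_0_iff)
    then show ?thesis unfolding ds_def d\<theta>_def by (simp add: algebra_simps)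
  qed
  then have "mode (ds ?P ?Q) n s = mode (\<lambda>z. - 1 * d\<theta> ?P' ?Q' z) n s"
    by (intro mode_cong) (use U[OF s] in blast)
  also have "\<dots> = - 1 * mode (d\<theta> ?P' ?Q') n s" unfolding mode_def by (rule fourier_coeff_cmult)
  also have "\<dots> = - 1 * (\<i> * of_int n * (\<i> * of_int n * mode F n s))"
    unfolding mode_d\<theta>[OF C1_on_d\<theta>_dx[OF F(2,3)] U[OF s]] mode_d\<theta>[OF F(1) U[OF s]] ..
  also have "\<dots> = of_int (n\<^sup>2) * mode F n s"
  proof -
    have "\<i> * x * (\<i> * x * y) = (\<i> * \<i>) * (x * x * y)" for x y :: complex by (simp only: mult_ac)
    then show ?thesis by (simp add: power2_eq_square)
  qed
  finally show "(mode (ds Fx Fy) n has_vector_derivative of_int (n\<^sup>2) * mode F n s) (at s)" using 1 by simp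
qed

text \<open>
  The pair \<open>G1\<close>, \<open>G2\<close> is the \<open>L\<^sup>2\<close> limit of the gradients of the approximations; it is not assumed to be
  the gradient of \<open>F\<close>. Parseval on almost every circle and \<open>mode_limit\<close> for every mode give the formula.
\<close>

theorem annulus_energy_fourier:
  fixes F Fx Fy Fxx Fxy Fyx Fyy G1 G2 :: "complex \<Rightarrow> complex" and u ux uy :: "nat \<Rightarrow> complex \<Rightarrow> complex"
  assumes t: "t > 1"
    and Fm: "F \<in> borel_measurable borel"
    and F: "C1_on (open_annulus t) F Fx Fy" "C1_on (open_annulus t) Fx Fxx Fxy" "C1_on (open_annulus t) Fy Fyx Fyy"
    and harm: "\<And>z. z \<in> open_annulus t \<Longrightarrow> Fxx z + Fyy z = 0"
    and G: "G1 \<in> borel_measurable borel" "G2 \<in> borel_measurable borel"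
    and fin: "(\<integral>\<^sup>+z. ennreal ((norm (G1 z))\<^sup>2 + (norm (G2 z))\<^sup>2) * indicator (open_annulus t) z \<partial>lborel) < \<infinity>"
    and u: "\<And>k. C1_on UNIV (u k) (ux k) (uy k)"
    and lim_F: "(\<lambda>k. \<integral>\<^sup>+z. ennreal ((norm (u k z - F z))\<^sup>2) * indicator (open_annulus t) z \<partial>lborel) \<longlonglongrightarrow> 0"
    and lim_G: "(\<lambda>k. \<integral>\<^sup>+z. ennreal ((norm (ux k z - G1 z))\<^sup>2 + (norm (uy k z - G2 z))\<^sup>2) * indicator (open_annulus t) z \<partial>lborel) \<longlonglongrightarrow> 0"
    and ab: "circle_L2 a" "circle_L2 b"
    and lim_a: "(\<lambda>k. \<integral>\<^sup>+\<theta>. ennreal ((norm (u k (logpolar 0 \<theta>) - a \<theta>))\<^sup>2) \<partial>circle_measure) \<longlonglongrightarrow> 0"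
    and lim_b: "(\<lambda>k. \<integral>\<^sup>+\<theta>. ennreal ((norm (u k (logpolar (ln t) \<theta>) - b \<theta>))\<^sup>2) \<partial>circle_measure) \<longlonglongrightarrow> 0"
  shows "(\<integral>\<^sup>+z. ennreal ((norm (G1 z))\<^sup>2 + (norm (G2 z))\<^sup>2) * indicator (open_annulus t) z \<partial>lborel) =
    (\<Sum>k. ennreal (2 * pi * mode_energy t (fourier_coeff a (int_decode k)) (fourier_coeff b (int_decode k)) (int_decode k)))"
proof -
  have cu: "continuous_on UNIV (u k)" "continuous_on UNIV (ux k)" "continuous_on UNIV (uy k)" for k
    using u[of k] C1_on_continuous[OF u] by (auto simp: C1_on_def)
  then have um: "u k \<in> borel_measurable borel" "ux k \<in> borel_measurable borel" "uy k \<in> borel_measurable borel" for k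
    by (auto intro: borel_measurable_continuous_onI)
  have cds: "continuous_on UNIV (ds (ux k) (uy k))" "continuous_on UNIV (d\<theta> (ux k) (uy k))" for k
    by (intro continuous_on_ds continuous_on_d\<theta> cu)+
  note mds = measurable_ds[OF um(2,3)] and mG = measurable_ds[OF G]
  have sq: "circle_L2 (\<lambda>\<theta>. w (logpolar s \<theta>))" if "continuous_on UNIV w" for w s
    by (rule circle_L2_section_continuous[OF borel_measurable_continuous_onI[OF that] that UNIV_I])
  have E: "(\<integral>\<^sup>+z. ennreal ((norm (G1 z))\<^sup>2 + (norm (G2 z))\<^sup>2) * indicator (open_annulus t) z \<partial>lborel)
      = (\<integral>\<^sup>+s. circle_energy (ds G1 G2) s + circle_energy (d\<theta> G1 G2) s \<partial>radial (ln t))"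
    by (rule nn_integral_annulus_energy[OF t G])
  note mE = measurable_radialI[OF measurable_circle_energy[OF mG(1)], of "ln t"]
    measurable_radialI[OF measurable_circle_energy[OF mG(2)], of "ln t"]
  have aeG: "AE s in radial (ln t). circle_energy (ds G1 G2) s < \<infinity> \<and> circle_energy (d\<theta> G1 G2) s < \<infinity>"
  proof -
    have "AE s in radial (ln t). circle_energy (ds G1 G2) s + circle_energy (d\<theta> G1 G2) s \<noteq> \<infinity>"
      by (rule nn_integral_PInf_AE) (use fin E mE in \<open>auto intro: borel_measurable_add\<close>)
    then show ?thesis by eventually_elim (auto simp: less_top)
  qed
  have aeF: "AE s in radial (ln t). circle_energy F s < \<infinity>"
  proof (rule AE_I2)
    fix s assume "s \<in> space (radial (ln t))"
    then have "logpolar s \<theta> \<in> open_annulus t" for \<theta> using t by (simp add: logpolar_in_open_annulus)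
    from circle_L2_section_continuous[OF Fm C1_on_continuous[OF F(1)] this]
    show "circle_energy F s < \<infinity>" by (simp only: circle_L2_section_iff[OF Fm])
  qed
  have mdiff: "(\<lambda>z. ux k z - G1 z) \<in> borel_measurable borel" "(\<lambda>z. uy k z - G2 z) \<in> borel_measurable borel" for k
    using um G by (auto intro: borel_measurable_diff)
  have total: "(\<lambda>k. \<integral>\<^sup>+s. circle_energy (ds (\<lambda>z. ux k z - G1 z) (\<lambda>z. uy k z - G2 z)) s
      + circle_energy (d\<theta> (\<lambda>z. ux k z - G1 z) (\<lambda>z. uy k z - G2 z)) s \<partial>radial (ln t)) \<longlonglongrightarrow> 0"
    using lim_G unfolding nn_integral_annulus_energy[OF t mdiff] .
  have lim_ds: "(\<lambda>k. \<integral>\<^sup>+s. circle_energy (\<lambda>z. ds (ux k) (uy k) z - ds G1 G2 z) s \<partial>radial (ln t)) \<longlonglongrightarrow> 0"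
  proof (rule tendsto_sandwich[OF always_eventually always_eventually tendsto_const total, OF allI allI, OF zero_le])
    fix k
    show "(\<integral>\<^sup>+s. circle_energy (\<lambda>z. ds (ux k) (uy k) z - ds G1 G2 z) s \<partial>radial (ln t)) \<le>
      (\<integral>\<^sup>+s. circle_energy (ds (\<lambda>z. ux k z - G1 z) (\<lambda>z. uy k z - G2 z)) s
      + circle_energy (d\<theta> (\<lambda>z. ux k z - G1 z) (\<lambda>z. uy k z - G2 z)) s \<partial>radial (ln t))"
      unfolding ds_diff by (intro nn_integral_mono) simp
  qed
  have lim_d\<theta>: "(\<lambda>k. \<integral>\<^sup>+s. circle_energy (\<lambda>z. d\<theta> (ux k) (uy k) z - d\<theta> G1 G2 z) s \<partial>radial (ln t)) \<longlonglongrightarrow> 0"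
  proof (rule tendsto_sandwich[OF always_eventually always_eventually tendsto_const total, OF allI allI, OF zero_le])
    fix k
    show "(\<integral>\<^sup>+s. circle_energy (\<lambda>z. d\<theta> (ux k) (uy k) z - d\<theta> G1 G2 z) s \<partial>radial (ln t)) \<le>
      (\<integral>\<^sup>+s. circle_energy (ds (\<lambda>z. ux k z - G1 z) (\<lambda>z. uy k z - G2 z)) s
      + circle_energy (d\<theta> (\<lambda>z. ux k z - G1 z) (\<lambda>z. uy k z - G2 z)) s \<partial>radial (ln t))"
      unfolding d\<theta>_diff by (intro nn_integral_mono) simp
  qed
  have lim_F': "(\<lambda>k. \<integral>\<^sup>+s. circle_energy (\<lambda>z. u k z - F z) s \<partial>radial (ln t)) \<longlonglongrightarrow> 0"
  proof (rule tendsto_sandwich[OF always_eventually always_eventually tendsto_const lim_F, OF allI allI, OF zero_le])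
    fix k
    have "(\<lambda>z. u k z - F z) \<in> borel_measurable borel" using um Fm by (auto intro: borel_measurable_diff)
    then show "(\<integral>\<^sup>+s. circle_energy (\<lambda>z. u k z - F z) s \<partial>radial (ln t)) \<le>
        (\<integral>\<^sup>+z. ennreal ((norm (u k z - F z))\<^sup>2) * indicator (open_annulus t) z \<partial>lborel)"
      by (rule nn_integral_circle_energy_le[OF t])
  qed
  have main: "(\<integral>\<^sup>+s. ennreal ((norm (mode (ds G1 G2) n s))\<^sup>2 + (norm (mode (d\<theta> G1 G2) n s))\<^sup>2) \<partial>radial (ln t)) =
      ennreal (mode_energy t (fourier_coeff a n) (fourier_coeff b n) n)" for n
  proof (rule mode_limit[OF t, where v = "\<lambda>k. mode (u k) n" and pv = "\<lambda>k. mode (ds (ux k) (uy k)) n" and V = "mode F n" and ?V1.0 = "mode (ds Fx Fy) n"])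
    show "(mode (u k) n has_vector_derivative mode (ds (ux k) (uy k)) n s) (at s)" for k s
      by (rule mode_ds[OF u, of "s - 1" "s + 1"]) auto
    show "continuous_on UNIV (mode (ds (ux k) (uy k)) n)" for k by (rule continuous_on_mode[OF cds(1)])
    show "mode (ds G1 G2) n \<in> borel_measurable (radial (ln t))" "mode (d\<theta> G1 G2) n \<in> borel_measurable (radial (ln t))"
      by (intro measurable_radialI measurable_mode mG)+
    have "(\<integral>\<^sup>+s. ennreal ((norm (mode (ds G1 G2) n s))\<^sup>2) \<partial>radial (ln t))
        \<le> (\<integral>\<^sup>+s. circle_energy (ds G1 G2) s + circle_energy (d\<theta> G1 G2) s \<partial>radial (ln t))"
      by (intro nn_integral_mono order_trans[OF norm_mode_le[OF mG(1)]]) simp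
    also have "\<dots> < \<infinity>" using fin by (simp only: E)
    finally show "(\<integral>\<^sup>+s. ennreal ((norm (mode (ds G1 G2) n s))\<^sup>2) \<partial>radial (ln t)) < \<infinity>" .
    show "(\<lambda>k. \<integral>\<^sup>+s. ennreal ((norm (mode (ds (ux k) (uy k)) n s - mode (ds G1 G2) n s))\<^sup>2) \<partial>radial (ln t)) \<longlonglongrightarrow> 0"
      by (rule mode_L2_limit[OF mds(1) mG(1) sq[OF cds(1)] _ lim_ds]) (use aeG in \<open>eventually_elim, simp\<close>)
    have "(\<lambda>k. \<integral>\<^sup>+s. ennreal ((norm (mode (d\<theta> (ux k) (uy k)) n s - mode (d\<theta> G1 G2) n s))\<^sup>2) \<partial>radial (ln t)) \<longlonglongrightarrow> 0"
      by (rule mode_L2_limit[OF mds(2) mG(2) sq[OF cds(2)] _ lim_d\<theta>]) (use aeG in \<open>eventually_elim, simp\<close>)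
    then show "(\<lambda>k. \<integral>\<^sup>+s. ennreal ((norm (\<i> * of_int n * mode (u k) n s - mode (d\<theta> G1 G2) n s))\<^sup>2) \<partial>radial (ln t)) \<longlonglongrightarrow> 0"
      by (simp only: mode_d\<theta>[OF u UNIV_I])
    show "(\<lambda>k. \<integral>\<^sup>+s. ennreal ((norm (mode (u k) n s - mode F n s))\<^sup>2) \<partial>radial (ln t)) \<longlonglongrightarrow> 0"
      by (rule mode_L2_limit[OF um(1) Fm sq[OF cu(1)] aeF lim_F'])
    show "(\<lambda>k. mode (u k) n 0) \<longlonglongrightarrow> fourier_coeff a n" unfolding mode_def
      by (rule fourier_coeff_tendsto[OF sq[OF cu(1)] ab(1) lim_a])
    show "(\<lambda>k. mode (u k) n (ln t)) \<longlonglongrightarrow> fourier_coeff b n" unfolding mode_def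
      by (rule fourier_coeff_tendsto[OF sq[OF cu(1)] ab(2) lim_b])
    show "(mode F n has_vector_derivative mode (ds Fx Fy) n s) (at s)" if "s \<in> {0<..<ln t}" for s
      by (rule mode_harmonic(1)[OF F harm t that])
    show "(mode (ds Fx Fy) n has_vector_derivative of_int (n\<^sup>2) * mode F n s) (at s)" if "s \<in> {0<..<ln t}" for s
      by (rule mode_harmonic(2)[OF F harm t that])
  qed
  let ?e = "\<lambda>k s. ennreal ((norm (mode (ds G1 G2) (int_decode k) s))\<^sup>2 + (norm (mode (d\<theta> G1 G2) (int_decode k) s))\<^sup>2)"
  have em: "?e k \<in> borel_measurable (radial (ln t))" for k
    using measurable_radialI[OF measurable_mode[OF mG(1), of "int_decode k"], of "ln t"]
      measurable_radialI[OF measurable_mode[OF mG(2), of "int_decode k"], of "ln t"] by measurable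
  have "(\<integral>\<^sup>+s. circle_energy (ds G1 G2) s + circle_energy (d\<theta> G1 G2) s \<partial>radial (ln t))
      = (\<integral>\<^sup>+s. (\<Sum>k. ennreal (2 * pi) * ?e k s) \<partial>radial (ln t))"
    using aeG
  proof (intro nn_integral_cong_AE, eventually_elim)
    case (elim s)
    then have sG: "circle_L2 (\<lambda>\<theta>. ds G1 G2 (logpolar s \<theta>))" "circle_L2 (\<lambda>\<theta>. d\<theta> G1 G2 (logpolar s \<theta>))"
      by (simp_all only: circle_L2_section_iff[OF mG(1)] circle_L2_section_iff[OF mG(2)])
    have "circle_energy (ds G1 G2) s = (\<Sum>k. ennreal (2 * pi * (norm (mode (ds G1 G2) (int_decode k) s))\<^sup>2))"
      "circle_energy (d\<theta> G1 G2) s = (\<Sum>k. ennreal (2 * pi * (norm (mode (d\<theta> G1 G2) (int_decode k) s))\<^sup>2))"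
      unfolding circle_energy_def mode_def by (rule parseval_nn_integral[OF sG(1)], rule parseval_nn_integral[OF sG(2)])
    then have "circle_energy (ds G1 G2) s + circle_energy (d\<theta> G1 G2) s =
      (\<Sum>k. ennreal (2 * pi * (norm (mode (ds G1 G2) (int_decode k) s))\<^sup>2) + ennreal (2 * pi * (norm (mode (d\<theta> G1 G2) (int_decode k) s))\<^sup>2))"
      by (simp only:) (rule suminf_add; simp)
    also have "\<dots> = (\<Sum>k. ennreal (2 * pi) * ?e k s)"
      by (intro suminf_cong) (simp add: distrib_left flip: ennreal_plus ennreal_mult)
    finally show ?case .
  qed
  also have "\<dots> = (\<Sum>k. \<integral>\<^sup>+s. ennreal (2 * pi) * ?e k s \<partial>radial (ln t))"
    by (rule nn_integral_suminf, rule borel_measurable_times_ennreal[OF measurable_const em], simp)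
  also have "\<dots> = (\<Sum>k. ennreal (2 * pi) * (\<integral>\<^sup>+s. ?e k s \<partial>radial (ln t)))"
    by (rule suminf_cong, rule nn_integral_cmult[OF em])
  also have "\<dots> = (\<Sum>k. ennreal (2 * pi * mode_energy t (fourier_coeff a (int_decode k)) (fourier_coeff b (int_decode k)) (int_decode k)))"
    unfolding main by (simp add: ennreal_mult')
  finally show ?thesis unfolding E .
qed

lemma mode_energy_nonneg:
  assumes t: "t > 1"
  shows "0 \<le> mode_energy t \<alpha> \<beta> n"
proof (cases "n = 0")
  case False
  define T where "T = t ^ nat \<bar>n\<bar>"
  have T: "T > 1" unfolding T_def using t False by (intro one_less_power) auto
  define R where "R = Re (\<alpha> * cnj \<beta>)"
  have "R \<le> norm \<alpha> * norm \<beta>"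
    using complex_Re_le_cmod[of "\<alpha> * cnj \<beta>"] by (simp add: norm_mult R_def)
  moreover have "2 * (norm \<alpha> * norm \<beta>) \<le> (norm \<alpha>)\<^sup>2 + (norm \<beta>)\<^sup>2"
    using zero_le_power2[of "norm \<alpha> - norm \<beta>"] by (simp add: power2_diff)
  ultimately have "2 * R \<le> (norm \<alpha>)\<^sup>2 + (norm \<beta>)\<^sup>2" by linarith
  then have "(2 * T) * (2 * R) \<le> (2 * T) * ((norm \<alpha>)\<^sup>2 + (norm \<beta>)\<^sup>2)"
    using T by (intro mult_left_mono) auto
  also have "\<dots> \<le> (T\<^sup>2 + 1) * ((norm \<alpha>)\<^sup>2 + (norm \<beta>)\<^sup>2)"
    using zero_le_power2[of "T - 1"] by (intro mult_right_mono) (auto simp: power2_diff)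
  finally have "0 \<le> (T\<^sup>2 + 1) * ((norm \<alpha>)\<^sup>2 + (norm \<beta>)\<^sup>2) - 4 * T * Re (\<alpha> * cnj \<beta>)"
    unfolding R_def by linarith
  then show ?thesis using False T unfolding mode_energy_def Let_def T_def[symmetric]
    by (auto intro!: mult_nonneg_nonneg divide_nonneg_nonneg simp: one_le_power)
qed (use t in \<open>simp add: mode_energy_def\<close>)

section \<open>Vector-valued functions and Lebesgue measurability\<close>

lemma measurable_lebesgue_onI:
  fixes f :: "'a::euclidean_space \<Rightarrow> 'b::topological_space"
  assumes "f \<in> borel_measurable borel"
  shows "f \<in> borel_measurable (lebesgue_on S)"
  by (rule measurable_restrict_space1[OF measurable_completion]) (use assms in simp)

text \<open>
  Lebesgue measurable functions are replaced by Borel functions, for which Fubini's theorem and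
  composition with the logarithmic polar coordinates are available.
\<close>

lemma borel_representative:
  fixes f :: "'a::euclidean_space \<Rightarrow> real"
  assumes S: "S \<in> sets borel" and f: "f \<in> borel_measurable (lebesgue_on S)"
  obtains g where "g \<in> borel_measurable borel" "AE x in lebesgue. x \<in> S \<longrightarrow> f x = g x"
proof -
  have "(\<lambda>x. indicator S x *\<^sub>R f x) \<in> borel_measurable lebesgue"
    using f S by (subst (asm) borel_measurable_restrict_space_iff) auto
  then obtain g where g: "g \<in> borel_measurable lborel" "AE x in lborel. indicator S x *\<^sub>R f x = g x"
    using completion_ex_borel_measurable_real by blast
  have "AE x in lebesgue. indicator S x *\<^sub>R f x = g x" by (rule AE_completion[OF g(2)])
  then have "AE x in lebesgue. x \<in> S \<longrightarrow> f x = g x" by eventually_elim (auto simp: indicator_def)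
  then show thesis using g(1) by (intro that) auto
qed

lemma nn_integral_lborel_eq_lebesgue_on:
  fixes h :: "'a::euclidean_space \<Rightarrow> real" and w :: "'a \<Rightarrow> ennreal"
  assumes S: "S \<in> sets borel" and h: "integrable (lebesgue_on S) h" "\<And>x. 0 \<le> h x"
    and w: "w \<in> borel_measurable borel"
  shows "(AE x in lebesgue. x \<in> S \<longrightarrow> w x \<le> ennreal (h x)) \<Longrightarrow>
      (\<integral>\<^sup>+x. w x * indicator S x \<partial>lborel) \<le> ennreal (LINT x|lebesgue_on S. h x)"
    and "(AE x in lebesgue. x \<in> S \<longrightarrow> w x = ennreal (h x)) \<Longrightarrow>
      (\<integral>\<^sup>+x. w x * indicator S x \<partial>lborel) = ennreal (LINT x|lebesgue_on S. h x)"
proof -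
  have "ennreal (LINT x|lebesgue_on S. h x) = (\<integral>\<^sup>+x. ennreal (h x) \<partial>lebesgue_on S)"
    using h by (intro nn_integral_eq_integral[symmetric]) auto
  also have "\<dots> = (\<integral>\<^sup>+x. ennreal (h x) * indicator S x \<partial>lebesgue)"
    using S by (subst nn_integral_restrict_space) auto
  finally have e: "ennreal (LINT x|lebesgue_on S. h x) = (\<integral>\<^sup>+x. ennreal (h x) * indicator S x \<partial>lebesgue)" .
  have l: "(\<integral>\<^sup>+x. w x * indicator S x \<partial>lborel) = (\<integral>\<^sup>+x. w x * indicator S x \<partial>lebesgue)"
    by (rule nn_integral_completion[symmetric])
  show "(\<integral>\<^sup>+x. w x * indicator S x \<partial>lborel) \<le> ennreal (LINT x|lebesgue_on S. h x)"
    if "AE x in lebesgue. x \<in> S \<longrightarrow> w x \<le> ennreal (h x)"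
    unfolding e l using that by (intro nn_integral_mono_AE, eventually_elim) (auto simp: indicator_def)
  show "(\<integral>\<^sup>+x. w x * indicator S x \<partial>lborel) = ennreal (LINT x|lebesgue_on S. h x)"
    if "AE x in lebesgue. x \<in> S \<longrightarrow> w x = ennreal (h x)"
    unfolding e l using that by (intro nn_integral_cong_AE, eventually_elim) (auto simp: indicator_def)
qed

lemma L2_on_diff:
  assumes "L2_on S f" "L2_on S g"
  shows "L2_on S (\<lambda>x. f x - g x)"
proof -
  have m: "f \<in> borel_measurable (lebesgue_on S)" "g \<in> borel_measurable (lebesgue_on S)"
    using assms by (auto simp: L2_on_def)
  have "integrable (lebesgue_on S) (\<lambda>x. (norm (f x - g x))\<^sup>2)"
  proof (rule Bochner_Integration.integrable_bound[where f = "\<lambda>x. 2 * (norm (f x))\<^sup>2 + 2 * (norm (g x))\<^sup>2"])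
    show "integrable (lebesgue_on S) (\<lambda>x. 2 * (norm (f x))\<^sup>2 + 2 * (norm (g x))\<^sup>2)"
      using assms by (auto simp: L2_on_def)
    show "(\<lambda>x. (norm (f x - g x))\<^sup>2) \<in> borel_measurable (lebesgue_on S)" using m by measurable
    have "(norm (f x - g x))\<^sup>2 \<le> 2 * (norm (f x))\<^sup>2 + 2 * (norm (g x))\<^sup>2" for x
      using norm_add_sq_le[of "f x" "- g x"] by simp
    then show "AE x in lebesgue_on S. norm ((norm (f x - g x))\<^sup>2) \<le> norm (2 * (norm (f x))\<^sup>2 + 2 * (norm (g x))\<^sup>2)"
      by (intro AE_I2) simp
  qed
  then show ?thesis using m by (simp add: L2_on_def)
qed

lemma L2_on_continuous:
  fixes f :: "'a::euclidean_space \<Rightarrow> 'b::euclidean_space"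
  assumes c: "continuous_on K f" and K: "compact K" and S: "S \<subseteq> K" "S \<in> lmeasurable"
  shows "L2_on S f"
proof -
  interpret finite_measure "lebesgue_on S" by (rule finite_measure_lebesgue_on[OF S(2)])
  have m: "f \<in> borel_measurable (lebesgue_on S)"
    using continuous_on_subset[OF c S(1)] S(2) by (intro continuous_imp_measurable_on_sets_lebesgue) auto
  have "bounded (f ` K)" by (intro compact_imp_bounded compact_continuous_image c K)
  then obtain B where B: "\<And>x. x \<in> K \<Longrightarrow> norm (f x) \<le> B" unfolding bounded_iff by blast
  have "integrable (lebesgue_on S) (\<lambda>x. (norm (f x))\<^sup>2)"
  proof (rule integrable_const_bound[where B = "B\<^sup>2"])
    show "AE x in lebesgue_on S. norm ((norm (f x))\<^sup>2) \<le> B\<^sup>2"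
      using B S(1) by (intro AE_I2) (auto simp: space_restrict_space intro!: power_mono)
  qed (use m in measurable)
  then show ?thesis using m by (simp add: L2_on_def)
qed

lemma norm_vec_sq: "(norm (x :: 'a::real_normed_vector ^ 'm))\<^sup>2 = (\<Sum>j\<in>UNIV. (norm (x $ j))\<^sup>2)"
  by (simp add: norm_vec_def L2_set_def sum_nonneg)

lemma L2_on_component:
  fixes f :: "'a::euclidean_space \<Rightarrow> real ^ 'm::finite"
  assumes "L2_on S f"
  shows "L2_on S (\<lambda>x. f x $ j)"
proof -
  have m: "f \<in> borel_measurable (lebesgue_on S)" using assms by (simp add: L2_on_def)
  have "(\<lambda>x :: real ^ 'm. x $ j) \<in> borel_measurable borel"
    by (intro borel_measurable_continuous_onI continuous_intros)
  from measurable_compose[OF m this] have mj: "(\<lambda>x. f x $ j) \<in> borel_measurable (lebesgue_on S)" .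
  have "integrable (lebesgue_on S) (\<lambda>x. (norm (f x $ j))\<^sup>2)"
  proof (rule Bochner_Integration.integrable_bound[where f = "\<lambda>x. (norm (f x))\<^sup>2"])
    show "integrable (lebesgue_on S) (\<lambda>x. (norm (f x))\<^sup>2)" using assms by (simp add: L2_on_def)
    show "(\<lambda>x. (norm (f x $ j))\<^sup>2) \<in> borel_measurable (lebesgue_on S)" using mj by measurable
    have "(norm (f x $ j))\<^sup>2 \<le> (norm (f x))\<^sup>2" for x
      by (intro power_mono Finite_Cartesian_Product.norm_nth_le norm_ge_zero)
    then show "AE x in lebesgue_on S. norm ((norm (f x $ j))\<^sup>2) \<le> norm ((norm (f x))\<^sup>2)"
      by (intro AE_I2) simp
  qed
  then show ?thesis using mj by (simp add: L2_on_def)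
qed

lemma circle_borel: "{0..2*pi} \<in> sets (borel :: real measure)" by simp

lemma nn_integral_circ:
  "w \<in> borel_measurable borel \<Longrightarrow> (\<integral>\<^sup>+x. w x \<partial>circle_measure) = (\<integral>\<^sup>+x. w x * indicator {0..2*pi} x \<partial>lborel)"
  unfolding circle_measure_def by (subst nn_integral_restrict_space) auto

lemma circ_representative:
  fixes f :: "real \<Rightarrow> real"
  assumes f: "L2_on {0..2*pi} f"
  obtains g where "g \<in> borel_measurable borel" "AE x in lebesgue. x \<in> {0..2*pi} \<longrightarrow> f x = g x"
    "circle_L2 (\<lambda>x. complex_of_real (g x))" "(LINT x|circle_measure. (g x)\<^sup>2) = (LINT x|lebesgue_on {0..2*pi}. (f x)\<^sup>2)"
proof -
  have fm: "f \<in> borel_measurable (lebesgue_on {0..2*pi})" and fi: "integrable (lebesgue_on {0..2*pi}) (\<lambda>x. (f x)\<^sup>2)"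
    using f by (auto simp: L2_on_def)
  obtain g where g: "g \<in> borel_measurable borel" "AE x in lebesgue. x \<in> {0..2*pi} \<longrightarrow> f x = g x"
    using borel_representative[OF circle_borel fm] .
  have gm: "(\<lambda>x. complex_of_real (g x)) \<in> borel_measurable borel" using g(1) by measurable
  have "(\<integral>\<^sup>+x. ennreal ((norm (complex_of_real (g x)))\<^sup>2) \<partial>circle_measure) = (\<integral>\<^sup>+x. ennreal ((g x)\<^sup>2) * indicator {0..2*pi} x \<partial>lborel)"
    using g(1) by (subst nn_integral_circ) auto
  also have "\<dots> = ennreal (LINT x|lebesgue_on {0..2*pi}. (f x)\<^sup>2)"
  proof (rule nn_integral_lborel_eq_lebesgue_on(2)[OF circle_borel fi])
    show "AE x in lebesgue. x \<in> {0..2*pi} \<longrightarrow> ennreal ((g x)\<^sup>2) = ennreal ((f x)\<^sup>2)"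
      using g(2) by eventually_elim auto
  qed (use g(1) in auto)
  finally have e: "(\<integral>\<^sup>+x. ennreal ((norm (complex_of_real (g x)))\<^sup>2) \<partial>circle_measure) = ennreal (LINT x|lebesgue_on {0..2*pi}. (f x)\<^sup>2)" .
  then have sq: "circle_L2 (\<lambda>x. complex_of_real (g x))"
    unfolding circle_L2_iff_nn using measurable_circI[OF gm] by simp
  have "ennreal (LINT x|circle_measure. (g x)\<^sup>2) = ennreal (LINT x|lebesgue_on {0..2*pi}. (f x)\<^sup>2)"
    using e nn_integral_norm_sq[OF sq] by simp
  then have "(LINT x|circle_measure. (g x)\<^sup>2) = (LINT x|lebesgue_on {0..2*pi}. (f x)\<^sup>2)"
    by (subst (asm) ennreal_inj) (auto intro!: integral_nonneg_AE)
  then show thesis using that g sq by blast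
qed

lemma L2_on_circle_integrable:
  fixes f :: "real \<Rightarrow> real ^ 'm::finite"
  assumes "L2_on {0..2*pi} f"
  shows "integrable (lebesgue_on {0..2*pi}) f"
proof -
  interpret finite_measure "lebesgue_on {0..2*pi}"
    using finite_measure_lebesgue_on[of "{0..2*pi}"] lmeasurable_cbox[of 0 "2*pi"] by (simp only: cbox_interval)
  have m: "f \<in> borel_measurable (lebesgue_on {0..2*pi})" and i: "integrable (lebesgue_on {0..2*pi}) (\<lambda>x. (norm (f x))\<^sup>2)"
    using assms by (auto simp: L2_on_def)
  have "integrable (lebesgue_on {0..2*pi}) (\<lambda>x. norm (f x))"
    by (rule square_integrable_imp_integrable[OF _ i]) (use m in measurable)
  then show ?thesis using m by (simp only: integrable_norm_iff)
qed

text \<open>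
  A component of the distributional coefficient, a pairing with cosine and sine against Lebesgue
  measure, is the Fourier integral of any Borel representative of that component.
\<close>

lemma fourier_distr_of:
  fixes g :: "complex \<Rightarrow> real ^ 'm::finite"
  assumes g: "L2_on {0..2*pi} (\<lambda>\<theta>. g (cis \<theta>))" and h: "h \<in> borel_measurable borel"
    and ae: "AE \<theta> in lebesgue. \<theta> \<in> {0..2*pi} \<longrightarrow> g (cis \<theta>) $ j = h \<theta>"
  shows "fourier (distr_of g) n $ j = fourier_coeff (\<lambda>\<theta>. complex_of_real (h \<theta>)) n"
proof -
  have i: "integrable (lebesgue_on {0..2*pi}) (\<lambda>\<theta>. g (cis \<theta>))" by (rule L2_on_circle_integrable[OF g])
  have hi: "integrable circle_measure (\<lambda>\<theta>. complex_of_real (h \<theta>))"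
  proof -
    obtain h' where h': "h' \<in> borel_measurable borel" "AE x in lebesgue. x \<in> {0..2*pi} \<longrightarrow> g (cis x) $ j = h' x"
      "circle_L2 (\<lambda>x. complex_of_real (h' x))"
      using circ_representative[OF L2_on_component[OF g, of j]] by blast
    have "AE x in lebesgue. x \<in> {0..2*pi} \<longrightarrow> h x = h' x" using ae h'(2) by eventually_elim auto
    then have "AE x in circle_measure. h x = h' x" unfolding AE_circ by (simp add: AE_completion_iff)
    then have "integrable circle_measure (\<lambda>\<theta>. complex_of_real (h \<theta>)) \<longleftrightarrow> integrable circle_measure (\<lambda>\<theta>. complex_of_real (h' \<theta>))"
      using h h'(1) by (intro integrable_cong_AE measurable_circI) (auto elim: eventually_mono)
    then show ?thesis using circle_L2_integrable[OF h'(3)] by simp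
  qed
  have pair: "distr_pairing (distr_of g) \<phi> $ j = (LINT \<theta>|circle_measure. Rep_circle_test \<phi> \<theta> * h \<theta>)"
    if r: "continuous_on UNIV (Rep_circle_test \<phi>)" and bd: "\<And>x. \<bar>Rep_circle_test \<phi> x\<bar> \<le> 1" for \<phi>
  proof -
    let ?r = "Rep_circle_test \<phi>"
    have rm: "?r \<in> borel_measurable borel" using r by (rule borel_measurable_continuous_onI)
    have rl: "?r \<in> borel_measurable (lebesgue_on {0..2*pi})"
      by (rule measurable_lebesgue_onI[OF rm])
    have ig: "integrable (lebesgue_on {0..2*pi}) (\<lambda>\<theta>. ?r \<theta> *\<^sub>R g (cis \<theta>))"
    proof (rule Bochner_Integration.integrable_bound[OF i])
      show "(\<lambda>\<theta>. ?r \<theta> *\<^sub>R g (cis \<theta>)) \<in> borel_measurable (lebesgue_on {0..2*pi})"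
        using rl i by (intro borel_measurable_scaleR) auto
    qed (use bd in \<open>auto intro!: AE_I2 mult_left_le_one_le\<close>)
    have "distr_pairing (distr_of g) \<phi> $ j = (LINT \<theta>|lebesgue_on {0..2*pi}. ?r \<theta> *\<^sub>R g (cis \<theta>)) $ j"
      using i by (simp add: distr_of.rep_eq)
    also have "\<dots> = (LINT \<theta>|lebesgue_on {0..2*pi}. (?r \<theta> *\<^sub>R g (cis \<theta>)) $ j)"
      by (rule integral_bounded_linear[OF bounded_linear_vec_nth ig, symmetric])
    also have "\<dots> = (LINT \<theta>|lebesgue. indicator {0..2*pi} \<theta> *\<^sub>R (?r \<theta> * g (cis \<theta>) $ j))"
      by (subst integral_restrict_space) auto
    also have "\<dots> = (LINT \<theta>|lebesgue. indicator {0..2*pi} \<theta> *\<^sub>R (?r \<theta> * h \<theta>))"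
    proof (rule integral_cong_AE)
      have "integrable (lebesgue_on {0..2*pi}) (\<lambda>\<theta>. (?r \<theta> *\<^sub>R g (cis \<theta>)) $ j)"
        by (rule integrable_bounded_linear[OF bounded_linear_vec_nth ig])
      then have "(\<lambda>\<theta>. ?r \<theta> * g (cis \<theta>) $ j) \<in> borel_measurable (lebesgue_on {0..2*pi})" by auto
      then show "(\<lambda>\<theta>. indicator {0..2*pi} \<theta> *\<^sub>R (?r \<theta> * g (cis \<theta>) $ j)) \<in> borel_measurable lebesgue"
        by (subst (asm) borel_measurable_restrict_space_iff) auto
      show "(\<lambda>\<theta>. indicator {0..2*pi} \<theta> *\<^sub>R (?r \<theta> * h \<theta>)) \<in> borel_measurable lebesgue"
        by (rule measurable_completion) (use rm h in simp)
    qed (use ae in \<open>eventually_elim, auto simp: indicator_def\<close>)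
    also have "\<dots> = (LINT \<theta>|lborel. indicator {0..2*pi} \<theta> *\<^sub>R (?r \<theta> * h \<theta>))"
      by (rule integral_completion) (use rm h in simp)
    also have "\<dots> = (LINT \<theta>|circle_measure. ?r \<theta> * h \<theta>)" by (rule integral_circ[symmetric])
    finally show ?thesis .
  qed
  have c: "distr_pairing (distr_of g) (cos_test n) $ j = (LINT \<theta>|circle_measure. cos (of_int n * \<theta>) * h \<theta>)"
    and s: "distr_pairing (distr_of g) (sin_test n) $ j = (LINT \<theta>|circle_measure. sin (of_int n * \<theta>) * h \<theta>)"
    by (subst pair; simp add: cos_test.rep_eq sin_test.rep_eq continuous_intros)+
  have ihc: "integrable circle_measure (\<lambda>\<theta>. complex_of_real (h \<theta>) * cis (- of_int n * \<theta>))" by (rule integrable_fourier_coeff[OF hi])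
  have re: "(\<lambda>\<theta>. Re (complex_of_real (h \<theta>) * cis (- of_int n * \<theta>))) = (\<lambda>\<theta>. cos (of_int n * \<theta>) * h \<theta>)"
    and im: "(\<lambda>\<theta>. Im (complex_of_real (h \<theta>) * cis (- of_int n * \<theta>))) = (\<lambda>\<theta>. - (sin (of_int n * \<theta>) * h \<theta>))"
    by (simp_all add: mult.commute)
  let ?I = "LINT \<theta>|circle_measure. complex_of_real (h \<theta>) * cis (- of_int n * \<theta>)"
  have "Re ?I = (LINT \<theta>|circle_measure. cos (of_int n * \<theta>) * h \<theta>)"
    using integral_Re[OF ihc] unfolding re by simp
  moreover have "Im ?I = - (LINT \<theta>|circle_measure. sin (of_int n * \<theta>) * h \<theta>)"
    using integral_Im[OF ihc] unfolding im by simp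
  ultimately have "?I = of_real (LINT \<theta>|circle_measure. cos (of_int n * \<theta>) * h \<theta>) - \<i> * of_real (LINT \<theta>|circle_measure. sin (of_int n * \<theta>) * h \<theta>)"
    by (simp add: complex_eq_iff)
  then show ?thesis unfolding fourier_def fourier_coeff_def by (simp add: c s)
qed

lemma has_sum_finite_sum:
  fixes f :: "'i \<Rightarrow> 'a \<Rightarrow> real"
  assumes "finite I" "\<And>i. i \<in> I \<Longrightarrow> (f i has_sum s i) A"
  shows "((\<lambda>x. \<Sum>i\<in>I. f i x) has_sum (\<Sum>i\<in>I. s i)) A"
  using assms by (induction I rule: finite_induct) (auto intro: has_sum_add)

lemma parseval_vec:
  fixes g :: "complex \<Rightarrow> real ^ 'm::finite"
  assumes g: "L2_on {0..2*pi} (\<lambda>\<theta>. g (cis \<theta>))"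
  shows "((\<lambda>n. 2 * pi * (norm (fourier (distr_of g) n))\<^sup>2) has_sum (circle_L2_norm g)\<^sup>2) UNIV"
proof -
  have comp: "((\<lambda>n. 2 * pi * (norm (fourier (distr_of g) n $ j))\<^sup>2) has_sum (LINT \<theta>|lebesgue_on {0..2*pi}. (g (cis \<theta>) $ j)\<^sup>2)) UNIV" for j
  proof -
    obtain h where h: "h \<in> borel_measurable borel" "AE x in lebesgue. x \<in> {0..2*pi} \<longrightarrow> g (cis x) $ j = h x"
      "circle_L2 (\<lambda>x. complex_of_real (h x))" "(LINT x|circle_measure. (h x)\<^sup>2) = (LINT x|lebesgue_on {0..2*pi}. (g (cis x) $ j)\<^sup>2)"
      using circ_representative[OF L2_on_component[OF g, of j]] by blast
    show ?thesis using parseval[OF h(3)] unfolding fourier_distr_of[OF g h(1,2)] by (simp add: h(4))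
  qed
  have "((\<lambda>n. \<Sum>j\<in>UNIV. 2 * pi * (norm (fourier (distr_of g) n $ j))\<^sup>2) has_sum (\<Sum>j\<in>UNIV. LINT \<theta>|lebesgue_on {0..2*pi}. (g (cis \<theta>) $ j)\<^sup>2)) UNIV"
    by (rule has_sum_finite_sum) (use comp in auto)
  moreover have "(\<Sum>j\<in>UNIV. LINT \<theta>|lebesgue_on {0..2*pi}. (g (cis \<theta>) $ j)\<^sup>2) = (LINT \<theta>|lebesgue_on {0..2*pi}. (norm (g (cis \<theta>)))\<^sup>2)"
    unfolding norm_vec_sq using L2_on_component[OF g]
    by (subst Bochner_Integration.integral_sum) (auto simp: L2_on_def)
  moreover have "(LINT \<theta>|lebesgue_on {0..2*pi}. (norm (g (cis \<theta>)))\<^sup>2) = (circle_L2_norm g)\<^sup>2"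
    unfolding circle_L2_norm_def by (subst real_sqrt_pow2) (auto intro!: integral_nonneg_AE)
  ultimately show ?thesis by (simp add: norm_vec_sq sum_distrib_left)
qed

text \<open>
  The distributions are real-valued.
\<close>

lemma fourier_minus: "fourier (T :: 'm::finite circle_distr) (- n) = vcnj (fourier T n)"
proof -
  have c: "cos_test (- n) = cos_test n"
    by (rule Rep_circle_test_inject[THEN iffD1]) (simp add: cos_test.rep_eq fun_eq_iff)
  have "sin_test (- n) = (- 1) *\<^sub>R sin_test n"
    by (rule Rep_circle_test_inject[THEN iffD1]) (simp add: sin_test.rep_eq scaleR_circle_test.rep_eq uminus_circle_test.rep_eq fun_eq_iff)
  then have s: "distr_pairing T (sin_test (- n)) = - distr_pairing T (sin_test n)"
    by (simp only: distr_pairing_scaleR) simp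
  show ?thesis unfolding fourier_def vcnj_def by (simp add: vec_eq_iff c s)
qed

text \<open>
  Riesz-Fischer provides complex functions with the prescribed coefficients. Since the coefficients at
  \<open>n\<close> and \<open>- n\<close> are conjugate, the real parts have the same coefficients.
\<close>

lemma ex_quarter_laplacian:
  fixes a :: "complex \<Rightarrow> real ^ 'm::finite"
  assumes a: "a \<in> H_half"
  shows "\<exists>g. L2_on {0..2*pi} (\<lambda>\<theta>. g (cis \<theta>)) \<and>
     (\<forall>n. fourier (distr_of g) n = sqrt \<bar>of_int n\<bar> *\<^sub>R fourier (distr_of a) n)"
proof -
  let ?A = "fourier (distr_of a)"
  have "\<exists>h. h \<in> borel_measurable circle_measure \<and> (\<forall>n. fourier_coeff (\<lambda>\<theta>. complex_of_real (h \<theta>)) n = of_real (sqrt \<bar>of_int n\<bar>) * ?A n $ j) \<and> circle_L2 (\<lambda>\<theta>. complex_of_real (h \<theta>))" for j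
  proof -
    have "(\<lambda>n::int. \<bar>of_int n\<bar> * (norm (?A n))\<^sup>2) summable_on UNIV" using a by (simp add: H_half_def)
    then have "(\<lambda>n. (norm (of_real (sqrt \<bar>of_int n\<bar>) * ?A n $ j))\<^sup>2) summable_on UNIV"
    proof (rule summable_on_comparison_test)
      fix n :: int
      have "(norm (?A n $ j))\<^sup>2 \<le> (norm (?A n))\<^sup>2" by (intro power_mono Finite_Cartesian_Product.norm_nth_le norm_ge_zero)
      then show "(norm (of_real (sqrt \<bar>of_int n\<bar>) * ?A n $ j))\<^sup>2 \<le> \<bar>of_int n\<bar> * (norm (?A n))\<^sup>2"
        by (simp add: norm_mult power_mult_distrib mult_left_mono)
    qed simp
    then obtain g where g: "circle_L2 g" "\<And>n. fourier_coeff g n = of_real (sqrt \<bar>of_int n\<bar>) * ?A n $ j"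
      using riesz_fischer[of "\<lambda>n. of_real (sqrt \<bar>of_int n\<bar>) * ?A n $ j"] by metis
    have "cnj \<in> borel_measurable borel" by (intro borel_measurable_continuous_onI continuous_intros)
    then have gc: "circle_L2 (\<lambda>\<theta>. cnj (g \<theta>))"
      using g(1) measurable_compose[of g circle_measure borel cnj borel] by (simp add: circle_L2_def)
    have e: "(\<lambda>\<theta>. complex_of_real (Re (g \<theta>))) = (\<lambda>\<theta>. (1/2) * (g \<theta> + cnj (g \<theta>)))"
      by (simp add: complex_add_cnj)
    have "fourier_coeff (\<lambda>\<theta>. complex_of_real (Re (g \<theta>))) n = (1/2) * (fourier_coeff g n + cnj (fourier_coeff g (- n)))" for n
      unfolding e fourier_coeff_cmult fourier_coeff_add[OF circle_L2_integrable[OF g(1)] circle_L2_integrable[OF gc]] fourier_coeff_cnj ..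
    then have "fourier_coeff (\<lambda>\<theta>. complex_of_real (Re (g \<theta>))) n = of_real (sqrt \<bar>of_int n\<bar>) * ?A n $ j" for n
      by (simp add: g(2) fourier_minus vcnj_def)
    moreover have "circle_L2 (\<lambda>\<theta>. complex_of_real (Re (g \<theta>)))"
      unfolding e by (intro circle_L2_cmult circle_L2_add g(1) gc)
    ultimately show ?thesis using g(1) by (intro exI[of _ "\<lambda>\<theta>. Re (g \<theta>)"]) (auto simp: circle_L2_def)
  qed
  then obtain h where h: "\<And>j. h j \<in> borel_measurable circle_measure"
    "\<And>j n. fourier_coeff (\<lambda>\<theta>. complex_of_real (h j \<theta>)) n = of_real (sqrt \<bar>of_int n\<bar>) * ?A n $ j"
    "\<And>j. circle_L2 (\<lambda>\<theta>. complex_of_real (h j \<theta>))"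
    by metis
  define k where "k = (\<lambda>j \<theta>. indicator {0..2*pi} \<theta> *\<^sub>R h j \<theta>)"
  have k: "k j \<in> borel_measurable borel" for j
    using h(1)[of j] unfolding k_def circle_measure_def by (subst (asm) borel_measurable_restrict_space_iff) auto
  \<comment> \<open>A function of the angle becomes a function on the plane by composition with the argument in
    \<open>[0, 2 \<pi>)\<close>; only the angle \<open>2 \<pi>\<close> is not recovered.\<close>
  define g :: "complex \<Rightarrow> real ^ 'm" where "g = (\<lambda>z. \<chi> j. k j (Arg2pi z))"
  have arg: "Arg2pi (cis \<theta>) = \<theta>" if "\<theta> \<in> {0..2*pi}" "\<theta> \<noteq> 2 * pi" for \<theta>
    using Arg2pi_unique[of 1 \<theta> "cis \<theta>"] that by (simp add: cis_conv_exp)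
  have gk: "AE \<theta> in lebesgue. \<theta> \<in> {0..2*pi} \<longrightarrow> g (cis \<theta>) $ j = k j \<theta>" for j
    using AE_completion[OF AE_lborel_singleton[of "2 * pi"]] by eventually_elim (auto simp: g_def arg)
  have gm: "(\<lambda>\<theta>. g (cis \<theta>) $ j) \<in> borel_measurable (lebesgue_on {0..2*pi})" for j
  proof -
    have "(\<lambda>\<theta>. if \<theta> = 2 * pi then k j 0 else k j \<theta>) \<in> borel_measurable borel" using k by measurable
    then have m1: "(\<lambda>\<theta>. if \<theta> = 2 * pi then k j 0 else k j \<theta>) \<in> borel_measurable (lebesgue_on {0..2*pi})"
      by (rule measurable_lebesgue_onI)
    have eq: "g (cis \<theta>) $ j = (if \<theta> = 2 * pi then k j 0 else k j \<theta>)" if "\<theta> \<in> space (lebesgue_on {0..2*pi})" for \<theta>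
      using arg[of \<theta>] arg[of 0] that by (auto simp: g_def space_restrict_space)
    show ?thesis by (rule measurable_cong[THEN iffD2, OF eq m1])
  qed
  have gi: "integrable (lebesgue_on {0..2*pi}) (\<lambda>\<theta>. (g (cis \<theta>) $ j)\<^sup>2)" for j
  proof (rule integrableI_bounded)
    show "(\<lambda>\<theta>. (g (cis \<theta>) $ j)\<^sup>2) \<in> borel_measurable (lebesgue_on {0..2*pi})" using gm by measurable
    have "(\<integral>\<^sup>+\<theta>. ennreal (norm ((g (cis \<theta>) $ j)\<^sup>2)) \<partial>lebesgue_on {0..2*pi}) = (\<integral>\<^sup>+\<theta>. ennreal ((g (cis \<theta>) $ j)\<^sup>2) * indicator {0..2*pi} \<theta> \<partial>lebesgue)"
      by (subst nn_integral_restrict_space) auto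
    also have "\<dots> = (\<integral>\<^sup>+\<theta>. ennreal ((k j \<theta>)\<^sup>2) * indicator {0..2*pi} \<theta> \<partial>lebesgue)"
      using gk[of j] by (intro nn_integral_cong_AE, eventually_elim) (auto simp: indicator_def)
    also have "\<dots> = (\<integral>\<^sup>+\<theta>. ennreal ((k j \<theta>)\<^sup>2) * indicator {0..2*pi} \<theta> \<partial>lborel)" by (rule nn_integral_completion)
    also have "\<dots> = (\<integral>\<^sup>+\<theta>. ennreal ((norm (complex_of_real (k j \<theta>)))\<^sup>2) \<partial>circle_measure)"
      using k by (subst nn_integral_circ) auto
    also have "\<dots> = (\<integral>\<^sup>+\<theta>. ennreal ((norm (complex_of_real (h j \<theta>)))\<^sup>2) \<partial>circle_measure)"
      by (intro nn_integral_cong) (auto simp: k_def)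
    also have "\<dots> < \<infinity>" using h(3)[of j] by (simp add: circle_L2_iff_nn)
    finally show "(\<integral>\<^sup>+\<theta>. ennreal (norm ((g (cis \<theta>) $ j)\<^sup>2)) \<partial>lebesgue_on {0..2*pi}) < \<infinity>" .
  qed
  have "(\<lambda>\<theta>. g (cis \<theta>)) \<in> borel_measurable (lebesgue_on {0..2*pi})"
    by (subst borel_measurable_euclidean_space) (auto simp: Basis_vec_def inner_axis gm)
  then have gL2: "L2_on {0..2*pi} (\<lambda>\<theta>. g (cis \<theta>))"
    using gi by (simp add: L2_on_def norm_vec_sq)
  have "fourier (distr_of g) n = sqrt \<bar>of_int n\<bar> *\<^sub>R ?A n" for n
  proof -
    have "fourier (distr_of g) n $ j = of_real (sqrt \<bar>of_int n\<bar>) * ?A n $ j" for j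
    proof -
      have "fourier (distr_of g) n $ j = fourier_coeff (\<lambda>\<theta>. complex_of_real (k j \<theta>)) n"
        by (rule fourier_distr_of[OF gL2 k gk])
      also have "\<dots> = fourier_coeff (\<lambda>\<theta>. complex_of_real (h j \<theta>)) n"
        unfolding fourier_coeff_def by (intro arg_cong2[where f = "(/)"] Bochner_Integration.integral_cong refl) (auto simp: k_def)
      finally show ?thesis by (simp only: h(2))
    qed
    then show ?thesis unfolding vec_eq_iff by (simp, simp add: scaleR_conv_of_real)
  qed
  then show ?thesis using gL2 by blast
qed

text \<open>
  Any two admissible choices have the same coefficients, so Parseval gives the norm of the chosen one.
\<close>

lemma quarter_laplacian_norm:
  fixes a :: "complex \<Rightarrow> real ^ 'm::finite"
  assumes a: "a \<in> H_half"
  shows "((\<lambda>n. 2 * pi * (\<bar>of_int n\<bar> * (norm (fourier (distr_of a) n))\<^sup>2)) has_sum (circle_L2_norm (quarter_laplacian a))\<^sup>2) UNIV"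
proof -
  have q: "L2_on {0..2*pi} (\<lambda>\<theta>. quarter_laplacian a (cis \<theta>))"
    "\<And>n. fourier (distr_of (quarter_laplacian a)) n = sqrt \<bar>of_int n\<bar> *\<^sub>R fourier (distr_of a) n"
    using someI_ex[OF ex_quarter_laplacian[OF a]] unfolding quarter_laplacian_def by auto
  show ?thesis using parseval_vec[OF q(1)] by (simp add: q(2) power_mult_distrib)
qed

section \<open>The energy of the harmonic extension\<close>

lemma annulus_eq: "annulus t = {z. 1 \<le> norm z \<and> norm z \<le> t}"
  by (auto simp: annulus_def dist_norm)

lemma interior_annulus: "interior (annulus t) = open_annulus t"
proof -
  have "closure (ball (0 :: complex) 1) = cball 0 1" by (rule closure_ball) simp
  then show ?thesis unfolding annulus_def interior_diff open_annulus_def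
    by (auto simp: dist_norm interior_cball)
qed

lemma compact_annulus: "compact (annulus t)"
  unfolding annulus_def by (intro compact_diff) auto

lemma open_annulus_subset: "open_annulus t \<subseteq> annulus t"
  by (auto simp: annulus_eq open_annulus_def)

lemma open_annulus_lmeasurable: "open_annulus t \<in> lmeasurable"
  using compact_annulus[of t] open_annulus_subset[of t] open_open_annulus[of t]
  by (intro lmeasurable_open bounded_subset[OF compact_imp_bounded]) 

lemma negligible_annulus_boundary: "negligible (annulus t - open_annulus t)"
proof (rule negligible_subset)
  show "negligible (frontier (ball (0 :: complex) 1) \<union> frontier (cball (0 :: complex) t))"
    by (intro negligible_Un negligible_convex_frontier convex_ball convex_cball)
  show "annulus t - open_annulus t \<subseteq> frontier (ball 0 1) \<union> frontier (cball 0 t)"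
    by (auto simp: annulus_eq open_annulus_def)
qed

lemma integral_annulus_eq:
  fixes h :: "complex \<Rightarrow> real"
  assumes h: "integrable (lebesgue_on (open_annulus t)) h"
  shows "(LINT z|lebesgue_on (annulus t). h z) = (LINT z|lebesgue_on (open_annulus t). h z)"
proof -
  have sets: "annulus t \<in> sets lebesgue" "open_annulus t \<in> sets lebesgue"
    using compact_annulus[of t] open_annulus_lmeasurable by (auto simp: lmeasurable_compact intro: fmeasurableD)
  have n1: "negligible {x \<in> open_annulus t - annulus t. h x \<noteq> 0}"
    using open_annulus_subset[of t] by (auto intro!: negligible_subset[OF negligible_empty])
  have n2: "negligible {x \<in> annulus t - open_annulus t. h x \<noteq> 0}"
    by (rule negligible_subset[OF negligible_annulus_boundary]) auto
  have "h absolutely_integrable_on open_annulus t"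
    using h sets by (simp add: set_integrable_def integrable_restrict_space)
  then have "h absolutely_integrable_on annulus t"
    using absolutely_integrable_spike_set_eq[OF n1 n2] by simp
  then have h': "integrable (lebesgue_on (annulus t)) h"
    using sets by (simp add: set_integrable_def integrable_restrict_space)
  show ?thesis
    unfolding lebesgue_integral_eq_integral[OF h' sets(1)] lebesgue_integral_eq_integral[OF h sets(2)]
    by (rule integral_spike_set[OF n2 n1])
qed

lemma frechet_derivative_complex:
  assumes "f differentiable (at z)"
  shows "frechet_derivative f (at z) h = Re h *\<^sub>R frechet_derivative f (at z) 1 + Im h *\<^sub>R frechet_derivative f (at z) \<i>"
proof -
  have l: "linear (frechet_derivative f (at z))" by (rule linear_frechet_derivative[OF assms])
  have "h = Re h *\<^sub>R 1 + Im h *\<^sub>R \<i>" by (simp add: complex_eq_iff)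
  then show ?thesis by (metis linear_add[OF l] linear_scale[OF l])
qed

lemma C1_on_component:
  fixes v :: "complex \<Rightarrow> real ^ 'm::finite"
  assumes d: "\<And>z. z \<in> V \<Longrightarrow> v differentiable (at z)"
    and c: "\<And>w. continuous_on V (\<lambda>z. frechet_derivative v (at z) w)"
  shows "C1_on V (\<lambda>z. complex_of_real (v z $ j)) (\<lambda>z. complex_of_real (frechet_derivative v (at z) 1 $ j))
    (\<lambda>z. complex_of_real (frechet_derivative v (at z) \<i> $ j))"
  unfolding C1_on_def
proof (intro conjI ballI)
  fix z assume z: "z \<in> V"
  have "(v has_derivative frechet_derivative v (at z)) (at z)"
    using d[OF z] by (simp only: frechet_derivative_works)
  then have "((\<lambda>z. complex_of_real (v z $ j)) has_derivative (\<lambda>h. complex_of_real (frechet_derivative v (at z) h $ j))) (at z)"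
    by (intro bounded_linear.has_derivative[OF bounded_linear_of_real] bounded_linear.has_derivative[OF bounded_linear_vec_nth])
  then show "((\<lambda>z. complex_of_real (v z $ j)) has_derivative (\<lambda>h. of_real (Re h) * complex_of_real (frechet_derivative v (at z) 1 $ j)
      + of_real (Im h) * complex_of_real (frechet_derivative v (at z) \<i> $ j))) (at z)"
    by (subst (asm) frechet_derivative_complex[OF d[OF z]]) simp
qed (intro continuous_intros c)+

lemma C1_on_cong:
  assumes V: "open V" and u: "C1_on V u ux uy" and eq: "\<And>z. z \<in> V \<Longrightarrow> u z = u' z"
  shows "C1_on V u' ux uy"
  using u unfolding C1_on_def
  by (auto intro!: has_derivative_transform_within_open[OF _ V _ eq])

lemma smooth_on_C1:
  assumes "smooth_on UNIV v"
  shows "v differentiable (at z)" "continuous_on UNIV (\<lambda>z. frechet_derivative v (at z) w)"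
proof -
  have "Ck_on 1 UNIV v" using assms by (simp add: smooth_on_def)
  then show "v differentiable (at z)" "continuous_on UNIV (\<lambda>z. frechet_derivative v (at z) w)"
    by (simp_all add: numeral_eq_Suc)
qed

lemma grad_norm_sq:
  fixes x y :: "real ^ 'm::finite"
  shows "(norm (x, y))\<^sup>2 = (\<Sum>j\<in>UNIV. (x $ j)\<^sup>2 + (y $ j)\<^sup>2)"
  by (simp add: norm_Pair norm_vec_sq sum.distrib sum_nonneg)

text \<open>
  The scalar formula applies to each real component, viewed as a complex function, and the component
  energies add up to the total energy.
\<close>

theorem dirichlet_energy_modes:
  fixes a b :: "complex \<Rightarrow> real ^ 'm::finite"
  assumes t: "t > 1" and ab: "a \<in> H_half" "b \<in> H_half"
    and f: "\<And>\<theta>. f (cis \<theta>) = a (cis \<theta>)" "\<And>\<theta>. f (of_real t * cis \<theta>) = b (cis \<theta>)"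
    and F: "harmonic_extension t f F"
  shows "((\<lambda>n. 2 * pi * (\<Sum>j\<in>UNIV. mode_energy t (fourier (distr_of a) n $ j) (fourier (distr_of b) n $ j) n))
    has_sum dirichlet_energy t F) UNIV"
proof -
  define U where "U = open_annulus t"
  have U: "open U" "U \<in> sets borel" "U \<in> lmeasurable" unfolding U_def
    by (auto simp: open_open_annulus open_annulus_lmeasurable)
  define G where "G = wgrad U F"
  have FH: "F \<in> H1 U" and Fharm: "harmonic_on U F" and Ftr: "has_trace t F f"
    using F by (auto simp: harmonic_extension_def interior_annulus U_def)
  have "L2_on U G \<and> weak_gradient U F G"
  proof -
    have "\<exists>G. L2_on U G \<and> weak_gradient U F G" using FH by (simp add: H1_def)
    from someI_ex[OF this] show ?thesis by (simp only: G_def wgrad_def)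
  qed
  then have GL: "L2_on U G" by simp
  have FL: "L2_on U F" using FH by (simp add: H1_def)
  obtain u where u: "\<And>k. smooth_on UNIV (u k)"
    and uF: "(\<lambda>k. LINT z|lebesgue_on (annulus t). (norm (u k z - F z))\<^sup>2) \<longlonglongrightarrow> 0"
    and uG: "(\<lambda>k. LINT z|lebesgue_on (annulus t). (norm (grad (u k) z - G z))\<^sup>2) \<longlonglongrightarrow> 0"
    and ub: "\<And>r. r \<in> {1, t} \<Longrightarrow> (\<lambda>k. LINT \<theta>|lebesgue_on {0..2*pi}. (norm (u k (of_real r * cis \<theta>) - f (of_real r * cis \<theta>)))\<^sup>2) \<longlonglongrightarrow> 0"
    using Ftr unfolding has_trace_def interior_annulus G_def U_def by blast
  note ud = smooth_on_C1[OF u]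
  have uc: "continuous_on UNIV (u k)" for k
    by (rule continuous_at_imp_continuous_on) (use ud in \<open>auto intro: differentiable_imp_continuous_within\<close>)
  have gc: "continuous_on UNIV (grad (u k))" for k
    unfolding grad_def by (intro continuous_intros ud)
  have L2U: "L2_on U v" if "continuous_on UNIV v" for v :: "complex \<Rightarrow> 'c::euclidean_space"
    by (rule L2_on_continuous[OF continuous_on_subset[OF that subset_UNIV] compact_annulus[of t]])
       (use open_annulus_subset U in \<open>auto simp: U_def\<close>)
  have iF: "integrable (lebesgue_on U) (\<lambda>z. (norm (u k z - F z))\<^sup>2)" for k
    using L2_on_diff[OF L2U[OF uc] FL] by (simp add: L2_on_def)
  have iG: "integrable (lebesgue_on U) (\<lambda>z. (norm (grad (u k) z - G z))\<^sup>2)" for k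
    using L2_on_diff[OF L2U[OF gc] GL] by (simp add: L2_on_def)
  have iG0: "integrable (lebesgue_on U) (\<lambda>z. (norm (G z))\<^sup>2)" using GL by (simp add: L2_on_def)
  have uF': "(\<lambda>k. LINT z|lebesgue_on U. (norm (u k z - F z))\<^sup>2) \<longlonglongrightarrow> 0"
    using uF integral_annulus_eq[OF iF[unfolded U_def]] by (simp add: U_def)
  have uG': "(\<lambda>k. LINT z|lebesgue_on U. (norm (grad (u k) z - G z))\<^sup>2) \<longlonglongrightarrow> 0"
    using uG integral_annulus_eq[OF iG[unfolded U_def]] by (simp add: U_def)
  define D where "D = dirichlet_energy t F"
  have D: "D = (LINT z|lebesgue_on U. (norm (G z))\<^sup>2)"
    unfolding D_def dirichlet_energy_def interior_annulus
    using integral_annulus_eq[OF iG0[unfolded U_def]] by (simp add: G_def U_def)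
  have aL: "L2_on {0..2*pi} (\<lambda>\<theta>. a (cis \<theta>))" and bL: "L2_on {0..2*pi} (\<lambda>\<theta>. b (cis \<theta>))"
    using ab by (auto simp: H_half_def)

  have FC: "Ck_on 2 U F" and Flap: "\<And>z. z \<in> U \<Longrightarrow> laplacian F z = 0"
    using Fharm by (auto simp: harmonic_on_def)
  have Fd: "\<And>z. z \<in> U \<Longrightarrow> F differentiable (at z)"
    and Fdd: "\<And>z w. z \<in> U \<Longrightarrow> (\<lambda>x. frechet_derivative F (at x) w) differentiable (at z)"
    and Fddc: "\<And>w w'. continuous_on U (\<lambda>z. frechet_derivative (\<lambda>x. frechet_derivative F (at x) w) (at z) w')"
    using FC by (simp_all add: numeral_eq_Suc)
  have Fdc: "continuous_on U (\<lambda>z. frechet_derivative F (at z) w)" for w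
    by (rule continuous_at_imp_continuous_on) (use Fdd in \<open>auto intro: differentiable_imp_continuous_within\<close>)
  have Fc: "continuous_on U F"
    by (rule continuous_at_imp_continuous_on) (use Fd in \<open>auto intro: differentiable_imp_continuous_within\<close>)
  \<comment> \<open>\<open>F\<close> is continuous only on the open annulus; cut off there, it is Borel measurable on the plane.\<close>
  define F0 where "F0 = (\<lambda>z. indicator U z *\<^sub>R F z)"
  have F0m: "F0 \<in> borel_measurable borel"
    unfolding F0_def by (rule borel_measurable_continuous_on_indicator[OF U(2) Fc])
  have nthm: "(\<lambda>x :: real ^ 'm. x $ j) \<in> borel_measurable borel" for j
    by (intro borel_measurable_continuous_onI continuous_intros)
  have ofrm: "complex_of_real \<in> borel_measurable borel"
    by (intro borel_measurable_continuous_onI continuous_intros)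

  have Gm: "G \<in> borel_measurable (lebesgue_on U)" using GL by (simp add: L2_on_def)
  have fstm: "(\<lambda>p :: (real ^ 'm) \<times> (real ^ 'm). fst p $ j) \<in> borel_measurable borel"
    and sndm: "(\<lambda>p :: (real ^ 'm) \<times> (real ^ 'm). snd p $ j) \<in> borel_measurable borel" for j
    by (intro borel_measurable_continuous_onI continuous_intros)+
  have "\<forall>j. \<exists>g. g \<in> borel_measurable borel \<and> (AE z in lebesgue. z \<in> U \<longrightarrow> fst (G z) $ j = g z)"
  proof
    fix j
    obtain g where "g \<in> borel_measurable borel" "AE z in lebesgue. z \<in> U \<longrightarrow> fst (G z) $ j = g z"
      by (rule borel_representative[OF U(2) measurable_compose[OF Gm fstm[of j]]])
    then show "\<exists>g. g \<in> borel_measurable borel \<and> (AE z in lebesgue. z \<in> U \<longrightarrow> fst (G z) $ j = g z)" by (intro exI conjI)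
  qed
  from choice[OF this] obtain g1 where g1: "\<And>j. g1 j \<in> borel_measurable borel" "\<And>j. AE z in lebesgue. z \<in> U \<longrightarrow> fst (G z) $ j = g1 j z"
    by (elim exE) (rule that, auto)
  have "\<forall>j. \<exists>g. g \<in> borel_measurable borel \<and> (AE z in lebesgue. z \<in> U \<longrightarrow> snd (G z) $ j = g z)"
  proof
    fix j
    obtain g where "g \<in> borel_measurable borel" "AE z in lebesgue. z \<in> U \<longrightarrow> snd (G z) $ j = g z"
      by (rule borel_representative[OF U(2) measurable_compose[OF Gm sndm[of j]]])
    then show "\<exists>g. g \<in> borel_measurable borel \<and> (AE z in lebesgue. z \<in> U \<longrightarrow> snd (G z) $ j = g z)" by (intro exI conjI)
  qed
  from choice[OF this] obtain g2 where g2: "\<And>j. g2 j \<in> borel_measurable borel" "\<And>j. AE z in lebesgue. z \<in> U \<longrightarrow> snd (G z) $ j = g2 j z"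
    by (elim exE) (rule that, auto)
  have ae_all: "AE z in lebesgue. z \<in> U \<longrightarrow> (\<forall>j. fst (G z) $ j = g1 j z \<and> snd (G z) $ j = g2 j z)"
  proof -
    have "AE z in lebesgue. \<forall>j\<in>UNIV. (z \<in> U \<longrightarrow> fst (G z) $ j = g1 j z) \<and> (z \<in> U \<longrightarrow> snd (G z) $ j = g2 j z)"
      by (rule AE_finite_allI) (use g1(2) g2(2) in auto)
    then show ?thesis by eventually_elim auto
  qed
  let ?E = "\<lambda>j. \<integral>\<^sup>+z. ennreal ((norm (complex_of_real (g1 j z)))\<^sup>2 + (norm (complex_of_real (g2 j z)))\<^sup>2) * indicator U z \<partial>lborel"
  have m12: "(\<lambda>z. ennreal ((norm (complex_of_real (g1 j z)))\<^sup>2 + (norm (complex_of_real (g2 j z)))\<^sup>2)) \<in> borel_measurable borel" for j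
    using g1(1)[of j] g2(1)[of j] by simp
  have sumE: "(\<Sum>j\<in>UNIV. ?E j) = ennreal D"
  proof -
    have "(\<Sum>j\<in>UNIV. ?E j) = (\<integral>\<^sup>+z. (\<Sum>j\<in>UNIV. ennreal ((norm (complex_of_real (g1 j z)))\<^sup>2 + (norm (complex_of_real (g2 j z)))\<^sup>2) * indicator U z) \<partial>lborel)"
      by (rule nn_integral_sum[symmetric]) (use m12 U(2) in simp)
    also have "\<dots> = (\<integral>\<^sup>+z. ennreal (\<Sum>j\<in>UNIV. (g1 j z)\<^sup>2 + (g2 j z)\<^sup>2) * indicator U z \<partial>lborel)"
      by (intro nn_integral_cong, subst sum_ennreal[symmetric]) (simp_all add: sum_distrib_right)
    also have "\<dots> = ennreal (LINT z|lebesgue_on U. (norm (G z))\<^sup>2)"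
    proof (rule nn_integral_lborel_eq_lebesgue_on(2)[OF U(2) iG0])
      show "(\<lambda>z. ennreal (\<Sum>j\<in>UNIV. (g1 j z)\<^sup>2 + (g2 j z)\<^sup>2)) \<in> borel_measurable borel"
        using g1(1) g2(1) by simp
      show "AE z in lebesgue. z \<in> U \<longrightarrow> ennreal (\<Sum>j\<in>UNIV. (g1 j z)\<^sup>2 + (g2 j z)\<^sup>2) = ennreal ((norm (G z))\<^sup>2)"
        using ae_all
      proof eventually_elim
        case (elim z)
        show ?case using elim grad_norm_sq[of "fst (G z)" "snd (G z)"] by simp
      qed
    qed simp
    finally show ?thesis by (simp only: D)
  qed
  have finE: "?E j < \<infinity>" for j
  proof -
    have "?E j \<le> (\<Sum>j\<in>UNIV. ?E j)" by (rule member_le_sum) auto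
    then show ?thesis unfolding sumE by (simp add: le_less_trans[OF _ ennreal_less_top])
  qed

  let ?A = "fourier (distr_of a)" and ?B = "fourier (distr_of b)"
  have comp: "?E j = (\<Sum>k. ennreal (2 * pi * mode_energy t (?A (int_decode k) $ j) (?B (int_decode k) $ j) (int_decode k)))" for j
  proof -
    obtain \<alpha> where \<alpha>: "\<alpha> \<in> borel_measurable borel" "AE x in lebesgue. x \<in> {0..2*pi} \<longrightarrow> a (cis x) $ j = \<alpha> x"
      "circle_L2 (\<lambda>x. complex_of_real (\<alpha> x))"
      using circ_representative[OF L2_on_component[OF aL, of j]] by blast
    obtain \<beta> where \<beta>: "\<beta> \<in> borel_measurable borel" "AE x in lebesgue. x \<in> {0..2*pi} \<longrightarrow> b (cis x) $ j = \<beta> x"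
      "circle_L2 (\<lambda>x. complex_of_real (\<beta> x))"
      using circ_representative[OF L2_on_component[OF bL, of j]] by blast
    \<comment> \<open>The convergence of the traces, once for each of the two boundary circles.\<close>
    have boundary: "(\<lambda>k. \<integral>\<^sup>+\<theta>. ennreal ((norm (complex_of_real (u k (logpolar s \<theta>) $ j) - complex_of_real (\<gamma> \<theta>)))\<^sup>2) \<partial>circle_measure) \<longlonglongrightarrow> 0"
      if r: "r \<in> {1, t}" and s: "\<And>\<theta>. logpolar s \<theta> = of_real r * cis \<theta>" and fval: "\<And>\<theta>. f (of_real r * cis \<theta>) = c (cis \<theta>)"
        and c: "L2_on {0..2*pi} (\<lambda>\<theta>. c (cis \<theta>))" and \<gamma>: "\<gamma> \<in> borel_measurable borel"
        and ae: "AE x in lebesgue. x \<in> {0..2*pi} \<longrightarrow> c (cis x) $ j = \<gamma> x" for s r c \<gamma>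
    proof -
      have ucirc: "continuous_on A (\<lambda>\<theta>. u k (of_real r * cis \<theta>))" for k A
        by (intro continuous_on_compose2[OF uc] continuous_intros) auto
      have "L2_on {0..2*pi} (\<lambda>\<theta>. u k (of_real r * cis \<theta>))" for k
        by (rule L2_on_continuous[OF ucirc compact_Icc order_refl]) (metis cbox_interval lmeasurable_cbox)
      then have i: "integrable (lebesgue_on {0..2*pi}) (\<lambda>\<theta>. (norm (u k (of_real r * cis \<theta>) - c (cis \<theta>)))\<^sup>2)" for k
        using L2_on_diff[OF _ c, of "\<lambda>\<theta>. u k (of_real r * cis \<theta>)"] by (simp add: L2_on_def)
      have lim: "(\<lambda>k. ennreal (LINT \<theta>|lebesgue_on {0..2*pi}. (norm (u k (of_real r * cis \<theta>) - c (cis \<theta>)))\<^sup>2)) \<longlonglongrightarrow> 0"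
        using tendsto_ennrealI[OF ub[OF r]] by (simp add: fval)
      have um: "(\<lambda>\<theta>. u k (of_real r * cis \<theta>) $ j) \<in> borel_measurable borel" for k
        by (intro borel_measurable_continuous_onI continuous_intros ucirc)
      show ?thesis
      proof (rule tendsto_sandwich[OF always_eventually always_eventually tendsto_const lim, OF allI allI, OF zero_le])
        fix k
        have wm: "(\<lambda>\<theta>. ennreal ((norm (complex_of_real (u k (of_real r * cis \<theta>) $ j) - complex_of_real (\<gamma> \<theta>)))\<^sup>2)) \<in> borel_measurable borel"
          using um[of k] \<gamma> by simp
        have "(\<integral>\<^sup>+\<theta>. ennreal ((norm (complex_of_real (u k (logpolar s \<theta>) $ j) - complex_of_real (\<gamma> \<theta>)))\<^sup>2) \<partial>circle_measure)
          = (\<integral>\<^sup>+\<theta>. ennreal ((norm (complex_of_real (u k (of_real r * cis \<theta>) $ j) - complex_of_real (\<gamma> \<theta>)))\<^sup>2) * indicator {0..2*pi} \<theta> \<partial>lborel)"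
          unfolding s by (rule nn_integral_circ[OF wm])
        also have "\<dots> \<le> ennreal (LINT \<theta>|lebesgue_on {0..2*pi}. (norm (u k (of_real r * cis \<theta>) - c (cis \<theta>)))\<^sup>2)"
        proof (rule nn_integral_lborel_eq_lebesgue_on(1)[OF circle_borel i _ wm])
          show "AE \<theta> in lebesgue. \<theta> \<in> {0..2*pi} \<longrightarrow> ennreal ((norm (complex_of_real (u k (of_real r * cis \<theta>) $ j) - complex_of_real (\<gamma> \<theta>)))\<^sup>2)
              \<le> ennreal ((norm (u k (of_real r * cis \<theta>) - c (cis \<theta>)))\<^sup>2)"
            using ae
          proof eventually_elim
            case (elim \<theta>)
            show ?case
            proof (intro impI ennreal_leI power_mono norm_ge_zero)
              assume "\<theta> \<in> {0..2*pi}"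
              then have "complex_of_real (u k (of_real r * cis \<theta>) $ j) - complex_of_real (\<gamma> \<theta>) = of_real ((u k (of_real r * cis \<theta>) - c (cis \<theta>)) $ j)"
                using elim by simp
              then show "norm (complex_of_real (u k (of_real r * cis \<theta>) $ j) - complex_of_real (\<gamma> \<theta>)) \<le> norm (u k (of_real r * cis \<theta>) - c (cis \<theta>))"
                using Finite_Cartesian_Product.norm_nth_le[of "u k (of_real r * cis \<theta>) - c (cis \<theta>)" j] by (simp only: norm_of_real real_norm_def)
            qed
          qed
        qed simp
        finally show "(\<integral>\<^sup>+\<theta>. ennreal ((norm (complex_of_real (u k (logpolar s \<theta>) $ j) - complex_of_real (\<gamma> \<theta>)))\<^sup>2) \<partial>circle_measure)
            \<le> ennreal (LINT \<theta>|lebesgue_on {0..2*pi}. (norm (u k (of_real r * cis \<theta>) - c (cis \<theta>)))\<^sup>2)" .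
      qed
    qed
    have "?E j = (\<Sum>k. ennreal (2 * pi * mode_energy t (fourier_coeff (\<lambda>\<theta>. complex_of_real (\<alpha> \<theta>)) (int_decode k)) (fourier_coeff (\<lambda>\<theta>. complex_of_real (\<beta> \<theta>)) (int_decode k)) (int_decode k)))"
      unfolding U_def
    proof (rule annulus_energy_fourier[OF t,
          where F = "\<lambda>z. complex_of_real (F0 z $ j)"
            and Fx = "\<lambda>z. complex_of_real (frechet_derivative F (at z) 1 $ j)"
            and Fy = "\<lambda>z. complex_of_real (frechet_derivative F (at z) \<i> $ j)"
            and Fxx = "\<lambda>z. complex_of_real (frechet_derivative (\<lambda>x. frechet_derivative F (at x) 1) (at z) 1 $ j)"
            and Fxy = "\<lambda>z. complex_of_real (frechet_derivative (\<lambda>x. frechet_derivative F (at x) 1) (at z) \<i> $ j)"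
            and Fyx = "\<lambda>z. complex_of_real (frechet_derivative (\<lambda>x. frechet_derivative F (at x) \<i>) (at z) 1 $ j)"
            and Fyy = "\<lambda>z. complex_of_real (frechet_derivative (\<lambda>x. frechet_derivative F (at x) \<i>) (at z) \<i> $ j)"
            and u = "\<lambda>k z. complex_of_real (u k z $ j)"
            and ux = "\<lambda>k z. complex_of_real (frechet_derivative (u k) (at z) 1 $ j)"
            and uy = "\<lambda>k z. complex_of_real (frechet_derivative (u k) (at z) \<i> $ j)"], fold U_def)
      show "(\<lambda>z. complex_of_real (F0 z $ j)) \<in> borel_measurable borel"
        by (rule measurable_compose[OF measurable_compose[OF F0m nthm] ofrm])
      show "C1_on U (\<lambda>z. complex_of_real (F0 z $ j)) (\<lambda>z. complex_of_real (frechet_derivative F (at z) 1 $ j)) (\<lambda>z. complex_of_real (frechet_derivative F (at z) \<i> $ j))"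
        by (rule C1_on_cong[OF U(1) C1_on_component[OF Fd Fdc]]) (auto simp: F0_def)
      show "C1_on U (\<lambda>z. complex_of_real (frechet_derivative F (at z) 1 $ j))
          (\<lambda>z. complex_of_real (frechet_derivative (\<lambda>x. frechet_derivative F (at x) 1) (at z) 1 $ j))
          (\<lambda>z. complex_of_real (frechet_derivative (\<lambda>x. frechet_derivative F (at x) 1) (at z) \<i> $ j))"
        by (rule C1_on_component[OF Fdd Fddc])
      show "C1_on U (\<lambda>z. complex_of_real (frechet_derivative F (at z) \<i> $ j))
          (\<lambda>z. complex_of_real (frechet_derivative (\<lambda>x. frechet_derivative F (at x) \<i>) (at z) 1 $ j))
          (\<lambda>z. complex_of_real (frechet_derivative (\<lambda>x. frechet_derivative F (at x) \<i>) (at z) \<i> $ j))"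
        by (rule C1_on_component[OF Fdd Fddc])
      show "complex_of_real (frechet_derivative (\<lambda>x. frechet_derivative F (at x) 1) (at z) 1 $ j)
          + complex_of_real (frechet_derivative (\<lambda>x. frechet_derivative F (at x) \<i>) (at z) \<i> $ j) = 0" if "z \<in> U" for z
      proof -
        have "1 \<noteq> \<i>" by (simp add: complex_eq_iff)
        then have "(frechet_derivative (\<lambda>x. frechet_derivative F (at x) 1) (at z) 1
            + frechet_derivative (\<lambda>x. frechet_derivative F (at x) \<i>) (at z) \<i>) $ j = 0"
          using Flap[OF that] by (simp add: laplacian_def)
        then show ?thesis by (simp flip: of_real_add)
      qed
      show "(\<lambda>z. complex_of_real (g1 j z)) \<in> borel_measurable borel" "(\<lambda>z. complex_of_real (g2 j z)) \<in> borel_measurable borel"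
        by (intro measurable_compose[OF g1(1) ofrm] measurable_compose[OF g2(1) ofrm])+
      show "?E j < \<infinity>" by (rule finE)
      show "C1_on UNIV (\<lambda>z. complex_of_real (u k z $ j)) (\<lambda>z. complex_of_real (frechet_derivative (u k) (at z) 1 $ j)) (\<lambda>z. complex_of_real (frechet_derivative (u k) (at z) \<i> $ j))" for k
        by (rule C1_on_component[OF ud])
      show "circle_L2 (\<lambda>\<theta>. complex_of_real (\<alpha> \<theta>))" "circle_L2 (\<lambda>\<theta>. complex_of_real (\<beta> \<theta>))" by (rule \<alpha>(3), rule \<beta>(3))
      show "(\<lambda>k. \<integral>\<^sup>+\<theta>. ennreal ((norm (complex_of_real (u k (logpolar 0 \<theta>) $ j) - complex_of_real (\<alpha> \<theta>)))\<^sup>2) \<partial>circle_measure) \<longlonglongrightarrow> 0"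
        by (rule boundary[of 1 0 a \<alpha>, OF _ _ _ aL \<alpha>(1,2)]) (simp_all add: logpolar_def f)
      show "(\<lambda>k. \<integral>\<^sup>+\<theta>. ennreal ((norm (complex_of_real (u k (logpolar (ln t) \<theta>) $ j) - complex_of_real (\<beta> \<theta>)))\<^sup>2) \<partial>circle_measure) \<longlonglongrightarrow> 0"
        by (rule boundary[of t "ln t" b \<beta>, OF _ _ _ bL \<beta>(1,2)]) (use t in \<open>simp_all add: logpolar_def f\<close>)
      have lim1: "(\<lambda>k. ennreal (LINT z|lebesgue_on U. (norm (u k z - F z))\<^sup>2)) \<longlonglongrightarrow> 0"
        using tendsto_ennrealI[OF uF'] by simp
      show "(\<lambda>k. \<integral>\<^sup>+z. ennreal ((norm (complex_of_real (u k z $ j) - complex_of_real (F0 z $ j)))\<^sup>2) * indicator U z \<partial>lborel) \<longlonglongrightarrow> 0"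
      proof (rule tendsto_sandwich[OF always_eventually always_eventually tendsto_const lim1, OF allI allI, OF zero_le])
        fix k
        have ukm: "(\<lambda>z. u k z $ j) \<in> borel_measurable borel" by (intro borel_measurable_continuous_onI continuous_intros uc)
        show "(\<integral>\<^sup>+z. ennreal ((norm (complex_of_real (u k z $ j) - complex_of_real (F0 z $ j)))\<^sup>2) * indicator U z \<partial>lborel)
            \<le> ennreal (LINT z|lebesgue_on U. (norm (u k z - F z))\<^sup>2)"
        proof (rule nn_integral_lborel_eq_lebesgue_on(1)[OF U(2) iF])
          show "(\<lambda>z. ennreal ((norm (complex_of_real (u k z $ j) - complex_of_real (F0 z $ j)))\<^sup>2)) \<in> borel_measurable borel"
            using ukm measurable_compose[OF F0m nthm[of j]] by simp
          have "norm (complex_of_real (u k z $ j) - complex_of_real (F0 z $ j)) \<le> norm (u k z - F z)" if "z \<in> U" for z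
          proof -
            have "complex_of_real (u k z $ j) - complex_of_real (F0 z $ j) = of_real ((u k z - F z) $ j)"
              using that by (simp add: F0_def)
            then show ?thesis using Finite_Cartesian_Product.norm_nth_le[of "u k z - F z" j] by (simp only: norm_of_real real_norm_def)
          qed
          then show "AE z in lebesgue. z \<in> U \<longrightarrow> ennreal ((norm (complex_of_real (u k z $ j) - complex_of_real (F0 z $ j)))\<^sup>2) \<le> ennreal ((norm (u k z - F z))\<^sup>2)"
            by (intro AE_I2 impI ennreal_leI power_mono) auto
        qed simp
      qed
      have lim2: "(\<lambda>k. ennreal (LINT z|lebesgue_on U. (norm (grad (u k) z - G z))\<^sup>2)) \<longlonglongrightarrow> 0"
        using tendsto_ennrealI[OF uG'] by simp
      show "(\<lambda>k. \<integral>\<^sup>+z. ennreal ((norm (complex_of_real (frechet_derivative (u k) (at z) 1 $ j) - complex_of_real (g1 j z)))\<^sup>2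
          + (norm (complex_of_real (frechet_derivative (u k) (at z) \<i> $ j) - complex_of_real (g2 j z)))\<^sup>2) * indicator U z \<partial>lborel) \<longlonglongrightarrow> 0"
      proof (rule tendsto_sandwich[OF always_eventually always_eventually tendsto_const lim2, OF allI allI, OF zero_le])
        fix k
        have um: "(\<lambda>z. frechet_derivative (u k) (at z) 1 $ j) \<in> borel_measurable borel" "(\<lambda>z. frechet_derivative (u k) (at z) \<i> $ j) \<in> borel_measurable borel"
          by (intro borel_measurable_continuous_onI continuous_intros ud)+
        show "(\<integral>\<^sup>+z. ennreal ((norm (complex_of_real (frechet_derivative (u k) (at z) 1 $ j) - complex_of_real (g1 j z)))\<^sup>2
          + (norm (complex_of_real (frechet_derivative (u k) (at z) \<i> $ j) - complex_of_real (g2 j z)))\<^sup>2) * indicator U z \<partial>lborel)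
            \<le> ennreal (LINT z|lebesgue_on U. (norm (grad (u k) z - G z))\<^sup>2)"
        proof (rule nn_integral_lborel_eq_lebesgue_on(1)[OF U(2) iG])
          show "(\<lambda>z. ennreal ((norm (complex_of_real (frechet_derivative (u k) (at z) 1 $ j) - complex_of_real (g1 j z)))\<^sup>2
            + (norm (complex_of_real (frechet_derivative (u k) (at z) \<i> $ j) - complex_of_real (g2 j z)))\<^sup>2)) \<in> borel_measurable borel"
            using um g1(1)[of j] g2(1)[of j] by simp
          show "AE z in lebesgue. z \<in> U \<longrightarrow> ennreal ((norm (complex_of_real (frechet_derivative (u k) (at z) 1 $ j) - complex_of_real (g1 j z)))\<^sup>2
            + (norm (complex_of_real (frechet_derivative (u k) (at z) \<i> $ j) - complex_of_real (g2 j z)))\<^sup>2) \<le> ennreal ((norm (grad (u k) z - G z))\<^sup>2)"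
            using ae_all
          proof eventually_elim
            case (elim z)
            show ?case
            proof (intro impI ennreal_leI)
              assume z: "z \<in> U"
              let ?x = "frechet_derivative (u k) (at z) 1 - fst (G z)" and ?y = "frechet_derivative (u k) (at z) \<i> - snd (G z)"
              have "grad (u k) z - G z = (?x, ?y)" by (simp add: grad_def prod_eq_iff)
              then have e: "(norm (grad (u k) z - G z))\<^sup>2 = (\<Sum>j\<in>UNIV. (?x $ j)\<^sup>2 + (?y $ j)\<^sup>2)" by (simp only: grad_norm_sq)
              have "(norm (complex_of_real (frechet_derivative (u k) (at z) 1 $ j) - complex_of_real (g1 j z)))\<^sup>2
                + (norm (complex_of_real (frechet_derivative (u k) (at z) \<i> $ j) - complex_of_real (g2 j z)))\<^sup>2 = (?x $ j)\<^sup>2 + (?y $ j)\<^sup>2"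
                using elim z by (simp flip: of_real_diff)
              also have "\<dots> \<le> (norm (grad (u k) z - G z))\<^sup>2"
                unfolding e by (rule member_le_sum) auto
              finally show "(norm (complex_of_real (frechet_derivative (u k) (at z) 1 $ j) - complex_of_real (g1 j z)))\<^sup>2
                + (norm (complex_of_real (frechet_derivative (u k) (at z) \<i> $ j) - complex_of_real (g2 j z)))\<^sup>2 \<le> (norm (grad (u k) z - G z))\<^sup>2" .
            qed
          qed
        qed simp
      qed
    qed
    then show ?thesis unfolding fourier_distr_of[OF aL \<alpha>(1,2), symmetric] fourier_distr_of[OF bL \<beta>(1,2), symmetric] .
  qed
  have hs: "((\<lambda>n. 2 * pi * mode_energy t (?A n $ j) (?B n $ j) n) has_sum enn2real (?E j)) UNIV" for j
  proof -
    let ?e = "\<lambda>k. 2 * pi * mode_energy t (?A (int_decode k) $ j) (?B (int_decode k) $ j) (int_decode k)"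
    have nn: "0 \<le> ?e k" for k using mode_energy_nonneg[OF t] by simp
    have s: "summable ?e" by (rule summable_suminf_not_top[OF nn]) (use finE[of j, unfolded comp] in \<open>simp add: less_top\<close>)
    have "?E j = ennreal (\<Sum>k. ?e k)" unfolding comp by (rule suminf_ennreal2[OF nn s])
    then have "enn2real (?E j) = (\<Sum>k. ?e k)" by (simp only: enn2real_ennreal[OF suminf_nonneg[OF s nn]])
    then have "?e sums enn2real (?E j)" by (simp only: summable_sums[OF s])
    then have "(?e has_sum enn2real (?E j)) UNIV" using nn by (rule sums_nonneg_imp_has_sum)
    then show ?thesis
      using has_sum_reindex_bij_betw[OF bij_int_decode, of "\<lambda>n. 2 * pi * mode_energy t (?A n $ j) (?B n $ j) n"] by simp
  qed
  have "ennreal D = ennreal (\<Sum>j\<in>UNIV. enn2real (?E j))"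
  proof -
    have "ennreal (enn2real (?E j)) = ?E j" for j
      by (rule ennreal_enn2real) (use finE[of j] in \<open>simp only: infinity_ennreal_def\<close>)
    then have "(\<Sum>j\<in>UNIV. ?E j) = (\<Sum>j\<in>UNIV. ennreal (enn2real (?E j)))" by (simp only:)
    also have "\<dots> = ennreal (\<Sum>j\<in>UNIV. enn2real (?E j))" by (rule sum_ennreal) (rule enn2real_nonneg)
    finally show ?thesis unfolding sumE .
  qed
  then have "D = (\<Sum>j\<in>UNIV. enn2real (?E j))"
    by (subst (asm) ennreal_inj) (auto simp: D intro!: integral_nonneg_AE sum_nonneg)
  then show ?thesis
    using has_sum_finite_sum[of UNIV, OF finite hs] by (simp add: D_def sum_distrib_left)
qed

section \<open>Summing over the modes\<close>

lemma has_sum_even_int: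
  fixes Z :: "int \<Rightarrow> real"
  assumes Z: "(Z has_sum S) UNIV" and even: "\<And>n. Z (- n) = Z n"
  shows "((\<lambda>n. 2 * Z (int n)) has_sum (S - Z 0)) {0::nat<..}"
proof -
  define P where "P = infsum Z (int ` {0<..})"
  have P: "(Z has_sum P) (int ` {0<..})"
    unfolding P_def by (intro has_sum_infsum summable_on_subset_banach[OF has_sum_imp_summable[OF Z]]) auto
  then have P1: "((\<lambda>n. Z (int n)) has_sum P) {0::nat<..}"
    by (subst (asm) has_sum_reindex) (auto simp: o_def inj_on_def)
  have N: "(Z has_sum P) ((\<lambda>n::nat. - int n) ` {0<..})"
    by (subst has_sum_reindex) (use P1 in \<open>auto simp: o_def inj_on_def even\<close>)
  have PN: "(Z has_sum (P + P)) (int ` {0<..} \<union> (\<lambda>n::nat. - int n) ` {0<..})"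
    by (rule has_sum_Un_disjoint[OF P N]) auto
  have "(Z has_sum Z 0) {0}" using has_sum_finite[of "{0}" Z] by simp
  then have "(Z has_sum (Z 0 + (P + P))) ({0} \<union> (int ` {0<..} \<union> (\<lambda>n::nat. - int n) ` {0<..}))"
    by (rule has_sum_Un_disjoint[OF _ PN]) auto
  moreover have "{0} \<union> (int ` {0<..} \<union> (\<lambda>n::nat. - int n) ` {0<..}) = UNIV"
  proof -
    have "n = 0 \<or> n \<in> int ` {0<..} \<or> n \<in> (\<lambda>n::nat. - int n) ` {0<..}" for n :: int
    proof (cases n rule: int_cases2)
      case (nonneg m) then show ?thesis by (cases "m = 0") auto
    next
      case (nonpos m) then show ?thesis by (cases "m = 0") auto
    qed
    then show ?thesis by auto
  qed
  ultimately have "S = Z 0 + (P + P)" using Z infsumI by metis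
  then show ?thesis using has_sum_cmult_right[OF P1, of 2] by simp
qed

text \<open>
  What a mode contributes to the energy beyond the part \<open>|n| (|x|\<^sup>2 + |y|\<^sup>2)\<close>, which would be the
  contribution of two discs with the same boundary values.
\<close>

definition interaction :: "real \<Rightarrow> complex ^ 'm::finite \<Rightarrow> complex ^ 'm \<Rightarrow> int \<Rightarrow> real" where
  "interaction t x y n = (if n = 0 then (norm (y - x))\<^sup>2 / ln t
     else let T = t ^ nat \<bar>n\<bar> in \<bar>of_int n\<bar> * (2 / (T\<^sup>2 - 1) * ((norm x)\<^sup>2 + (norm y)\<^sup>2) - 4 * T / (T\<^sup>2 - 1) * Re (x \<cdot> vcnj y)))"

text \<open>
  For \<open>T = t\<^sup>n\<close> this is \<open>(T\<^sup>2 + 1) / (T\<^sup>2 - 1) = 1 + 2 / (T\<^sup>2 - 1)\<close>.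
\<close>

lemma sum_mode_energy:
  fixes x y :: "complex ^ 'm::finite"
  assumes t: "t > 1"
  shows "(\<Sum>j\<in>UNIV. mode_energy t (x $ j) (y $ j) n) = \<bar>of_int n\<bar> * ((norm x)\<^sup>2 + (norm y)\<^sup>2) + interaction t x y n"
proof (cases "n = 0")
  case True
  then show ?thesis by (simp add: mode_energy_def interaction_def norm_vec_sq sum_divide_distrib)
next
  case False
  define T where "T = t ^ nat \<bar>n\<bar>"
  define m where "m = real_of_int \<bar>n\<bar>"
  have T1: "T > 1" unfolding T_def using t False by (intro one_less_power) auto
  then have T: "T\<^sup>2 - 1 \<noteq> 0" by (auto simp: power2_eq_1_iff)
  define W where "W = (norm x)\<^sup>2 + (norm y)\<^sup>2"
  define R where "R = Re (x \<cdot> vcnj y)"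
  have W: "W = (\<Sum>j\<in>UNIV. (norm (x $ j))\<^sup>2 + (norm (y $ j))\<^sup>2)" by (simp add: W_def norm_vec_sq sum.distrib)
  have R: "R = (\<Sum>j\<in>UNIV. Re (x $ j * cnj (y $ j)))" by (simp add: R_def cdot_def vcnj_def)
  have "mode_energy t \<alpha> \<beta> n = m / (T\<^sup>2 - 1) * ((T\<^sup>2 + 1) * ((norm \<alpha>)\<^sup>2 + (norm \<beta>)\<^sup>2) - 4 * T * Re (\<alpha> * cnj \<beta>))" for \<alpha> \<beta>
    using False by (simp only: mode_energy_def if_False Let_def T_def m_def)
  then have "(\<Sum>j\<in>UNIV. mode_energy t (x $ j) (y $ j) n) = m / (T\<^sup>2 - 1) * ((T\<^sup>2 + 1) * W - 4 * T * R)"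
    unfolding W R by (simp only: sum_distrib_left sum_subtractf right_diff_distrib)
  also have "\<dots> = m * ((T\<^sup>2 - 1) / (T\<^sup>2 - 1) * W + 2 / (T\<^sup>2 - 1) * W - 4 * T / (T\<^sup>2 - 1) * R)"
  proof -
    have "m / X * ((X + 2) * W - 4 * T * R) = m * (X / X * W + 2 / X * W - 4 * T / X * R)" for X
      by (simp add: diff_divide_distrib add_divide_distrib algebra_simps)
    moreover have "T\<^sup>2 - 1 + 2 = T\<^sup>2 + 1" by simp
    ultimately show ?thesis by metis
  qed
  also have "\<dots> = m * W + m * (2 / (T\<^sup>2 - 1) * W - 4 * T / (T\<^sup>2 - 1) * R)"
    using T by (simp add: algebra_simps)
  finally show ?thesis
    using False by (simp add: interaction_def Let_def T_def W_def R_def m_def)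
qed

lemma interaction_minus: "interaction t (vcnj x) (vcnj y) (- n) = interaction t x y n"
proof -
  have d: "norm (vcnj y - vcnj x) = norm (y - x)"
    using norm_vcnj[of "y - x"] by (simp add: vcnj_def vec_eq_iff minus_vec_def)
  have "vcnj x \<cdot> vcnj (vcnj y) = cnj (x \<cdot> vcnj y)" by (simp add: cdot_def vcnj_def)
  then show ?thesis by (simp add: interaction_def norm_vcnj d)
qed

lemma interaction_pos:
  assumes "n > 0"
  shows "2 * interaction t x y (int n) = real n * (4 / (t ^ (2 * n) - 1) * ((norm x)\<^sup>2 + (norm y)\<^sup>2)
     - 8 * t ^ n / (t ^ (2 * n) - 1) * Re (x \<cdot> vcnj y))"
proof -
  have "(t ^ n)\<^sup>2 = t ^ (2 * n)" by (simp add: mult.commute flip: power_mult)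
  then show ?thesis using assms by (simp add: interaction_def Let_def algebra_simps add_divide_distrib)
qed

text \<open>
  The factor \<open>2\<close> stands for the two indices \<open>n\<close> and \<open>- n\<close>, which contribute equally.
\<close>

lemma form_term_diagonal:
  assumes "n > 0"
  shows "form_term t (a, b) (a, b) n = 2 * pi * (2 * interaction t (fourier a (int n)) (fourier b (int n)) (int n))"
proof -
  define x y where "x = fourier a (int n)" and "y = fourier b (int n)"
  have sq: "Re (z \<cdot> vcnj z) = (norm z)\<^sup>2" for z :: "complex ^ 'a"
    unfolding norm_vec_sq cmod_power2 by (simp add: cdot_def vcnj_def power2_eq_square)
  have "form_term t (a, b) (a, b) n = 8 * pi * real n / (t ^ (2 * n) - 1) * ((norm x)\<^sup>2 + (norm y)\<^sup>2 - t ^ n * Re (x \<cdot> vcnj y) - t ^ n * Re (x \<cdot> vcnj y))"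
    by (simp add: form_term_def sq Re_cdot_vcnj_commute[of y x] flip: x_def y_def)
  also have "\<dots> = 2 * pi * (real n * (4 / (t ^ (2 * n) - 1) * ((norm x)\<^sup>2 + (norm y)\<^sup>2) - 8 * t ^ n / (t ^ (2 * n) - 1) * Re (x \<cdot> vcnj y)))"
    by (simp add: diff_divide_distrib add_divide_distrib algebra_simps)
  finally show ?thesis unfolding interaction_pos[OF assms] x_def y_def .
qed

lemma Re_cdot_fourier_zero: "Re ((fourier b 0 - fourier a 0) \<cdot> (fourier b 0 - fourier a 0)) = (norm (fourier b 0 - fourier a 0))\<^sup>2"
proof -
  have "vcnj (fourier T 0) = fourier T 0" for T :: "'a circle_distr" using fourier_minus[of T 0] by simp
  then have r: "cnj (fourier T 0 $ j) = fourier T 0 $ j" for T :: "'a circle_distr" and j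
    by (simp add: vcnj_def vec_eq_iff)
  have "Im (fourier T 0 $ j) = 0" for T :: "'a circle_distr" and j
    using r[of T j] by (simp add: complex_eq_iff)
  then show ?thesis unfolding norm_vec_sq cmod_power2 by (simp add: cdot_def power2_eq_square)
qed

text \<open>
  The series for the energy is the sum of the series for the quarter Laplacians and an even series of
  interactions. Both formulas of the statement are evaluations of the latter: by its terms with
  \<open>n \<ge> 0\<close>, and as the diagonal of the bilinear form.
\<close>

theorem dirichlet_energy_formula:
  fixes a b :: "complex \<Rightarrow> real ^ 'm::finite"
  assumes t: "t > 1" and ab: "a \<in> H_half" "b \<in> H_half"
    and f: "\<And>\<theta>. f (cis \<theta>) = a (cis \<theta>)" "\<And>\<theta>. f (of_real t * cis \<theta>) = b (cis \<theta>)"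
    and F: "harmonic_extension t f F"
  defines "an \<equiv> fourier (distr_of a)" and "bn \<equiv> fourier (distr_of b)"
  shows "1 / (2 * pi) * dirichlet_energy t F =
            (\<Sum>\<^sub>\<infinity>n\<in>(UNIV :: int set). \<bar>of_int n\<bar> * ((norm (an n))\<^sup>2 + (norm (bn n))\<^sup>2))
            + (norm (bn 0 - an 0))\<^sup>2 / ln t
            + (\<Sum>\<^sub>\<infinity>n\<in>{0 :: nat<..}. real n *
                (4 / (t ^ (2 * n) - 1) * ((norm (an (int n)))\<^sup>2 + (norm (bn (int n)))\<^sup>2)
                 - 8 * t ^ n / (t ^ (2 * n) - 1) * Re (an (int n) \<cdot> vcnj (bn (int n)))))"
    and "1 / (2 * pi) * dirichlet_energy t F =
            1 / (2 * pi) *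
              ((circle_L2_norm (quarter_laplacian a))\<^sup>2 + (circle_L2_norm (quarter_laplacian b))\<^sup>2
               + annulus_form t (distr_of a, distr_of b) (distr_of a, distr_of b))"
proof -
  define D where "D = dirichlet_energy t F"
  define QA QB where "QA = (circle_L2_norm (quarter_laplacian a))\<^sup>2" and "QB = (circle_L2_norm (quarter_laplacian b))\<^sup>2"
  let ?W = "\<lambda>n::int. \<bar>of_int n\<bar> * ((norm (an n))\<^sup>2 + (norm (bn n))\<^sup>2)"
  let ?Z = "\<lambda>n. interaction t (an n) (bn n) n"
  have "((\<lambda>n. 2 * pi * (?W n + ?Z n)) has_sum D) UNIV"
    using dirichlet_energy_modes[OF t ab f F] unfolding sum_mode_energy[OF t] by (simp add: D_def an_def bn_def)
  from has_sum_cmult_right[OF this, of "1 / (2 * pi)"]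
  have DZ: "((\<lambda>n. ?W n + ?Z n) has_sum (1 / (2 * pi) * D)) UNIV" by simp
  have "((\<lambda>n. 2 * pi * (\<bar>of_int n\<bar> * (norm (an n))\<^sup>2) + 2 * pi * (\<bar>of_int n\<bar> * (norm (bn n))\<^sup>2)) has_sum (QA + QB)) UNIV"
    unfolding an_def bn_def QA_def QB_def by (intro has_sum_add quarter_laplacian_norm ab)
  from has_sum_cmult_right[OF this, of "1 / (2 * pi)"]
  have W: "(?W has_sum (1 / (2 * pi) * (QA + QB))) UNIV" by (simp add: distrib_left)
  have "((\<lambda>n. (?W n + ?Z n) + -1 * ?W n) has_sum (1 / (2 * pi) * D + -1 * (1 / (2 * pi) * (QA + QB)))) UNIV"
    by (intro has_sum_add DZ has_sum_cmult_right W)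
  moreover have "(\<lambda>n. (?W n + ?Z n) + -1 * ?W n) = ?Z" by auto
  moreover have "1 / (2 * pi) * D + -1 * (1 / (2 * pi) * (QA + QB)) = 1 / (2 * pi) * D - 1 / (2 * pi) * (QA + QB)" by argo
  ultimately have Z: "(?Z has_sum (1 / (2 * pi) * D - 1 / (2 * pi) * (QA + QB))) UNIV" by (simp only:)
  have even: "?Z (- n) = ?Z n" for n
    unfolding an_def bn_def fourier_minus by (rule interaction_minus)
  note pos = has_sum_even_int[OF Z even]
  have Z0: "?Z 0 = (norm (bn 0 - an 0))\<^sup>2 / ln t" by (simp add: interaction_def)
  have "(\<Sum>\<^sub>\<infinity>n\<in>{0 :: nat<..}. real n *
                (4 / (t ^ (2 * n) - 1) * ((norm (an (int n)))\<^sup>2 + (norm (bn (int n)))\<^sup>2)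
                 - 8 * t ^ n / (t ^ (2 * n) - 1) * Re (an (int n) \<cdot> vcnj (bn (int n)))))
      = (\<Sum>\<^sub>\<infinity>n\<in>{0 :: nat<..}. 2 * ?Z (int n))"
    by (intro infsum_cong) (simp only: interaction_pos greaterThan_iff)
  then show "1 / (2 * pi) * dirichlet_energy t F =
            (\<Sum>\<^sub>\<infinity>n\<in>(UNIV :: int set). ?W n) + (norm (bn 0 - an 0))\<^sup>2 / ln t
            + (\<Sum>\<^sub>\<infinity>n\<in>{0 :: nat<..}. real n *
                (4 / (t ^ (2 * n) - 1) * ((norm (an (int n)))\<^sup>2 + (norm (bn (int n)))\<^sup>2)
                 - 8 * t ^ n / (t ^ (2 * n) - 1) * Re (an (int n) \<cdot> vcnj (bn (int n)))))"
    using infsumI[OF pos] infsumI[OF W] Z0 by (simp only: D_def[symmetric])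
  have "(\<Sum>\<^sub>\<infinity>n\<in>{0<..}. form_term t (distr_of a, distr_of b) (distr_of a, distr_of b) n)
      = (\<Sum>\<^sub>\<infinity>n\<in>{0 :: nat<..}. 2 * pi * (2 * ?Z (int n)))"
    by (intro infsum_cong) (simp only: form_term_diagonal greaterThan_iff an_def bn_def)
  also have "\<dots> = 2 * pi * (1 / (2 * pi) * D - 1 / (2 * pi) * (QA + QB) - ?Z 0)"
    by (rule infsumI) (rule has_sum_cmult_right[OF pos])
  also have "\<dots> = D - (QA + QB) - 2 * pi * ?Z 0" by (simp add: field_simps)
  finally have "annulus_form t (distr_of a, distr_of b) (distr_of a, distr_of b) = D - (QA + QB)"
    unfolding annulus_form_def prod.case Re_cdot_fourier_zero using Z0 by (simp add: an_def bn_def)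
  then show "1 / (2 * pi) * dirichlet_energy t F =
            1 / (2 * pi) *
              ((circle_L2_norm (quarter_laplacian a))\<^sup>2 + (circle_L2_norm (quarter_laplacian b))\<^sup>2
               + annulus_form t (distr_of a, distr_of b) (distr_of a, distr_of b))"
    by (simp add: D_def QA_def QB_def)
qed

theorem lemma1p5:
  fixes t :: real
  assumes "t > 1"
  shows
    "(\<forall>(a :: complex \<Rightarrow> real ^ 'm::finite) b f F.
        a \<in> H_half \<and> b \<in> H_half \<and>
        (\<forall>\<theta>. f (cis \<theta>) = a (cis \<theta>)) \<and> (\<forall>\<theta>. f (of_real t * cis \<theta>) = b (cis \<theta>)) \<and>
        harmonic_extension t f F \<longrightarrow>
        (let an = fourier (distr_of a); bn = fourier (distr_of b) in
          1 / (2 * pi) * dirichlet_energy t F =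
            (\<Sum>\<^sub>\<infinity>n\<in>(UNIV :: int set). \<bar>of_int n\<bar> * ((norm (an n))\<^sup>2 + (norm (bn n))\<^sup>2))
            + (norm (bn 0 - an 0))\<^sup>2 / ln t
            + (\<Sum>\<^sub>\<infinity>n\<in>{0 :: nat<..}. real n *
                (4 / (t ^ (2 * n) - 1) * ((norm (an (int n)))\<^sup>2 + (norm (bn (int n)))\<^sup>2)
                 - 8 * t ^ n / (t ^ (2 * n) - 1) * Re (an (int n) \<cdot> vcnj (bn (int n)))))
          \<and>
          1 / (2 * pi) * dirichlet_energy t F =
            1 / (2 * pi) *
              ((circle_L2_norm (quarter_laplacian a))\<^sup>2 + (circle_L2_norm (quarter_laplacian b))\<^sup>2
               + annulus_form t (distr_of a, distr_of b) (distr_of a, distr_of b)))) \<and>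
     (\<forall>u v :: 'm circle_distr \<times> 'm circle_distr. form_term t u v summable_on {0<..}) \<and>
     bilinear (annulus_form t :: 'm circle_distr \<times> 'm circle_distr \<Rightarrow> _) \<and>
     (\<forall>u v :: 'm circle_distr \<times> 'm circle_distr. annulus_form t u v = annulus_form t v u) \<and>
     compact_bilinear (annulus_form t :: 'm circle_distr \<times> 'm circle_distr \<Rightarrow> _)"
proof (intro conjI allI impI)
  fix u v :: "'m circle_distr \<times> 'm circle_distr"
  show "form_term t u v summable_on {0<..}"
    by (cases u, cases v) (auto intro: has_sum_imp_summable has_sum_form_term[OF assms])
  show "annulus_form t u v = annulus_form t v u" by (rule annulus_form_commute[OF assms])
next
  show "bilinear (annulus_form t :: 'm circle_distr \<times> 'm circle_distr \<Rightarrow> _)" by (rule bilinear_annulus_form[OF assms])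
  show "compact_bilinear (annulus_form t :: 'm circle_distr \<times> 'm circle_distr \<Rightarrow> _)" by (rule compact_annulus_form[OF assms])
next
  fix a b :: "complex \<Rightarrow> real ^ 'm" and f F
  assume h: "a \<in> H_half \<and> b \<in> H_half \<and> (\<forall>\<theta>. f (cis \<theta>) = a (cis \<theta>)) \<and>
      (\<forall>\<theta>. f (of_real t * cis \<theta>) = b (cis \<theta>)) \<and> harmonic_extension t f F"
  then have "a \<in> H_half" "b \<in> H_half" "\<And>\<theta>. f (cis \<theta>) = a (cis \<theta>)" "\<And>\<theta>. f (of_real t * cis \<theta>) = b (cis \<theta>)"
    "harmonic_extension t f F" by auto
  note e = dirichlet_energy_formula[OF assms this]
  show "let an = fourier (distr_of a); bn = fourier (distr_of b) in
          1 / (2 * pi) * dirichlet_energy t F =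
            (\<Sum>\<^sub>\<infinity>n\<in>(UNIV :: int set). \<bar>of_int n\<bar> * ((norm (an n))\<^sup>2 + (norm (bn n))\<^sup>2))
            + (norm (bn 0 - an 0))\<^sup>2 / ln t
            + (\<Sum>\<^sub>\<infinity>n\<in>{0 :: nat<..}. real n *
                (4 / (t ^ (2 * n) - 1) * ((norm (an (int n)))\<^sup>2 + (norm (bn (int n)))\<^sup>2)
                 - 8 * t ^ n / (t ^ (2 * n) - 1) * Re (an (int n) \<cdot> vcnj (bn (int n)))))
          \<and>
          1 / (2 * pi) * dirichlet_energy t F =
            1 / (2 * pi) *
              ((circle_L2_norm (quarter_laplacian a))\<^sup>2 + (circle_L2_norm (quarter_laplacian b))\<^sup>2
               + annulus_form t (distr_of a, distr_of b) (distr_of a, distr_of b))"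
    unfolding Let_def by (rule conjI[OF e])
qed


end
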